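(* Let $n\ge 1$, let $J\subset S=K[x_1,\dots,x_r]$ be a homogeneous ideal, and let $A=S/J$ with Hilbert function $h_A$. Assume that the $n$-binomial expansion of $h_A(n)$ has the form $h_A(n)=\binom{n+1}{n}+(\text{lower terms})$; equivalently, assume that $n+1\le h_A(n)<\binom{n+2}{2}$. Assume further that $h_A(n+1)=h_A(n)^{\langle n\rangle}-1$. Then the base locus of $[J]_n$ in $\mathbb P^{r-1}$ is non-empty, and it is a scheme of dimension either $0$ or $1$. In other words, the dimension of the base locus is either $MG(h_A(n),n)-1$ or $MG(h_A(n),n)$.
   Context: $K$ is an algebraically closed field of arbitrary characteristic, and $S=K[x_1,\dots,x_r]$ has the standard grading. For a homogeneous ideal $J\subset S$, $[J]_t$ is its degree $t$ component and the Hilbert function of $A=S/J$ is $h_A(t)=\dim_K[S/J]_t$. The base locus of $[J]_n$ is the closed subscheme of $\mathbb P^{r-1}=\operatorname{Proj} S$ defined by the ideal generated by $[J]_n$. For positive integers $k,i$, the $i$-binomial expansion of $k$ is the unique expression $k=\binom{k_i}{i}+\binom{k_{i-1}}{i-1}+\dots+\binom{k_j}{j}$ with $k_i>k_{i-1}>\dots>k_j\ge j\ge 1$. One sets $k^{\langle i\rangle}=\binom{k_i+1}{i+1}+\binom{k_{i-1}+1}{i}+\dots+\binom{k_j+1}{j+1}$. The MG-dimension of $k$ in degree $n$ is $MG(k,n)=k_n-n$, where $\binom{k_n}{n}$ is the first term of the $n$-binomial expansion of $k$. *)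

theory Defs
  imports
    "HOL-Algebra.Embedded_Algebras"
    "HOL-Algebra.QuotRing"
    "HOL-Library.Poly_Mapping"
    "HOL-Library.Extended_Real"
    "HOL-Computational_Algebra.Polynomial"
    "HOL-Analysis.Abstract_Topology"
begin

text \<open>Binomial expansions. The list \<open>ks = [k\<^sub>i, k\<^sub>i\<^sub>-\<^sub>1, \<dots>, k\<^sub>j]\<close> is indexed from the top, so its entry at
  position \<open>l\<close> belongs to the lower index \<open>i - l\<close>, and \<open>j = Suc i - length ks\<close>.\<close>

definition is_binom_expansion :: "nat \<Rightarrow> nat \<Rightarrow> nat list \<Rightarrow> bool" where
  "is_binom_expansion i k ks \<longleftrightarrow>
     ks \<noteq> [] \<and> length ks \<le> i \<and> sorted_wrt (>) ks \<and> Suc i - length ks \<le> last ks \<and>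
     k = (\<Sum>l<length ks. (ks ! l) choose (i - l))"

definition binom_expansion :: "nat \<Rightarrow> nat \<Rightarrow> nat list" where
  "binom_expansion i k = (THE ks. is_binom_expansion i k ks)"

definition macaulay_bound :: "nat \<Rightarrow> nat \<Rightarrow> nat" (\<open>_\<^bsup>\<langle>_\<rangle>\<^esup>\<close> [1000, 0] 999) where
  "k\<^bsup>\<langle>i\<rangle>\<^esup> = (let ks = binom_expansion i k in
     \<Sum>l<length ks. Suc (ks ! l) choose Suc (i - l))"

definition MG_dim :: "nat \<Rightarrow> nat \<Rightarrow> int" where
  "MG_dim k n = int (hd (binom_expansion n k)) - int n"

lemma is_binom_expansion_single:
  "is_binom_expansion i k [a] \<longleftrightarrow> 1 \<le> i \<and> i \<le> a \<and> k = a choose i"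
  by (auto simp: is_binom_expansion_def)

lemma is_binom_expansion_Cons:
  assumes "ks \<noteq> []"
  shows "is_binom_expansion (Suc i) k (a # ks) \<longleftrightarrow>
    hd ks < a \<and> (\<exists>k'. k = (a choose Suc i) + k' \<and> is_binom_expansion i k' ks)"
proof -
  obtain b t where ks: "ks = b # t" using assms by (cases ks) auto
  show ?thesis
    unfolding is_binom_expansion_def ks
    by (auto simp: sum.lessThan_Suc_shift simp del: sum.lessThan_Suc)
qed

lemma is_binom_expansion_bounds:
  assumes "is_binom_expansion i k ks"
  shows "i \<le> hd ks \<and> (hd ks choose i) \<le> k \<and> k < (Suc (hd ks) choose i) \<and> 0 < k"
  using assms
proof (induction ks arbitrary: i k)
  case Nil
  then show ?case by (simp add: is_binom_expansion_def)
next
  case (Cons a ks)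
  show ?case
  proof (cases "ks = []")
    case True
    then obtain i' where "i = Suc i'" "i \<le> a" "k = a choose i"
      using Cons.prems by (cases i) (auto simp: is_binom_expansion_single)
    then show ?thesis using True by (simp add: zero_less_binomial_iff)
  next
    case False
    have "1 \<le> i" using Cons.prems by (auto simp: is_binom_expansion_def)
    then obtain i' where i: "i = Suc i'" by (cases i) auto
    then obtain k' where k: "hd ks < a" "k = (a choose i) + k'" "is_binom_expansion i' k' ks"
      using Cons.prems False by (auto simp: is_binom_expansion_Cons)
    have IH: "i' \<le> hd ks" "k' < (Suc (hd ks) choose i')"
      using Cons.IH[OF k(3)] by auto
    have "(Suc (hd ks) choose i') \<le> (a choose i')"
      using k(1) by (intro binomial_right_mono) auto
    then show ?thesis using IH k i by (auto simp: zero_less_binomial_iff)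
  qed
qed

lemma is_binom_expansion_unique:
  assumes "is_binom_expansion i k ks" "is_binom_expansion i k ks'"
  shows "ks = ks'"
  using assms
proof (induction ks arbitrary: i k ks')
  case Nil
  then show ?case by (simp add: is_binom_expansion_def)
next
  case (Cons a ks)
  obtain b t where ks': "ks' = b # t"
    using Cons.prems(2) by (cases ks') (auto simp: is_binom_expansion_def)
  note B = is_binom_expansion_bounds[OF Cons.prems(1)] is_binom_expansion_bounds[OF Cons.prems(2)]
  have "\<not> a < b" "\<not> b < a"
    using B ks' binomial_right_mono[of "Suc a" b i] binomial_right_mono[of "Suc b" a i] by auto
  then have ab: "a = b" by simp
  have "1 \<le> i" using Cons.prems by (auto simp: is_binom_expansion_def)
  then obtain i' where i: "i = Suc i'" by (cases i) auto
  have nil: "us = []" if "is_binom_expansion i (a choose i) (a # us)" for us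
  proof (rule ccontr)
    assume "us \<noteq> []"
    then have "is_binom_expansion i' 0 us"
      using that i by (auto simp: is_binom_expansion_Cons)
    then show False using is_binom_expansion_bounds by blast
  qed
  show ?case
  proof (cases "ks = [] \<or> t = []")
    case True
    then have "k = a choose i"
      using Cons.prems ks' ab by (auto simp: is_binom_expansion_single)
    then show ?thesis using nil Cons.prems ks' ab by auto
  next
    case False
    then show ?thesis
      using Cons.prems Cons.IH ks' ab i by (auto simp: is_binom_expansion_Cons)
  qed
qed

lemma is_binom_expansion_exists:
  assumes "1 \<le> i" "1 \<le> k"
  shows "\<exists>ks. is_binom_expansion i k ks"
  using assms
proof (induction i arbitrary: k)
  case 0
  then show ?case by simp
next
  case (Suc i)
  define A where "A = {a. (a choose Suc i) \<le> k}"
  have "a \<le> k + Suc i" if "a \<in> A" for a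
  proof (rule ccontr)
    assume "\<not> a \<le> k + Suc i"
    then have le: "(Suc k + i choose Suc i) \<le> (a choose Suc i)"
      by (intro binomial_right_mono) simp
    have "k \<le> (k + i choose Suc i)" for k
    proof (induction k)
      case (Suc k)
      have "0 < (k + i choose i)" by (simp add: zero_less_binomial_iff)
      moreover have "(Suc k + i choose Suc i) = (k + i choose i) + (k + i choose Suc i)"
        by (simp only: add_Suc binomial_Suc_Suc)
      ultimately show ?case using Suc by linarith
    qed simp
    from this[of "Suc k"] show False using that le by (simp add: A_def del: binomial_Suc_Suc)
  qed
  then have fin: "finite A" by (metis finite_nat_set_iff_bounded_le)
  have mem: "Suc i \<in> A" using Suc.prems by (simp add: A_def)
  define a where "a = Max A"
  have aA: "a \<in> A" and ge: "Suc i \<le> a" unfolding a_def using fin mem by (auto intro: Max_in)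
  have "Suc a \<notin> A" using Max_ge[OF fin, of "Suc a"] by (auto simp: a_def)
  then have lt: "k < (a choose i) + (a choose Suc i)" by (simp add: A_def)
  define k' where "k' = k - (a choose Suc i)"
  have k: "k = (a choose Suc i) + k'" using aA by (simp add: A_def k'_def)
  show ?case
  proof (cases "k' = 0")
    case True
    then show ?thesis using k ge is_binom_expansion_single[of "Suc i" k a] by auto
  next
    case False
    have "i \<noteq> 0" using lt k False by (intro notI) simp
    then obtain ks where ks: "is_binom_expansion i k' ks"
      using Suc.IH[of k'] False by auto
    have "(hd ks choose i) < (a choose i)"
      using is_binom_expansion_bounds[OF ks] lt k by auto
    then have "hd ks < a"
      using binomial_right_mono[of a "hd ks" i] by (meson leD not_le_imp_less)
    then have "is_binom_expansion (Suc i) k (a # ks)"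
      using ks k by (subst is_binom_expansion_Cons) (auto simp: is_binom_expansion_def)
    then show ?thesis by blast
  qed
qed

lemma is_binom_expansion_binom_expansion:
  assumes "1 \<le> i" "1 \<le> k"
  shows "is_binom_expansion i k (binom_expansion i k)"
  unfolding binom_expansion_def
  by (rule theI') (use is_binom_expansion_exists[OF assms] is_binom_expansion_unique in blast)


text \<open>A monomial is its exponent vector. The variables of \<open>S = K[x\<^sub>1,\<dots>,x\<^sub>r]\<close> carry the
  indices \<open>0, \<dots>, r - 1\<close>.\<close>

type_synonym 'k mpoly = "(nat \<Rightarrow>\<^sub>0 nat) \<Rightarrow>\<^sub>0 'k"

definition mdeg :: "(nat \<Rightarrow>\<^sub>0 nat) \<Rightarrow> nat" where
  "mdeg m = (\<Sum>i\<in>Poly_Mapping.keys m. Poly_Mapping.lookup m i)"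

definition mpoly_ring :: "nat \<Rightarrow> ('k::field) mpoly ring" where
  "mpoly_ring r = \<lparr>carrier = {p. \<forall>m\<in>Poly_Mapping.keys p. Poly_Mapping.keys m \<subseteq> {..<r}},
     monoid.mult = (*), one = 1, ring.zero = 0, add = (+)\<rparr>"

definition const_polys :: "('k::field) mpoly set" where
  "const_polys = range (Poly_Mapping.single 0)"

definition graded_part :: "nat \<Rightarrow> nat \<Rightarrow> ('k::field) mpoly set" where
  "graded_part r d = {p \<in> carrier (mpoly_ring r). \<forall>m\<in>Poly_Mapping.keys p. mdeg m = d}"

lift_definition hom_component :: "nat \<Rightarrow> ('k::field) mpoly \<Rightarrow> 'k mpoly"
  is "\<lambda>d p m. p m when mdeg m = d"
  by (erule finite_subset[rotated]) auto

definition homogeneous_ideal :: "nat \<Rightarrow> ('k::field) mpoly set \<Rightarrow> bool" where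
  "homogeneous_ideal r J \<longleftrightarrow>
     ideal J (mpoly_ring r) \<and> (\<forall>f\<in>J. \<forall>d. hom_component d f \<in> J)"

text \<open>The degree \<open>t\<close> component of \<open>S/J\<close> is the image of the degree \<open>t\<close> component of \<open>S\<close>, and
  \<open>K\<close> acts on it through its image in \<open>S/J\<close>.\<close>

definition hilbert_function :: "nat \<Rightarrow> ('k::field) mpoly set \<Rightarrow> nat \<Rightarrow> nat" where
  "hilbert_function r J t =
     ring.dim (mpoly_ring r Quot J)
       ((\<lambda>f. J +>\<^bsub>mpoly_ring r\<^esub> f) ` const_polys)
       ((\<lambda>f. J +>\<^bsub>mpoly_ring r\<^esub> f) ` graded_part r t)"


definition Proj :: "nat \<Rightarrow> ('k::field) mpoly set set" where
  "Proj r = {P. primeideal P (mpoly_ring r) \<and> homogeneous_ideal r P \<and>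
     \<not> (\<Union>d\<in>{1..}. graded_part r d) \<subseteq> P}"

definition V_plus :: "nat \<Rightarrow> ('k::field) mpoly set \<Rightarrow> 'k mpoly set set" where
  "V_plus r E = {P \<in> Proj r. E \<subseteq> P}"

text \<open>Since \<open>V\<^sub>+(E)\<close> is also \<open>V\<^sub>+\<close> of the ideal generated by \<open>E\<close>, letting \<open>E\<close> run through the sets of
  homogeneous elements gives the same closed sets as the homogeneous ideals do.\<close>

definition zariski :: "nat \<Rightarrow> ('k::field) mpoly set topology" where
  "zariski r = topology (\<lambda>U. \<exists>E \<subseteq> (\<Union>d. graded_part r d). U = Proj r - V_plus r E)"

lemma cring_mpoly_ring: "cring (mpoly_ring r :: ('k::field) mpoly ring)"
proof (rule cringI)
  show "abelian_group (mpoly_ring r :: 'k mpoly ring)"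
  proof (rule abelian_groupI)
    fix x :: "'k mpoly" assume x: "x \<in> carrier (mpoly_ring r)"
    show "\<exists>y\<in>carrier (mpoly_ring r). y \<oplus>\<^bsub>mpoly_ring r\<^esub> x = \<zero>\<^bsub>mpoly_ring r\<^esub>"
      by (rule bexI[of _ "- x"]) (use x in \<open>auto simp: mpoly_ring_def in_keys_iff\<close>)
  next
    fix x y :: "'k mpoly"
    assume "x \<in> carrier (mpoly_ring r)" "y \<in> carrier (mpoly_ring r)"
    then show "x \<oplus>\<^bsub>mpoly_ring r\<^esub> y \<in> carrier (mpoly_ring r)"
      using keys_add[of x y] by (auto simp: mpoly_ring_def)
  qed (auto simp: mpoly_ring_def add_ac)
  show "comm_monoid (mpoly_ring r :: 'k mpoly ring)"
  proof (rule comm_monoidI)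
    fix x y :: "'k mpoly"
    assume xy: "x \<in> carrier (mpoly_ring r)" "y \<in> carrier (mpoly_ring r)"
    have "Poly_Mapping.keys m \<subseteq> {..<r}" if "m \<in> Poly_Mapping.keys (x * y)" for m
    proof -
      obtain a b where "m = a + b" "a \<in> Poly_Mapping.keys x" "b \<in> Poly_Mapping.keys y"
        using \<open>m \<in> Poly_Mapping.keys (x * y)\<close> keys_mult[of x y] by blast
      then show ?thesis using xy keys_add[of a b] by (fastforce simp: mpoly_ring_def)
    qed
    then show "x \<otimes>\<^bsub>mpoly_ring r\<^esub> y \<in> carrier (mpoly_ring r)" by (simp add: mpoly_ring_def)
  qed (auto simp: mpoly_ring_def algebra_simps)
qed (auto simp: mpoly_ring_def algebra_simps)

lemma mdeg_add: "mdeg (a + b) = mdeg a + mdeg b"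
proof -
  have eq: "mdeg m = (\<Sum>i\<in>Poly_Mapping.keys a \<union> Poly_Mapping.keys b. Poly_Mapping.lookup m i)"
    if "Poly_Mapping.keys m \<subseteq> Poly_Mapping.keys a \<union> Poly_Mapping.keys b" for m
    unfolding mdeg_def using that by (intro sum.mono_neutral_left) (auto simp: in_keys_iff)
  show ?thesis using keys_add[of a b] by (simp add: eq lookup_add sum.distrib)
qed

lemma graded_part_mult:
  assumes "e \<in> graded_part r c" "f \<in> graded_part r d"
  shows "e * f \<in> graded_part r (c + d)"
proof -
  interpret cring "mpoly_ring r :: 'a mpoly ring" by (rule cring_mpoly_ring)
  have "e \<otimes>\<^bsub>mpoly_ring r\<^esub> f \<in> carrier (mpoly_ring r)"
    using assms by (intro m_closed) (auto simp: graded_part_def)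
  moreover have "mdeg m = c + d" if m: "m \<in> Poly_Mapping.keys (e * f)" for m
  proof -
    obtain a b where "m = a + b" "a \<in> Poly_Mapping.keys e" "b \<in> Poly_Mapping.keys f"
      using m keys_mult[of e f] by blast
    then show ?thesis using assms by (auto simp: graded_part_def mdeg_add)
  qed
  ultimately show ?thesis by (simp add: graded_part_def mpoly_ring_def)
qed

lemma V_plus_Un:
  assumes "E \<subseteq> (\<Union>d. graded_part r d)" "F \<subseteq> (\<Union>d. graded_part r d)"
  shows "V_plus r E \<union> V_plus r F = V_plus r {e * f |e f. e \<in> E \<and> f \<in> F}"
proof (intro equalityI subsetI)
  have car: "E \<subseteq> carrier (mpoly_ring r)" "F \<subseteq> carrier (mpoly_ring r)"
    using assms by (auto simp: graded_part_def)
  {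
    fix P assume P: "P \<in> V_plus r E \<union> V_plus r F"
    then interpret primeideal P "mpoly_ring r" by (auto simp: V_plus_def Proj_def)
    have "e \<otimes>\<^bsub>mpoly_ring r\<^esub> f \<in> P" if "e \<in> E" "f \<in> F" for e f
      using P that car by (auto simp: V_plus_def intro: I_l_closed I_r_closed)
    then show "P \<in> V_plus r {e * f |e f. e \<in> E \<and> f \<in> F}"
      using P by (auto simp: V_plus_def mpoly_ring_def)
  next
    fix P assume P: "P \<in> V_plus r {e * f |e f. e \<in> E \<and> f \<in> F}"
    then interpret primeideal P "mpoly_ring r" by (auto simp: V_plus_def Proj_def)
    have "e \<in> P \<or> f \<in> P" if "e \<in> E" "f \<in> F" for e f
    proof (rule I_prime)
      have "e * f \<in> P" using P that by (auto simp: V_plus_def)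
      then show "e \<otimes>\<^bsub>mpoly_ring r\<^esub> f \<in> P" by (simp add: mpoly_ring_def)
    qed (use that car in auto)
    then show "P \<in> V_plus r E \<union> V_plus r F" using P by (auto simp: V_plus_def)
  }
qed

lemma istopology_zariski:
  "istopology (\<lambda>U. \<exists>E \<subseteq> (\<Union>d. graded_part r d :: ('k::field) mpoly set). U = Proj r - V_plus r E)"
  unfolding istopology_def
proof (intro conjI allI impI)
  fix U W :: "'k mpoly set set"
  assume "\<exists>E \<subseteq> (\<Union>d. graded_part r d). U = Proj r - V_plus r E"
  then obtain E where E: "E \<subseteq> (\<Union>d. graded_part r d)" "U = Proj r - V_plus r E" by auto
  assume "\<exists>E \<subseteq> (\<Union>d. graded_part r d). W = Proj r - V_plus r E"
  then obtain F where F: "F \<subseteq> (\<Union>d. graded_part r d)" "W = Proj r - V_plus r F" by auto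
  let ?EF = "{e * f |e f. e \<in> E \<and> f \<in> F}"
  have "?EF \<subseteq> (\<Union>d. graded_part r d)"
  proof
    fix p assume "p \<in> ?EF"
    then obtain e f where p: "p = e * f" "e \<in> E" "f \<in> F" by auto
    then obtain c d where "e \<in> graded_part r c" "f \<in> graded_part r d"
      using E(1) F(1) by (meson UN_E subsetD)
    then show "p \<in> (\<Union>d. graded_part r d)" using graded_part_mult p(1) by (meson UN_I UNIV_I)
  qed
  moreover have "U \<inter> W = Proj r - V_plus r ?EF"
    unfolding V_plus_Un[OF E(1) F(1), symmetric] E(2) F(2) by (simp only: Diff_Un)
  ultimately show "\<exists>E \<subseteq> (\<Union>d. graded_part r d). U \<inter> W = Proj r - V_plus r E"
    by (intro exI[of _ ?EF] conjI)
next
  fix \<U> :: "'k mpoly set set set"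
  assume "\<forall>U\<in>\<U>. \<exists>E \<subseteq> (\<Union>d. graded_part r d). U = Proj r - V_plus r E"
  then obtain E where "\<forall>U\<in>\<U>. E U \<subseteq> (\<Union>d. graded_part r d) \<and> U = Proj r - V_plus r (E U)"
    by (rule bchoice[THEN exE])
  then have E: "\<And>U. U \<in> \<U> \<Longrightarrow> E U \<subseteq> (\<Union>d. graded_part r d)"
    "\<And>U. U \<in> \<U> \<Longrightarrow> U = Proj r - V_plus r (E U)" by auto
  have "\<Union>\<U> = (\<Union>U\<in>\<U>. Proj r - V_plus r (E U))"
    using E(2) by (metis (no_types, lifting) SUP_cong SUP_identity_eq)
  also have "\<dots> = Proj r - V_plus r (\<Union>U\<in>\<U>. E U)" by (auto simp: V_plus_def)
  finally have eq: "\<Union>\<U> = Proj r - V_plus r (\<Union>U\<in>\<U>. E U)" .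
  moreover have "(\<Union>U\<in>\<U>. E U) \<subseteq> (\<Union>d. graded_part r d)" using E(1) by (rule UN_least)
  ultimately show "\<exists>E \<subseteq> (\<Union>d. graded_part r d). \<Union>\<U> = Proj r - V_plus r E"
    by (intro exI[of _ "\<Union>U\<in>\<U>. E U"] conjI)
qed

lemma openin_zariski:
  "openin (zariski r) U \<longleftrightarrow> (\<exists>E \<subseteq> (\<Union>d. graded_part r d). U = Proj r - V_plus r E)"
  unfolding zariski_def by (simp add: topology_inverse'[OF istopology_zariski])

lemma topspace_zariski: "topspace (zariski r :: ('k::field) mpoly set topology) = Proj r"
proof
  show "topspace (zariski r :: 'k mpoly set topology) \<subseteq> Proj r"
    using openin_topspace[of "zariski r :: 'k mpoly set topology"]
    unfolding openin_zariski by blast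
  have one: "(1 :: 'k mpoly) \<in> graded_part r 0"
    by (auto simp: graded_part_def mpoly_ring_def mdeg_def)
  have "P \<notin> V_plus r {1 :: 'k mpoly}" if "P \<in> Proj r" for P
  proof
    assume P: "P \<in> V_plus r {1}"
    interpret primeideal P "mpoly_ring r" using that by (simp add: Proj_def)
    have "\<one>\<^bsub>mpoly_ring r\<^esub> \<in> P" using P by (simp add: V_plus_def mpoly_ring_def)
    then show False using one_imp_carrier I_notcarr by simp
  qed
  then have "openin (zariski r) (Proj r :: 'k mpoly set set)"
    unfolding openin_zariski by (intro exI[of _ "{1}"]) (use one in auto)
  then show "(Proj r :: 'k mpoly set set) \<subseteq> topspace (zariski r)" by (rule openin_subset)
qed

text \<open>The underlying set of the base locus, the closed subscheme of \<open>Proj S\<close> cut out by the ideal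
  generated by the degree \<open>n\<close> part of \<open>J\<close>. Being non-empty and the dimension of a scheme depend on the
  underlying space alone, so no structure sheaf is needed.\<close>

definition base_locus :: "nat \<Rightarrow> ('k::field) mpoly set \<Rightarrow> nat \<Rightarrow> 'k mpoly set set" where
  "base_locus r J n = V_plus r (genideal (mpoly_ring r) (J \<inter> graded_part r n))"


definition irreducible_in :: "'a topology \<Rightarrow> 'a set \<Rightarrow> bool" where
  "irreducible_in T Z \<longleftrightarrow> Z \<noteq> {} \<and> Z \<subseteq> topspace T \<and>
     (\<forall>A B. closedin T A \<longrightarrow> closedin T B \<longrightarrow> Z \<subseteq> A \<union> B \<longrightarrow> Z \<subseteq> A \<or> Z \<subseteq> B)"

text \<open>The empty space has dimension \<open>-\<infinity>\<close>.\<close>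

definition krull_dim :: "'a topology \<Rightarrow> ereal" where
  "krull_dim T = Sup {ereal (real l) |l. \<exists>Z.
     (\<forall>i\<le>l. closedin T (Z i) \<and> irreducible_in T (Z i)) \<and> (\<forall>i<l. Z i \<subset> Z (Suc i))}"

definition base_locus_dim :: "nat \<Rightarrow> ('k::field) mpoly set \<Rightarrow> nat \<Rightarrow> ereal" where
  "base_locus_dim r J n = krull_dim (subtopology (zariski r) (base_locus r J n))"

end

theory Submission
  imports Defs
begin

text \<open>The proof dualises everything. The pairing of forms of degree \<open>t\<close> turns the degree \<open>t\<close> part of
  \<open>S/J\<close> into a space of forms on which the variables act by contraction, and the ideal generated by
  \<open>[J]\<^sub>n\<close> becomes the largest family \<open>M\<^sub>t\<close> (\<open>t \<ge> n\<close>) closed under contraction with \<open>M\<^sub>n = [J]\<^sub>n\<^sup>\<bottom>\<close>.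
  The base locus is non-empty iff all \<open>M\<^sub>t\<close> are non-zero. Write \<open>\<delta>\<close> for the number of terms
  \<open>i + 1\<close> over \<open>i\<close> in the expansion of \<open>h = h\<^sub>A(n)\<close>, so that \<open>dim M\<^sub>n\<^sub>+\<^sub>1 \<ge> h + \<delta> - 1\<close>.

  A generic linear form \<open>\<ell>\<close> has a kernel of dimension at most \<open>\<delta>\<close> on \<open>M\<^sub>n\<close> (Green's theorem in this
  range). Hence either \<open>\<ell>\<close> or the kernel shows maximal growth, which then persists, or \<open>\<ell>\<close> maps
  \<open>M\<^sub>n\<^sub>+\<^sub>1\<close> onto \<open>M\<^sub>n\<close>. In the last case \<open>\<ell>\<close> is onto in all lower degrees too, \<open>h\<close> is the sum of the
  dimensions of the kernels of \<open>\<ell>\<close> in degrees up to \<open>n\<close>, and the bound on \<open>h\<close> leaves two possibilities: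
  a kernel grows maximally in some degree below \<open>n\<close>, or \<open>[J]\<^sub>n\<close> lies in an ideal generated by fewer
  than \<open>r\<close> forms, which have a common zero.

  For the dimension, \<open>dim M\<^sub>t\<close> grows at most linearly in \<open>t\<close>, whereas a chain of three homogeneous
  primes in the base locus would give quadratic growth.\<close>

text \<open>One count carries the argument. If infinitely many forms of a one-parameter family each
  kill \<open>s\<close> dimensions of a space of forms of degree \<open>n\<close>, the kernels,
  pushed down one after the other, force that space to have at least
  \<open>\<Sum>j\<le>n. min s (j + 1)\<close> dimensions. This is the Hilbert function of a plane
  curve of degree \<open>s\<close>, and for \<open>s = \<delta> + 1\<close> it is the strict upper
  bound that the expansion imposes on \<open>h\<close>. The case \<open>s = 1\<close> makes a
  generic form injective as long as the dimension does not exceed the degree; Macaulay's bound and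
  persistence follow in that range. The obstacle is the missing dimension: growth of
  \<open>M\<close> may be one short of maximal, so persistence does not apply to \<open>M\<close>
  itself. The loss sits in the image of \<ell> or in its kernel. In the first case the kernel
  persists. In the second \<ell> is onto, and unless its kernels stabilise below degree
  \<open>n\<close>, the numbers force the inverse system generated by \<open>M\<close> to look like
  that of a plane curve of degree \<open>\<delta> + 1\<close> with one more condition in degree
  \<open>n\<close>. Linear forms cutting out the plane and these two conditions make fewer than
  \<open>r\<close> forms.\<close>

section \<open>Linear algebra of finite-dimensional subspaces\<close>

locale lin_space = vs: vector_space scale for scale :: "'a::field \<Rightarrow> 'b::ab_group_add \<Rightarrow> 'b"
begin

sublocale vs2: vector_space_pair scale scale by unfold_locales

abbreviation lin :: "('b \<Rightarrow> 'b) \<Rightarrow> bool" where "lin \<equiv> Vector_Spaces.linear scale scale"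

text \<open>Polynomials form an infinite-dimensional space, and \<open>vs.dim\<close> is informative
  only inside the span of a finite set.\<close>

definition fin_dim :: "'b set \<Rightarrow> bool" where
  "fin_dim V \<longleftrightarrow> (\<exists>B. finite B \<and> V \<subseteq> vs.span B)"

lemma fin_dim_mono: "fin_dim W \<Longrightarrow> V \<subseteq> W \<Longrightarrow> fin_dim V"
  unfolding fin_dim_def by blast

lemma fin_dim_basis:
  assumes "fin_dim V"
  obtains B where "finite B" "B \<subseteq> V" "vs.independent B" "V \<subseteq> vs.span B" "card B = vs.dim V"
proof -
  obtain A where A: "finite A" "V \<subseteq> vs.span A" using assms fin_dim_def by auto
  obtain B where B: "B \<subseteq> V" "vs.independent B" "V \<subseteq> vs.span B" "card B = vs.dim V" by (rule vs.basis_exists)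
  then have "finite B" using vs.independent_span_bound[OF A(1)] A(2) by blast
  then show ?thesis using that B by blast
qed

lemma independent_card_le_fin_dim:
  assumes "fin_dim V" "B \<subseteq> V" "vs.independent B"
  shows "finite B" "card B \<le> vs.dim V"
proof -
  obtain A where A: "finite A" "A \<subseteq> V" "vs.independent A" "V \<subseteq> vs.span A" "card A = vs.dim V"
    using fin_dim_basis[OF assms(1)] by blast
  then show "finite B" "card B \<le> vs.dim V"
    using vs.independent_span_bound[OF A(1) assms(3)] assms(2) by auto
qed

lemma dim_mono_fin: "fin_dim W \<Longrightarrow> V \<subseteq> W \<Longrightarrow> vs.dim V \<le> vs.dim W"
proof -
  assume W: "fin_dim W" "V \<subseteq> W"
  obtain B where "finite B" "B \<subseteq> V" "vs.independent B" "V \<subseteq> vs.span B" "card B = vs.dim V"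
    using fin_dim_basis[OF fin_dim_mono[OF W]] by blast
  then show ?thesis using independent_card_le_fin_dim(2)[OF W(1), of B] W(2) by simp
qed

lemma subspace_eqI_dim:
  assumes "vs.subspace V" "V \<subseteq> W" "fin_dim W" "vs.dim W \<le> vs.dim V"
  shows "V = W"
proof
  obtain B where B: "finite B" "B \<subseteq> V" "vs.independent B" "V \<subseteq> vs.span B" "card B = vs.dim V"
    using fin_dim_basis[OF fin_dim_mono[OF assms(3,2)]] by blast
  show "W \<subseteq> V"
  proof
    fix w assume w: "w \<in> W"
    show "w \<in> V"
    proof (rule ccontr)
      assume "w \<notin> V"
      then have n: "w \<notin> vs.span B" using vs.span_minimal[OF B(2) assms(1)] by auto
      then have "vs.independent (insert w B)" using B(3) by (simp add: vs.independent_insertI)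
      moreover have "insert w B \<subseteq> W" using B(2) assms(2) w by auto
      ultimately have "card (insert w B) \<le> vs.dim W" using independent_card_le_fin_dim[OF assms(3)] by blast
      moreover have "w \<notin> B" using n vs.span_base by blast
      ultimately show False using B(1,5) assms(4) by simp
    qed
  qed
qed fact

lemma dim_zero_space: "vs.dim {0} = 0"
  by (rule vs.dim_unique[of "{}"]) (auto simp: vs.independent_empty)

lemma dim_eq_0_fin:
  assumes "fin_dim V" "vs.dim V = 0"
  shows "V \<subseteq> {0}"
proof -
  obtain B where B: "finite B" "B \<subseteq> V" "vs.independent B" "V \<subseteq> vs.span B" "card B = vs.dim V"
    by (rule fin_dim_basis[OF assms(1)])
  have "B = {}" using assms(2) B(1,5) by simp
  then show ?thesis using B(4) by (simp add: vs.span_empty)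
qed

lemma dim_pos_iff:
  assumes "vs.subspace V" "fin_dim V"
  shows "0 < vs.dim V \<longleftrightarrow> (\<exists>v\<in>V. v \<noteq> 0)"
proof
  assume "0 < vs.dim V"
  then have "V \<noteq> {0}" using dim_zero_space by auto
  then show "\<exists>v\<in>V. v \<noteq> 0" using vs.subspace_0[OF assms(1)] by blast
next
  assume "\<exists>v\<in>V. v \<noteq> 0"
  then show "0 < vs.dim V" using dim_eq_0_fin[OF assms(2)] by (auto intro: gr0I)
qed

lemma exists_subspace_dim:
  assumes "vs.subspace W" "fin_dim W" "k \<le> vs.dim W"
  obtains V where "vs.subspace V" "V \<subseteq> W" "vs.dim V = k"
proof -
  obtain B where B: "finite B" "B \<subseteq> W" "vs.independent B" "W \<subseteq> vs.span B" "card B = vs.dim W"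
    using fin_dim_basis[OF assms(2)] by blast
  obtain C where C: "C \<subseteq> B" "card C = k" using assms(3) B(5) by (metis obtain_subset_with_card_n)
  have "vs.dim (vs.span C) = k" using C B(3) vs.independent_mono vs.dim_span_eq_card_independent by blast
  moreover have "vs.span C \<subseteq> W" using C B(2) assms(1) by (meson vs.span_minimal subset_trans)
  ultimately show ?thesis using that vs.subspace_span by blast
qed

lemma rank_nullity:
  assumes f: "lin f" and W: "vs.subspace W" "fin_dim W"
  shows "vs.dim W = vs.dim {w\<in>W. f w = 0} + vs.dim (f ` W)" "fin_dim (f ` W)"
proof -
  interpret f: Vector_Spaces.linear scale scale f by fact
  let ?N = "{w\<in>W. f w = 0}"
  have N: "vs.subspace ?N" using W(1)
    by (auto simp: vs.subspace_def f.add f.scale)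
  obtain B where B: "finite B" "B \<subseteq> ?N" "vs.independent B" "?N \<subseteq> vs.span B" "card B = vs.dim ?N"
    using fin_dim_basis[OF fin_dim_mono[OF W(2), of ?N]] by auto
  obtain E where E: "B \<subseteq> E" "E \<subseteq> W" "vs.independent E" "W \<subseteq> vs.span E"
    using vs.maximal_independent_subset_extend[of B W] B by blast
  have finE: "finite E" using independent_card_le_fin_dim[OF W(2) E(2,3)] by simp
  have dW: "vs.dim W = card E" using vs.basis_card_eq_dim[OF E(2,4,3)] by simp
  let ?C = "E - B"
  \<comment> \<open>\<open>g\<close> kills the kernel and fixes the span of the complement
    \<open>?C\<close>, so the two meet only in zero; this is what makes \<open>f\<close> injective
    on the span of \<open>?C\<close>.\<close>
  obtain g where g: "lin g" "\<forall>x\<in>E. g x = (if x \<in> B then 0 else x)"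
    using vs2.linear_independent_extend[OF E(3), of "\<lambda>b. if b \<in> B then 0 else b"] by auto
  interpret g: Vector_Spaces.linear scale scale g by (rule g(1))
  have gB: "g x = 0" if "x \<in> vs.span B" for x
    by (rule g.eq_0_on_span[OF _ that]) (use g(2) E(1) in auto)
  have gC: "g x = x" if "x \<in> vs.span ?C" for x
    by (rule vs2.linear_eq_on_span[OF g(1) vs.linear_ident _ that]) (use g(2) in auto)
  have inj: "inj_on f (vs.span ?C)"
  proof (rule inj_onI)
    fix x y assume xy: "x \<in> vs.span ?C" "y \<in> vs.span ?C" "f x = f y"
    have sp: "x - y \<in> vs.span ?C" using xy vs.span_diff by blast
    then have "x - y \<in> W" using vs.span_minimal[of ?C W] E(2) W(1) by blast
    then have "x - y \<in> ?N" using xy by (simp add: f.diff)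
    then have "g (x - y) = 0" using gB B(4) by blast
    then show "x = y" using gC[OF sp] by simp
  qed
  have indC: "vs.independent ?C" using E(3) vs.independent_mono by blast
  have ind: "vs.independent (f ` ?C)" by (rule f.independent_injective_image[OF indC inj])
  have card: "card (f ` ?C) = card ?C"
    by (rule card_image) (meson inj inj_on_subset vs.span_superset)
  have "vs.span E = W" using E(2,4) W(1) vs.span_minimal by blast
  then have "f ` W = vs.span (f ` E)" using f.span_image by metis
  also have "\<dots> = vs.span (f ` ?C)"
  proof (rule subset_antisym)
    show "vs.span (f ` E) \<subseteq> vs.span (f ` ?C)"
    proof (rule vs.span_minimal)
      show "f ` E \<subseteq> vs.span (f ` ?C)"
      proof
        fix y assume "y \<in> f ` E"
        then obtain e where e: "e \<in> E" "y = f e" by auto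
        show "y \<in> vs.span (f ` ?C)"
        proof (cases "e \<in> B")
          case True
          then have "y = 0" using B(2) e by auto
          then show ?thesis by (simp add: vs.span_zero)
        next
          case False
          then show ?thesis using e by (auto intro: vs.span_base)
        qed
      qed
    qed simp
  qed (rule vs.span_mono, blast)
  finally have im: "f ` W = vs.span (f ` ?C)" .
  then have "vs.dim (f ` W) = card ?C"
    using ind card by (metis vs.dim_span_eq_card_independent)
  moreover have "card E = card B + card ?C"
    using E(1) finE by (metis card_mono card_Diff_subset B(1) le_add_diff_inverse)
  ultimately show "vs.dim W = vs.dim ?N + vs.dim (f ` W)" using dW B(5) by simp
  show "fin_dim (f ` W)" unfolding fin_dim_def using im finE by (metis finite_Diff finite_imageI order_refl)
qed

lemma dim_image_le_fin:
  assumes "lin f" "vs.subspace W" "fin_dim W"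
  shows "vs.dim (f ` W) \<le> vs.dim W"
  using rank_nullity[OF assms] by simp

lemma dim_kernel_ge:
  assumes f: "lin f" and W: "vs.subspace W" "fin_dim W" and U: "f ` W \<subseteq> U" "fin_dim U"
  shows "vs.dim W \<le> vs.dim {w\<in>W. f w = 0} + vs.dim U"
  using rank_nullity[OF f W] dim_mono_fin[OF U(2,1)] by linarith

text \<open>\<open>q\<close> serves as the quotient map by \<open>V\<close> without leaving the
  type: it is the projection onto a complement along \<open>V\<close>.\<close>

lemma exists_linear_with_kernel:
  assumes "vs.subspace V"
  obtains q where "lin q" "\<And>x. q x = 0 \<longleftrightarrow> x \<in> V"
proof -
  obtain B where B: "B \<subseteq> V" "vs.independent B" "V \<subseteq> vs.span B" "card B = vs.dim V"
    by (rule vs.basis_exists)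
  obtain E where E: "B \<subseteq> E" "vs.independent E" "UNIV \<subseteq> vs.span E"
    by (rule vs.maximal_independent_subset_extend[OF subset_UNIV B(2)])
  obtain q where q: "lin q" "\<forall>x\<in>E. q x = (if x \<in> B then 0 else x)"
    using vs2.linear_independent_extend[OF E(2), of "\<lambda>b. if b \<in> B then 0 else b"] by auto
  interpret q: Vector_Spaces.linear scale scale q by (rule q(1))
  have qB: "q x = 0" if "x \<in> vs.span B" for x
    by (rule q.eq_0_on_span[OF _ that]) (use q(2) E(1) in auto)
  have qC: "q x = x" if "x \<in> vs.span (E - B)" for x
    by (rule vs2.linear_eq_on_span[OF q(1) vs.linear_ident _ that]) (use q(2) in auto)
  have "q x = 0 \<longleftrightarrow> x \<in> V" for x
  proof
    assume "x \<in> V" then show "q x = 0" using qB B(3) by blast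
  next
    assume x0: "q x = 0"
    have "B \<union> (E - B) = E" using E(1) by blast
    then have "x \<in> vs.span (B \<union> (E - B))" using E(3) by auto
    then obtain a b where ab: "x = a + b" "a \<in> vs.span B" "b \<in> vs.span (E - B)" unfolding vs.span_Un by blast
    then have "b = 0" using x0 qB qC by (simp add: q.add)
    then have "x \<in> vs.span B" using ab by simp
    then show "x \<in> V" using vs.span_minimal[OF B(1) assms] by blast
  qed
  then show ?thesis using that q(1) by blast
qed

text \<open>Both statements say that \<open>f\<close> induces an injection from \<open>S\<close> modulo the preimage of \<open>V\<close> into
  \<open>W\<close> modulo \<open>V\<close>.\<close>

lemma dim_preimage_le:
  assumes f: "lin f" and S: "vs.subspace S" "fin_dim S"
    and W: "vs.subspace W" "fin_dim W" and V: "vs.subspace V" "V \<subseteq> W" and im: "f ` S \<subseteq> W"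
  shows "vs.dim V + vs.dim S \<le> vs.dim W + vs.dim {s\<in>S. f s \<in> V}"
proof -
    obtain q where q: "lin q" "\<And>x. q x = 0 \<longleftrightarrow> x \<in> V"
    using exists_linear_with_kernel[OF V(1)] by blast
  have qf: "lin (q \<circ> f)" using Vector_Spaces.linear_compose[OF f q(1)] .
  have "{w \<in> W. q w = 0} = V" using q(2) V(2) by auto
  then have 1: "vs.dim W = vs.dim V + vs.dim (q ` W)" "fin_dim (q ` W)" using rank_nullity[OF q(1) W] by auto
  have 2: "vs.dim S = vs.dim {s\<in>S. f s \<in> V} + vs.dim ((q \<circ> f) ` S)"
    using rank_nullity[OF qf S] q(2) by simp
  have "vs.dim ((q \<circ> f) ` S) \<le> vs.dim (q ` W)"
    by (rule dim_mono_fin[OF 1(2)]) (use im in auto)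
  then show ?thesis using 1 2 by simp
qed

lemma dim_sum_image_le:
  assumes f: "lin f" and S: "vs.subspace S" "fin_dim S"
    and V: "vs.subspace V" "fin_dim V" and W: "vs.subspace W" "fin_dim W" "W \<subseteq> {v + f s | v s. v \<in> V \<and> s \<in> S}"
    and VW: "V \<subseteq> W"
  shows "vs.dim W + vs.dim {s\<in>S. f s \<in> V} \<le> vs.dim V + vs.dim S"
proof -
    obtain q where q: "lin q" "\<And>x. q x = 0 \<longleftrightarrow> x \<in> V"
    using exists_linear_with_kernel[OF V(1)] by blast
  interpret q: Vector_Spaces.linear scale scale q by (rule q(1))
  have qf: "lin (q \<circ> f)" using Vector_Spaces.linear_compose[OF f q(1)] .
  have "{w \<in> W. q w = 0} = V" using q(2) VW by auto
  then have 1: "vs.dim W = vs.dim V + vs.dim (q ` W)" using rank_nullity[OF q(1) W(1,2)] by auto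
  have 2: "vs.dim S = vs.dim {s\<in>S. f s \<in> V} + vs.dim ((q \<circ> f) ` S)" "fin_dim ((q \<circ> f) ` S)"
    using rank_nullity[OF qf S] q(2) by auto
  have "q ` W \<subseteq> (q \<circ> f) ` S"
  proof
    fix y assume "y \<in> q ` W"
    then obtain v s where "y = q (v + f s)" "v \<in> V" "s \<in> S" using W(3) by blast
    then show "y \<in> (q \<circ> f) ` S" using q(2)[of v] by (auto simp: q.add)
  qed
  then have "vs.dim (q ` W) \<le> vs.dim ((q \<circ> f) ` S)" by (rule dim_mono_fin[OF 2(2)])
  then show ?thesis using 1 2 by simp
qed

end

section \<open>Polynomials as a graded vector space\<close>

abbreviation lookup :: "('a \<Rightarrow>\<^sub>0 'b::zero) \<Rightarrow> 'a \<Rightarrow> 'b" where "lookup \<equiv> Poly_Mapping.lookup"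
abbreviation single :: "'a \<Rightarrow> 'b \<Rightarrow> ('a \<Rightarrow>\<^sub>0 'b::zero)" where "single \<equiv> Poly_Mapping.single"
abbreviation keys :: "('a \<Rightarrow>\<^sub>0 'b::zero) \<Rightarrow> 'a set" where "keys \<equiv> Poly_Mapping.keys"

definition smul :: "'k::field \<Rightarrow> 'k mpoly \<Rightarrow> 'k mpoly" where
  "smul c p = single 0 c * p"

global_interpretation mp: lin_space "smul :: 'k::field \<Rightarrow> 'k mpoly \<Rightarrow> 'k mpoly"
  by unfold_locales (simp_all add: smul_def algebra_simps single_add mult_single flip: mult.assoc)

abbreviation psubspace :: "('k::field) mpoly set \<Rightarrow> bool" where "psubspace \<equiv> mp.vs.subspace"
abbreviation pdim :: "('k::field) mpoly set \<Rightarrow> nat" where "pdim \<equiv> mp.vs.dim"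
abbreviation pspan :: "('k::field) mpoly set \<Rightarrow> 'k mpoly set" where "pspan \<equiv> mp.vs.span"
abbreviation pindep :: "('k::field) mpoly set \<Rightarrow> bool" where "pindep \<equiv> mp.vs.independent"

lemma lookup_single_mult: "lookup (single a c * p) (m + a) = c * lookup p m"
  for p :: "('k::field) mpoly"
proof -
  have "lookup (single a c * p) (m + a) = (\<Sum>l. (c * (\<Sum>q. lookup p q when m + a = l + q)) when l = a)"
    by (simp add: lookup_mult lookup_single when_mult eq_commute[of a])
  then show ?thesis by (simp add: add.commute[of m] eq_commute[of m])
qed

lemma keys_single_mult: "keys (single a c * p) \<subseteq> (\<lambda>m. m + a) ` keys p"
  for p :: "('k::field) mpoly"
  using keys_mult[of "single a c" p] by (auto simp: add.commute split: if_splits)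

lemma lookup_smul [simp]: "lookup (smul c p) m = c * lookup p m"
  using lookup_single_mult[of 0 c p m] by (simp add: smul_def)

lemma smul_mult_left: "smul c p * q = smul c (p * q)"
  by (simp add: smul_def mult.assoc)

lemma smul_mult_right: "p * smul c q = smul c (p * q)"
  by (simp add: smul_def mult.left_commute)

lemma linI:
  assumes "\<And>p q. f (p + q) = f p + f q" "\<And>c p. f (smul c p) = smul c (f p)"
  shows "mp.lin f"
  using assms by unfold_locales

lemma lin_mult: "mp.lin ((*) f)"
  by (rule linI) (simp_all add: algebra_simps smul_mult_right)

definition mons :: "nat \<Rightarrow> nat \<Rightarrow> (nat \<Rightarrow>\<^sub>0 nat) set" where
  "mons r d = {m. keys m \<subseteq> {..<r} \<and> mdeg m = d}"

lemma graded_part_iff: "p \<in> graded_part r d \<longleftrightarrow> keys p \<subseteq> mons r d"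
  by (auto simp: graded_part_def mpoly_ring_def mons_def)

lemma mdeg_single [simp]: "mdeg (single i k) = k"
  by (simp add: mdeg_def)

lemma mdeg_zero [simp]: "mdeg 0 = 0"
  by (simp add: mdeg_def)

lemma mons_0 [simp]: "mons r 0 = {0}"
proof -
  have "m = 0" if "mdeg m = 0" for m
  proof (rule poly_mapping_eqI)
    fix i show "lookup m i = lookup 0 i"
      using that by (cases "i \<in> keys m") (auto simp: mdeg_def in_keys_iff)
  qed
  then show ?thesis by (auto simp: mons_def)
qed

lemma mons_add:
  assumes "a \<in> mons r c" "b \<in> mons r d"
  shows "a + b \<in> mons r (c + d)"
  using assms keys_add[of a b] by (auto simp: mons_def mdeg_add)

lemma mons_single: "i < r \<Longrightarrow> single i 1 \<in> mons r 1"
  by (simp add: mons_def)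

lemma mons_remove:
  assumes "m \<in> mons r (Suc d)" "i \<in> keys m"
  obtains m' where "m = m' + single i 1" "m' \<in> mons r d" "i < r"
proof -
  let ?m = "m - single i 1"
  have eq: "m = ?m + single i 1"
  proof (rule poly_mapping_eqI)
    fix j show "lookup m j = lookup (?m + single i 1) j"
      using assms(2) by (auto simp: lookup_add lookup_minus lookup_single in_keys_iff when_def)
  qed
  then have "mdeg m = mdeg ?m + 1" by (metis mdeg_add mdeg_single)
  moreover have "keys ?m \<subseteq> keys m" by (auto simp: in_keys_iff lookup_minus)
  ultimately have "?m \<in> mons r d" using assms(1) by (auto simp: mons_def)
  then show ?thesis using that eq assms by (auto simp: mons_def)
qed

lemma mons_Suc_cases:
  assumes "m \<in> mons r (Suc d)"
  obtains i m' where "i < r" "m' \<in> mons r d" "m = m' + single i 1"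
proof -
  have "keys m \<noteq> {}" using assms by (auto simp: mons_def mdeg_def)
  then obtain i where "i \<in> keys m" by blast
  then show ?thesis using mons_remove[OF assms] that by blast
qed

lemma finite_mons: "finite (mons r d)"
proof (induction d)
  case (Suc d)
  have "mons r (Suc d) \<subseteq> (\<Union>i<r. (\<lambda>m. m + single i 1) ` mons r d)"
    by (auto elim!: mons_Suc_cases)
  then show ?case using Suc by (meson finite_UN_I finite_imageI finite_lessThan finite_subset)
qed simp

lemma subspace_graded_part: "psubspace (graded_part r d)"
  unfolding mp.vs.subspace_def
proof (intro conjI allI ballI)
  fix p q :: "'a mpoly" assume "p \<in> graded_part r d" "q \<in> graded_part r d"
  then show "p + q \<in> graded_part r d" using keys_add[of p q] unfolding graded_part_iff by blast
next
  fix c and p :: "'a mpoly" assume "p \<in> graded_part r d"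
  then show "smul c p \<in> graded_part r d" unfolding graded_part_iff by (auto simp: in_keys_iff)
qed (simp add: graded_part_iff)

lemma mpoly_eq_sum_mons:
  assumes "finite A" "keys p \<subseteq> A"
  shows "p = (\<Sum>m\<in>A. smul (lookup p m) (single m 1))"
proof (rule poly_mapping_eqI)
  fix k
  have "(\<Sum>m\<in>A. lookup p m * (1 when m = k)) = (\<Sum>m\<in>A. if m = k then lookup p k else 0)"
    by (rule sum.cong) (auto simp: when_def)
  then show "lookup p k = lookup (\<Sum>m\<in>A. smul (lookup p m) (single m 1)) k"
    using assms by (auto simp: lookup_sum lookup_single in_keys_iff)
qed

lemma fin_dim_graded_part: "mp.fin_dim (graded_part r d :: ('k::field) mpoly set)"
proof -
  have "p \<in> pspan ((\<lambda>m. single m 1) ` mons r d)" if "p \<in> graded_part r d" for p :: "'k mpoly"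
  proof -
    have "(\<Sum>m\<in>mons r d. smul (lookup p m) (single m 1)) \<in> pspan ((\<lambda>m. single m 1) ` mons r d)"
      by (intro mp.vs.span_sum mp.vs.span_scale mp.vs.span_base) auto
    then show ?thesis
      using mpoly_eq_sum_mons[OF finite_mons] that by (metis graded_part_iff)
  qed
  then show ?thesis unfolding mp.fin_dim_def using finite_mons by (metis finite_imageI subsetI)
qed

lemma fin_dim_subset_graded: "V \<subseteq> graded_part r d \<Longrightarrow> mp.fin_dim V"
  using mp.fin_dim_mono fin_dim_graded_part by blast

lemma single_in_graded_part: "m \<in> mons r d \<Longrightarrow> single m c \<in> graded_part r d"
  by (simp add: graded_part_iff)

section \<open>The pairing\<close>

text \<open>The monomials are made their own dual basis. No factorials occur, unlike in the pairing
  by differentiation, so the pairing is perfect on every graded part in every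
  characteristic.\<close>

definition pair :: "('k::field) mpoly \<Rightarrow> 'k mpoly \<Rightarrow> 'k" where
  "pair p q = (\<Sum>m\<in>keys p. lookup p m * lookup q m)"

lemma pair_eq_sum: "finite A \<Longrightarrow> keys p \<subseteq> A \<Longrightarrow> pair p q = (\<Sum>m\<in>A. lookup p m * lookup q m)"
  unfolding pair_def by (rule sum.mono_neutral_left) (auto simp: in_keys_iff)

lemma pair_commute: "pair p q = pair q p"
  using pair_eq_sum[of "keys p \<union> keys q" p q] pair_eq_sum[of "keys p \<union> keys q" q p]
  by (simp add: mult.commute)

lemma pair_add_right: "pair p (q + q') = pair p q + pair p q'"
  by (simp add: pair_def lookup_add algebra_simps sum.distrib)

lemma pair_smul_right: "pair p (smul c q) = c * pair p q"
  by (simp add: pair_def sum_distrib_left algebra_simps)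

lemma pair_zero [simp]: "pair 0 q = 0" "pair p 0 = 0"
  by (simp_all add: pair_def)

lemma pair_single: "pair (single m 1) q = lookup q m"
  by (simp add: pair_def)

lemma subspace_pair_zero: "psubspace {q. pair p q = 0}"
  by (simp add: mp.vs.subspace_def pair_add_right pair_smul_right)

lemma pair_zero_span:
  assumes "p \<in> pspan A" "\<And>a. a \<in> A \<Longrightarrow> pair a q = 0"
  shows "pair p q = 0"
proof -
  have "pspan A \<subseteq> {a. pair q a = 0}"
  proof (rule mp.vs.span_minimal)
    show "A \<subseteq> {a. pair q a = 0}" using assms(2) by (simp add: pair_commute[of q] subset_iff)
  qed (rule subspace_pair_zero)
  then have "p \<in> {a. pair q a = 0}" using assms(1) by blast
  then show ?thesis by (simp add: pair_commute[of p])
qed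

lemma dim_pair_kernel_ge:
  fixes W :: "('k::field) mpoly set"
  assumes "finite A" "psubspace W" "mp.fin_dim W"
  shows "pdim W \<le> pdim {w\<in>W. \<forall>a\<in>A. pair a w = 0} + card A"
  using assms(1)
proof (induction A)
  case (insert a A)
  let ?U = "{w\<in>W. \<forall>a\<in>A. pair a w = 0}"
  \<comment> \<open>The functional is turned into an endomorphism by placing its values on the line
    of constants, so that \<open>mp.dim_kernel_ge\<close> applies.\<close>
  let ?f = "\<lambda>w. smul (pair a w) 1"
  have U: "psubspace ?U" "mp.fin_dim ?U"
    using assms(2) by (auto simp: mp.vs.subspace_def pair_add_right pair_smul_right
        intro: mp.fin_dim_mono[OF assms(3)])
  have f: "mp.lin ?f"
    by (rule linI) (simp_all add: pair_add_right pair_smul_right mp.vs.scale_left_distrib)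
  have "?f ` ?U \<subseteq> pspan {1}" by (auto intro: mp.vs.span_scale mp.vs.span_base)
  moreover have "mp.fin_dim (pspan {1 :: 'k mpoly})" unfolding mp.fin_dim_def by blast
  ultimately have "pdim ?U \<le> pdim {w\<in>?U. ?f w = 0} + pdim (pspan {1 :: 'k mpoly})"
    by (rule mp.dim_kernel_ge[OF f U])
  moreover have "pdim (pspan {1 :: 'k mpoly}) \<le> 1"
    using mp.vs.dim_le_card[of "pspan {1 :: 'k mpoly}" "{1}"] by simp
  moreover have "{w\<in>?U. ?f w = 0} = {w\<in>W. \<forall>b\<in>insert a A. pair b w = 0}" by auto
  ultimately show ?case using insert by simp
qed simp

definition perp :: "nat \<Rightarrow> nat \<Rightarrow> ('k::field) mpoly set \<Rightarrow> 'k mpoly set" where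
  "perp r d V = {q\<in>graded_part r d. \<forall>p\<in>V. pair p q = 0}"

lemma perp_subset: "perp r d V \<subseteq> graded_part r d"
  by (auto simp: perp_def)

lemma subspace_perp: "psubspace (perp r d V)"
  using subspace_graded_part[of r d]
  by (auto simp: perp_def mp.vs.subspace_def pair_add_right pair_smul_right)

text \<open>A coefficient of a linear map with kernel \<open>V\<close> is a functional that vanishes
  on \<open>V\<close> and can be chosen nonzero at \<open>v\<close>. Its values on the monomials are
  the coefficients of the form \<open>w\<close> that represents it.\<close>

lemma perp_separates:
  assumes V: "psubspace V" and v: "v \<in> graded_part r d" "v \<notin> V"
  obtains w where "w \<in> perp r d (V \<inter> graded_part r d)" "pair v w \<noteq> 0"
proof -
  obtain q where q: "mp.lin q" "\<And>x. q x = 0 \<longleftrightarrow> x \<in> V"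
    using mp.exists_linear_with_kernel[OF V] by blast
  interpret q: Vector_Spaces.linear smul smul q by (rule q(1))
  have "q v \<noteq> 0" using q(2) v by simp
  then obtain k where k: "lookup (q v) k \<noteq> 0"
    by (metis poly_mapping_eqI lookup_zero)
  define w where "w = (\<Sum>m\<in>mons r d. single m (lookup (q (single m 1)) k))"
  have wl: "lookup w m = (lookup (q (single m 1)) k when m \<in> mons r d)" for m
    using finite_mons[of r d] by (auto simp: w_def lookup_sum lookup_single when_def)
  have wG: "w \<in> graded_part r d"
    by (auto simp: graded_part_iff in_keys_iff wl when_def split: if_splits)
  have pw: "pair p w = lookup (q p) k" if "p \<in> graded_part r d" for p
  proof -
    have kp: "keys p \<subseteq> mons r d" using that by (simp add: graded_part_iff)
    have "q p = (\<Sum>m\<in>mons r d. smul (lookup p m) (q (single m 1)))"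
      by (subst mpoly_eq_sum_mons[OF finite_mons kp]) (simp add: q.sum q.scale)
    then show ?thesis
      by (simp add: pair_eq_sum[OF finite_mons kp] wl lookup_sum cong: sum.cong)
  qed
  have "w \<in> perp r d (V \<inter> graded_part r d)" using wG pw q(2)[THEN iffD2] by (auto simp: perp_def)
  then show ?thesis using that pw[OF v(1)] k by simp
qed

lemma perp_perp:
  assumes V: "psubspace V" "V \<subseteq> graded_part r d"
  shows "perp r d (perp r d V) = V"
proof
  show "V \<subseteq> perp r d (perp r d V)" using V(2) by (auto simp: perp_def pair_commute)
  show "perp r d (perp r d V) \<subseteq> V"
  proof
    fix v assume v: "v \<in> perp r d (perp r d V)"
    show "v \<in> V"
    proof (rule ccontr)
      assume "v \<notin> V"
      then obtain w where "w \<in> perp r d (V \<inter> graded_part r d)" "pair v w \<noteq> 0"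
        using perp_separates[OF V(1)] v by (metis perp_subset subsetD)
      then show False using v V(2) by (auto simp: perp_def pair_commute Int_absorb2)
    qed
  qed
qed

lemma perp_graded_part: "perp r d (graded_part r d) = {0}"
proof -
  have "psubspace {0}" "{0} \<subseteq> graded_part r d" "perp r d {0} = graded_part r d"
    using mp.vs.subspace_0[OF subspace_graded_part] by (auto simp: perp_def mp.vs.subspace_def)
  then show ?thesis using perp_perp by metis
qed

lemma perp_mono: "V \<subseteq> W \<Longrightarrow> perp r d W \<subseteq> perp r d V"
  by (auto simp: perp_def)

text \<open>Each inequality counts conditions: a basis of \<open>V\<close> imposes at most
  \<open>pdim V\<close> of them on the graded part, and the rest of an extended basis suffices to
  cut the orthogonal of \<open>V\<close> down to zero.\<close>

lemma dim_perp:
  fixes V :: "('k::field) mpoly set"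
  assumes V: "psubspace V" "V \<subseteq> graded_part r d"
  shows "pdim (perp r d V) + pdim V = pdim (graded_part r d :: ('k::field) mpoly set)"
proof -
  let ?G = "graded_part r d :: 'k mpoly set"
  obtain B where B: "finite B" "B \<subseteq> V" "pindep B" "V \<subseteq> pspan B" "card B = pdim V"
    by (rule mp.fin_dim_basis[OF fin_dim_subset_graded[OF V(2)]])
  obtain E where E: "B \<subseteq> E" "E \<subseteq> ?G" "pindep E" "?G \<subseteq> pspan E"
    by (rule mp.vs.maximal_independent_subset_extend[OF _ B(3), of ?G]) (use B(2) V(2) in auto)
  have finE: "finite E" using mp.independent_card_le_fin_dim(1)[OF fin_dim_graded_part E(2,3)] .
  have cE: "card E = pdim ?G" by (rule mp.vs.basis_card_eq_dim[OF E(2,4,3)])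
  have "{w\<in>?G. \<forall>a\<in>B. pair a w = 0} = perp r d V"
    using B(2,4) pair_zero_span by (fastforce simp: perp_def)
  then have 1: "pdim ?G \<le> pdim (perp r d V) + pdim V"
    using dim_pair_kernel_ge[OF B(1) subspace_graded_part fin_dim_graded_part, of r d] B(5) by simp
  have "{w\<in>perp r d V. \<forall>a\<in>E - B. pair a w = 0} \<subseteq> perp r d ?G"
  proof
    fix w assume w: "w \<in> {w\<in>perp r d V. \<forall>a\<in>E - B. pair a w = 0}"
    then have "pair a w = 0" if "a \<in> E" for a using that B(2) by (auto simp: perp_def)
    then show "w \<in> perp r d ?G" using w E(4) pair_zero_span[of _ E w] by (auto simp: perp_def)
  qed
  then have "pdim {w\<in>perp r d V. \<forall>a\<in>E - B. pair a w = 0} \<le> pdim {0 :: 'k mpoly}"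
    unfolding perp_graded_part by (rule mp.dim_mono_fin[rotated]) (auto simp: mp.fin_dim_def)
  then have "pdim {w\<in>perp r d V. \<forall>a\<in>E - B. pair a w = 0} = 0" by (simp add: mp.dim_zero_space)
  then have "pdim (perp r d V) \<le> card (E - B)"
    using dim_pair_kernel_ge[of "E - B" "perp r d V"] finE subspace_perp
      fin_dim_subset_graded[OF perp_subset] by fastforce
  moreover have "card (E - B) + card B = card E"
    using E(1) finE B(1) by (simp add: card_Diff_subset card_mono)
  ultimately show ?thesis using 1 B(5) cE by simp
qed

text \<open>The forms complete a basis of the orthogonal of \<open>X\<close> to one of the
  orthogonal of \<open>M\<close>. Those in the orthogonal of \<open>X\<close> vanish on
  \<open>X\<close> anyway, so the codimension of \<open>M\<close> in \<open>X\<close> is the number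
  needed.\<close>

lemma cut_out_by_forms:
  assumes M: "psubspace M" "M \<subseteq> X" and X: "psubspace X" "X \<subseteq> graded_part r d"
  obtains A where "finite A" "A \<subseteq> graded_part r d" "card A + pdim M = pdim X"
    "\<And>q. q \<in> X \<Longrightarrow> (\<And>a. a \<in> A \<Longrightarrow> pair a q = 0) \<Longrightarrow> q \<in> M"
proof -
  have MG: "M \<subseteq> graded_part r d" using M X by auto
  obtain B where B: "finite B" "B \<subseteq> perp r d X" "pindep B" "perp r d X \<subseteq> pspan B" "card B = pdim (perp r d X)"
    by (rule mp.fin_dim_basis[OF fin_dim_subset_graded[OF perp_subset]])
  have le: "perp r d X \<subseteq> perp r d M" by (rule perp_mono[OF M(2)])
  obtain E where E: "B \<subseteq> E" "E \<subseteq> perp r d M" "pindep E" "perp r d M \<subseteq> pspan E"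
    by (rule mp.vs.maximal_independent_subset_extend[OF _ B(3), of "perp r d M"]) (use B(2) le in auto)
  have finE: "finite E"
    using mp.independent_card_le_fin_dim(1)[OF fin_dim_subset_graded[OF perp_subset] E(2,3)] .
  have cE: "card E = pdim (perp r d M)" by (rule mp.vs.basis_card_eq_dim[OF E(2,4,3)])
  have c: "card (E - B) + card B = card E"
    using E(1) finE B(1) by (simp add: card_Diff_subset card_mono)
  have "card (E - B) + pdim M = pdim X"
    using dim_perp[OF M(1) MG] dim_perp[OF X] c cE B(5) by simp
  moreover have "q \<in> M" if q: "q \<in> X" "\<And>a. a \<in> E - B \<Longrightarrow> pair a q = 0" for q
  proof -
    have "pair a q = 0" if "a \<in> E" for a
      using q that B(2) by (cases "a \<in> B") (auto simp: perp_def pair_commute)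
    then have "q \<in> perp r d (perp r d M)"
      using E(4) pair_zero_span[of _ E q] q(1) X(2) by (auto simp: perp_def)
    then show "q \<in> M" using perp_perp[OF M(1) MG] by simp
  qed
  ultimately show ?thesis using that[of "E - B"] finE E(2) perp_subset by blast
qed

section \<open>Contraction by variables and by linear forms\<close>

abbreviation var :: "nat \<Rightarrow> ('k::field) mpoly" where "var i \<equiv> single (single i 1) 1"

text \<open>Contraction by a variable: partial differentiation without the factor coming from the
  exponent. It is adjoint to multiplication by \<open>var i\<close>, see
  \<open>pair_shift\<close>.\<close>

definition shift :: "nat \<Rightarrow> ('k::field) mpoly \<Rightarrow> 'k mpoly" where
  "shift i p = Poly_Mapping.map_key (\<lambda>m. m + single i 1) p"

lemma lookup_shift [simp]: "lookup (shift i p) m = lookup p (m + single i 1)"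
  unfolding shift_def by (subst map_key.rep_eq) (auto intro: injI)

lemma lin_shift: "mp.lin (shift i)"
  by (rule linI) (auto intro!: poly_mapping_eqI simp: lookup_add)

lemma shift_zero [simp]: "shift i 0 = 0"
  by (rule poly_mapping_eqI) simp

lemma shift_commute: "shift i (shift j p) = shift j (shift i p)"
  by (rule poly_mapping_eqI) (simp add: add_ac)

lemma mons_add_single_iff: "m + single i 1 \<in> mons r (Suc d) \<longleftrightarrow> m \<in> mons r d \<and> i < r"
proof
  assume a: "m + single i 1 \<in> mons r (Suc d)"
  have "i \<in> keys (m + single i 1)" "keys m \<subseteq> keys (m + single i 1)"
    by (auto simp: in_keys_iff lookup_add)
  then show "m \<in> mons r d \<and> i < r" using a by (auto simp: mons_def mdeg_add)
next
  assume "m \<in> mons r d \<and> i < r"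
  then show "m + single i 1 \<in> mons r (Suc d)" using mons_add[of m r d "single i 1" 1] mons_single by simp
qed

lemma shift_in_graded_part:
  assumes "p \<in> graded_part r (Suc d)"
  shows "shift i p \<in> graded_part r d"
  unfolding graded_part_iff
proof
  fix m assume "m \<in> keys (shift i p)"
  then have "m + single i 1 \<in> mons r (Suc d)"
    using assms by (auto simp: graded_part_iff in_keys_iff)
  then show "m \<in> mons r d" unfolding mons_add_single_iff by simp
qed

lemma pair_shift: "pair (var i * p) q = pair p (shift i q)"
proof -
  have fin: "finite ((\<lambda>m. m + single i 1) ` keys p)" by simp
  have inj: "inj_on (\<lambda>m. m + single i 1) (keys p)" by (auto intro: inj_onI)
  have "pair (var i * p) q = (\<Sum>m\<in>(\<lambda>m. m + single i 1) ` keys p. lookup (var i * p) m * lookup q m)"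
    by (rule pair_eq_sum[OF fin keys_single_mult])
  also have "\<dots> = pair p (shift i q)"
    unfolding pair_def sum.reindex[OF inj] by (simp only: comp_def lookup_single_mult lookup_shift) simp
  finally show ?thesis .
qed

lemma graded_part_eq_0I:
  assumes "p \<in> graded_part r (Suc d)" "\<And>i. i < r \<Longrightarrow> shift i p = 0"
  shows "p = 0"
proof (rule poly_mapping_eqI)
  fix m show "lookup p m = lookup 0 m"
  proof (cases "m \<in> keys p")
    case True
    then have "m \<in> mons r (Suc d)" using assms(1) by (auto simp: graded_part_iff)
    then obtain i m' where "i < r" "m = m' + single i 1" by (rule mons_Suc_cases)
    then show ?thesis using assms(2)[of i] by (metis lookup_shift lookup_zero)
  qed (simp add: in_keys_iff)
qed

text \<open>A Poincare lemma for contractions. The coefficient of \<open>q\<close> at a monomial is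
  read off from \<open>f i\<close> for some variable \<open>i\<close> dividing it, and
  \<open>comm\<close> makes the choice of \<open>i\<close> irrelevant.\<close>

lemma exists_common_antishift:
  fixes f :: "nat \<Rightarrow> ('k::field) mpoly"
  assumes f: "\<And>i. i < r \<Longrightarrow> f i \<in> graded_part r d"
    and comm: "\<And>i j. i < r \<Longrightarrow> j < r \<Longrightarrow> shift j (f i) = shift i (f j)"
  obtains q where "q \<in> graded_part r (Suc d)" "\<And>i. i < r \<Longrightarrow> shift i q = f i"
proof -
  define s where "s m = (SOME i. i \<in> keys m)" for m :: "nat \<Rightarrow>\<^sub>0 nat"
  define q where "q = (\<Sum>m\<in>mons r (Suc d). single m (lookup (f (s m)) (m - single (s m) 1)))"
  have lq: "lookup q m = (lookup (f (s m)) (m - single (s m) 1) when m \<in> mons r (Suc d))" for m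
    using finite_mons[of r "Suc d"] by (auto simp: q_def lookup_sum lookup_single when_def)
  have "q \<in> graded_part r (Suc d)"
    by (auto simp: graded_part_iff in_keys_iff lq when_def split: if_splits)
  moreover have "shift j q = f j" if j: "j < r" for j
  proof (rule poly_mapping_eqI)
    fix m
    show "lookup (shift j q) m = lookup (f j) m"
    proof (cases "m \<in> mons r d")
      case False
      then have "lookup (f j) m = 0" using f[OF j] by (auto simp: graded_part_iff in_keys_iff)
      then show ?thesis using False by (simp add: lq mons_add_single_iff[simplified])
    next
      case True
      let ?m = "m + single j 1" let ?i = "s ?m"
      have mm: "?m \<in> mons r (Suc d)" using True j by (simp only: mons_add_single_iff)
      have "j \<in> keys ?m" by (simp add: in_keys_iff lookup_add)
      then have i: "?i \<in> keys ?m" unfolding s_def by (rule someI)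
      then have ir: "?i < r" using mm by (auto simp: mons_def)
      have "lookup (shift j q) m = lookup (f ?i) (?m - single ?i 1)" using mm by (simp add: lq)
      also have "\<dots> = lookup (f j) m"
      proof (cases "?i = j")
        case True
        then show ?thesis by simp
      next
        case False
        then have im: "?i \<in> keys m" using i by (simp add: in_keys_iff lookup_add lookup_single)
        \<comment> \<open>\<open>?m\<close> is divisible by both variables; the compatibility of
          \<open>f ?i\<close> and \<open>f j\<close> is used at the common quotient
          \<open>m'\<close>.\<close>
        define m' where "m' = m - single ?i 1"
        have m: "m = m' + single ?i 1"
        proof (rule poly_mapping_eqI)
          fix l show "lookup m l = lookup (m' + single ?i 1) l"
            using im by (auto simp: m'_def lookup_add lookup_minus lookup_single in_keys_iff when_def)
        qed
        have "?m = (m' + single j 1) + single ?i 1" by (subst (1) m) (simp only: add_ac)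
        then have "?m - single ?i 1 = m' + single j 1" by (metis add_diff_cancel_right')
        then have "lookup (f ?i) (?m - single ?i 1) = lookup (shift j (f ?i)) m'" by simp
        also have "\<dots> = lookup (shift ?i (f j)) m'" using comm[OF ir j] by simp
        also have "\<dots> = lookup (f j) m" using m by simp
        finally show ?thesis .
      qed
      finally show ?thesis .
    qed
  qed
  ultimately show ?thesis using that by blast
qed

text \<open>Taking the linear forms on the rational normal curve replaces a generic linear form: for every
  genericity condition below all but finitely many \<open>t\<close> are good.\<close>

definition lshift :: "nat \<Rightarrow> 'k \<Rightarrow> ('k::field) mpoly \<Rightarrow> 'k mpoly" where
  "lshift r t p = (\<Sum>i<r. smul (t ^ i) (shift i p))"

lemma lin_lshift: "mp.lin (lshift r t)"
proof (rule linI)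
  show "lshift r t (p + q) = lshift r t p + lshift r t q" for p q
    by (simp add: lshift_def sum.distrib mp.vs.scale_right_distrib
        mp.vs2.linear_add[OF lin_shift])
  show "lshift r t (smul c p) = smul c (lshift r t p)" for c p
    by (simp add: lshift_def mp.vs.scale_sum_right mult.commute[of c]
        mp.vs2.linear_scale[OF lin_shift])
qed

lemma lin_zero: "mp.lin f \<Longrightarrow> f 0 = 0"
  using mp.vs2.linear_0 .

lemma lin_diff: "mp.lin f \<Longrightarrow> f (p - q) = f p - f q"
  using mp.vs2.linear_diff .

lemma shift_lshift: "shift i (lshift r t p) = lshift r t (shift i p)"
proof -
  interpret s: Vector_Spaces.linear smul smul "shift i" by (rule lin_shift)
  show ?thesis by (simp add: lshift_def s.sum s.scale shift_commute[of i])
qed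

lemma lshift_commute: "lshift r t (lshift r u p) = lshift r u (lshift r t p)"
proof -
  interpret s: Vector_Spaces.linear smul smul "lshift r u" by (rule lin_lshift)
  have "lshift r t (lshift r u p) = (\<Sum>i<r. smul (t ^ i) (lshift r u (shift i p)))"
    by (simp add: lshift_def[of r t "lshift r u p"] shift_lshift)
  also have "\<dots> = lshift r u (\<Sum>i<r. smul (t ^ i) (shift i p))"
    unfolding s.sum s.scale by (rule refl)
  finally show ?thesis unfolding lshift_def[of r t p] .
qed

lemma lshift_in_subspace:
  assumes "psubspace M" "\<And>i. i < r \<Longrightarrow> shift i p \<in> M"
  shows "lshift r t p \<in> M"
  unfolding lshift_def using assms by (intro mp.vs.subspace_sum mp.vs.subspace_scale) auto

lemma lshift_in_graded_part: "p \<in> graded_part r (Suc d) \<Longrightarrow> lshift r t p \<in> graded_part r d"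
  by (intro lshift_in_subspace subspace_graded_part shift_in_graded_part)

lemma subspace_image: "mp.lin f \<Longrightarrow> psubspace V \<Longrightarrow> psubspace (f ` V)"
  by (rule mp.vs2.linear_subspace_image)

lemma subspace_kernel: "mp.lin f \<Longrightarrow> psubspace V \<Longrightarrow> psubspace {v\<in>V. f v = 0}"
  by (simp add: mp.vs.subspace_def mp.vs2.linear_0 mp.vs2.linear_add mp.vs2.linear_scale)

lemma dim_image_inj:
  assumes "mp.lin f" "psubspace V" "mp.fin_dim V" "\<And>v. v \<in> V \<Longrightarrow> f v = 0 \<Longrightarrow> v = 0"
  shows "pdim (f ` V) = pdim V"
proof -
  have "{v\<in>V. f v = 0} = {0}"
    using assms(4) lin_zero[OF assms(1)] mp.vs.subspace_0[OF assms(2)] by auto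
  then show ?thesis using mp.rank_nullity(1)[OF assms(1-3)] by (simp add: mp.dim_zero_space)
qed

text \<open>Each coefficient of \<open>lshift r t p\<close> is a polynomial in \<open>t\<close>
  whose coefficients come from the contractions of \<open>p\<close>; since one contraction is
  nonzero, so is one of these polynomials.\<close>

lemma finite_lshift_zero:
  assumes "p \<in> graded_part r (Suc d)" "p \<noteq> 0"
  shows "finite {t. lshift r t p = 0}"
proof -
  obtain i where i: "i < r" "shift i p \<noteq> 0" using graded_part_eq_0I assms by blast
  then obtain m where m: "lookup (shift i p) m \<noteq> 0" by (metis poly_mapping_eqI lookup_zero)
  define P where "P = (\<Sum>j<r. monom (lookup (shift j p) m) j)"
  have "coeff P i = lookup (shift i p) m" using i(1) by (simp add: P_def coeff_sum coeff_monom)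
  then have "P \<noteq> 0" using m by auto
  moreover have "poly P t = lookup (lshift r t p) m" for t
    by (simp add: P_def lshift_def lookup_sum poly_sum poly_monom mult.commute)
  ultimately show ?thesis using poly_roots_finite[of P] by (auto elim: rev_finite_subset)
qed

section \<open>Kernels of generic linear forms\<close>

text \<open>The first linear form splits \<open>W\<close> into its kernel, which contains the first
  \<open>K t\<close>, and its image. Because the forms commute, the other kernels map into that
  image and are still killed by their own forms, so the count continues there.\<close>

lemma sum_dim_iterated_images_le:
  fixes K :: "'k::field \<Rightarrow> 'k mpoly set"
  assumes "psubspace W" "mp.fin_dim W"
    and "\<And>t. t \<in> set ts \<Longrightarrow> psubspace (K t) \<and> K t \<subseteq> W \<and> (\<forall>q\<in>K t. lshift r t q = 0)"
  shows "(\<Sum>i<length ts. pdim (foldr (lshift r) (take i ts) ` K (ts ! i))) \<le> pdim W"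
  using assms
proof (induction ts arbitrary: W K)
  case (Cons t ts)
  let ?l = "lshift r t"
  have fold: "foldr (lshift r) us (?l q) = ?l (foldr (lshift r) us q)" for us q
    by (induction us) (simp_all add: lshift_commute)
  have "(\<Sum>i<length ts. pdim (foldr (lshift r) (take i ts) ` (?l ` K (ts ! i)))) \<le> pdim (?l ` W)"
  proof (rule Cons.IH)
    show "psubspace (?l ` W)" using subspace_image[OF lin_lshift Cons.prems(1)] .
    show "mp.fin_dim (?l ` W)" using mp.rank_nullity(2)[OF lin_lshift Cons.prems(1,2)] .
    fix u assume u: "u \<in> set ts"
    then have "psubspace (K u)" "K u \<subseteq> W" "\<forall>q\<in>K u. lshift r u q = 0" using Cons.prems(3)[of u] by auto
    then show "psubspace (?l ` K u) \<and> ?l ` K u \<subseteq> ?l ` W \<and> (\<forall>q\<in>?l ` K u. lshift r u q = 0)"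
      using subspace_image[OF lin_lshift] lin_zero[OF lin_lshift] by (auto simp: lshift_commute[of r u t])
  qed
  moreover have "pdim (K t) \<le> pdim {w\<in>W. ?l w = 0}"
    by (rule mp.dim_mono_fin) (use Cons.prems(2) Cons.prems(3)[of t] in \<open>auto intro: mp.fin_dim_mono\<close>)
  moreover have "(\<Sum>i<length (t # ts). pdim (foldr (lshift r) (take i (t # ts)) ` K ((t # ts) ! i)))
    = pdim (K t) + (\<Sum>i<length ts. pdim (foldr (lshift r) (take i ts) ` (?l ` K (ts ! i))))"
    by (simp add: sum.lessThan_Suc_shift image_image fold del: sum.lessThan_Suc)
  ultimately show ?case using mp.rank_nullity(1)[OF lin_lshift Cons.prems(1,2), of r t] by linarith
qed simp

text \<open>The points \<open>t\<close> are chosen one after the other, each new linear form acting on the kernels chosen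
  before as nearly injectively as the dimensions allow.\<close>

lemma dim_ge_of_kernels:
  fixes K :: "'k::field \<Rightarrow> 'k mpoly set"
  assumes step: "\<And>d (V :: 'k mpoly set). V \<subseteq> graded_part r (Suc d) \<Longrightarrow> psubspace V \<Longrightarrow> min s (d + 2) \<le> pdim V
      \<Longrightarrow> finite {t. pdim (lshift r t ` V) < min s (d + 1)}"
    and B: "infinite B"
    and K: "\<And>t. t \<in> B \<Longrightarrow> psubspace (K t) \<and> K t \<subseteq> W \<and> (\<forall>q\<in>K t. lshift r t q = 0) \<and> s \<le> pdim (K t)"
    and W: "psubspace W" "W \<subseteq> graded_part r n"
  shows "(\<Sum>j\<le>n. min s (j + 1)) \<le> pdim W"
proof -
  let ?f = "foldr (lshift r)"
  have lin: "mp.lin (?f us)" for us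
  proof (induction us)
    case Nil
    show ?case by (rule linI) simp_all
  next
    case (Cons u us)
    then show ?case
      by (intro linI) (simp_all add: mp.vs2.linear_add mp.vs2.linear_scale lin_lshift)
  qed
  have deg: "?f us q \<in> graded_part r d" if "q \<in> graded_part r (d + length us)" for us q d
    using that
  proof (induction us arbitrary: d)
    case (Cons u us)
    then show ?case by (auto intro!: lshift_in_graded_part)
  qed simp
  \<comment> \<open>New points go to the front, so \<open>take i ts\<close> consists of those chosen
    after \<open>ts ! i\<close>. That kernel has been pushed down to degree \<open>n - i\<close>,
    where at least \<open>min s (n + 1 - i)\<close> of its dimensions survive.\<close>
  have "\<exists>ts. length ts = k \<and> set ts \<subseteq> B \<and> (\<forall>i<k. min s (n + 1 - i) \<le> pdim (?f (take i ts) ` K (ts ! i)))"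
    if "k \<le> n + 1" for k
    using that
  proof (induction k)
    case (Suc k)
    then obtain ts where ts: "length ts = k" "set ts \<subseteq> B"
      "\<And>i. i < k \<Longrightarrow> min s (n + 1 - i) \<le> pdim (?f (take i ts) ` K (ts ! i))" by auto
    let ?V = "\<lambda>i. ?f (take i ts) ` K (ts ! i)"
    have "finite {t. pdim (lshift r t ` ?V i) < min s (n - i)}" if i: "i < k" for i
    proof -
      have n: "n - i = Suc (n - i - 1)" using i Suc.prems by simp
      have Ki: "psubspace (K (ts ! i))" "K (ts ! i) \<subseteq> graded_part r n"
        using K[OF subsetD[OF ts(2) nth_mem[of i]]] ts(1) i W(2) by auto
      have len: "length (take i ts) = i" using ts(1) i by simp
      have "?V i \<subseteq> graded_part r (n - i)"
        using deg[of _ "n - i" "take i ts"] Ki(2) len i Suc.prems by auto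
      then have "?V i \<subseteq> graded_part r (Suc (n - i - 1))" using n by simp
      moreover have "min s (n - i - 1 + 2) \<le> pdim (?V i)"
      proof -
        have "n - i - 1 + 2 = n + 1 - i" using i Suc.prems by simp
        then show ?thesis using ts(3)[OF i] by simp
      qed
      ultimately have "finite {t. pdim (lshift r t ` ?V i) < min s (n - i - 1 + 1)}"
        by (rule step[OF _ subspace_image[OF lin Ki(1)]])
      then show ?thesis using n by simp
    qed
    then have "finite (\<Union>i<k. {t. pdim (lshift r t ` ?V i) < min s (n - i)})" (is "finite ?F") by simp
    then have "infinite (B - ?F)" using B by (rule Diff_infinite_finite)
    then obtain t where "t \<in> B - ?F" using infinite_imp_nonempty by blast
    then have t: "t \<in> B" "t \<notin> ?F" by blast+
    have "min s (n + 1 - i) \<le> pdim (?f (take i (t # ts)) ` K ((t # ts) ! i))" if i: "i < Suc k" for i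
    proof (cases i)
      case 0
      then show ?thesis using K[OF t(1)] by (auto intro: min.coboundedI1)
    next
      case (Suc j)
      then have "\<not> pdim (lshift r t ` ?V j) < min s (n - j)" using t(2) i by blast
      then have "min s (n - j) \<le> pdim (lshift r t ` ?V j)" by (simp only: not_less)
      then show ?thesis using Suc by (simp add: image_image)
    qed
    then show ?case using ts(1,2) t(1) by (intro exI[of _ "t # ts"]) simp
  qed simp
  from this[of "n + 1"] obtain ts where ts: "length ts = n + 1" "set ts \<subseteq> B"
    "\<And>i. i < n + 1 \<Longrightarrow> min s (n + 1 - i) \<le> pdim (?f (take i ts) ` K (ts ! i))" by auto
  have "(\<Sum>j\<le>n. min s (j + 1)) = (\<Sum>j<n + 1. min s (j + 1))" by (simp add: lessThan_Suc_atMost)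
  also have "\<dots> = (\<Sum>i<n + 1. min s (n + 1 - Suc i + 1))"
    by (rule sum.nat_diff_reindex[symmetric])
  also have "\<dots> = (\<Sum>i<n + 1. min s (n + 1 - i))" by (rule sum.cong) auto
  also have "\<dots> \<le> (\<Sum>i<n + 1. pdim (?f (take i ts) ` K (ts ! i)))" by (rule sum_mono) (use ts(3) in auto)
  also have "\<dots> \<le> pdim W"
    using sum_dim_iterated_images_le[of W ts K r] W(1) fin_dim_subset_graded[OF W(2)] K ts(1,2) by auto
  finally show ?thesis .
qed

text \<open>The case \<open>s = 1\<close> of \<open>dim_ge_of_kernels\<close>, with kernel vectors
  spanning lines: infinitely many bad \<open>t\<close> would force \<open>d + 1\<close> dimensions.
  The step condition holds because a single nonzero vector survives all but finitely many
  \<open>t\<close>.\<close>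

lemma finite_lshift_not_inj:
  fixes V :: "('k::field) mpoly set"
  assumes V: "psubspace V" "V \<subseteq> graded_part r d" "pdim V \<le> d"
  shows "finite {t. \<exists>v\<in>V. v \<noteq> 0 \<and> lshift r t v = 0}"
proof (rule ccontr)
  assume inf: "infinite {t. \<exists>v\<in>V. v \<noteq> 0 \<and> lshift r t v = 0}"
  define f where "f t = (SOME v. v \<in> V \<and> v \<noteq> 0 \<and> lshift r t v = 0)" for t
  have f: "f t \<in> V \<and> f t \<noteq> 0 \<and> lshift r t (f t) = 0"
    if "t \<in> {t. \<exists>v\<in>V. v \<noteq> 0 \<and> lshift r t v = 0}" for t
    unfolding f_def by (rule someI_ex) (use that in blast)
  have "(\<Sum>j\<le>d. min 1 (j + 1)) \<le> pdim V"
  proof (rule dim_ge_of_kernels[OF _ inf _ V(1,2), where K = "\<lambda>t. pspan {f t}"])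
    fix t assume t: "t \<in> {t. \<exists>v\<in>V. v \<noteq> 0 \<and> lshift r t v = 0}"
    have "pspan {f t} \<subseteq> {v\<in>V. lshift r t v = 0}"
      by (rule mp.vs.span_minimal) (use f[OF t] subspace_kernel[OF lin_lshift V(1)] in auto)
    moreover have "pdim (pspan {f t}) = 1"
      using f[OF t] mp.vs.dim_span_eq_card_independent[of "{f t}"] by (simp add: mp.vs.dependent_single)
    ultimately show "psubspace (pspan {f t}) \<and> pspan {f t} \<subseteq> V \<and> (\<forall>q\<in>pspan {f t}. lshift r t q = 0) \<and> 1 \<le> pdim (pspan {f t})"
      by auto
  next
    fix e and U :: "'k mpoly set"
    assume U: "U \<subseteq> graded_part r (Suc e)" "psubspace U" "min 1 (e + 2) \<le> pdim U"
    then obtain u where u: "u \<in> U" "u \<noteq> 0" using mp.dim_pos_iff[OF U(2) fin_dim_subset_graded[OF U(1)]] by auto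
    have "0 < pdim (lshift r t ` U)" if "lshift r t u \<noteq> 0" for t
      using mp.dim_pos_iff[OF subspace_image[OF lin_lshift U(2)] mp.rank_nullity(2)[OF lin_lshift U(2) fin_dim_subset_graded[OF U(1)]]] u that
      by blast
    then have "{t. pdim (lshift r t ` U) < min 1 (e + 1)} \<subseteq> {t. lshift r t u = 0}" by fastforce
    then show "finite {t. pdim (lshift r t ` U) < min 1 (e + 1)}"
      using finite_lshift_zero[of u r e] u U(1) by (meson finite_subset subsetD)
  qed
  then show False using V(3) by simp
qed

text \<open>Green's bound in the range needed. For \<open>dim_ge_of_kernels\<close>,
  \<open>min s (d + 1)\<close> dimensions must survive a generic form acting in degree
  \<open>d + 1\<close>; a subspace of that size is small enough for
  \<open>finite_lshift_not_inj\<close>.\<close>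

lemma finite_lshift_kernel_ge:
  fixes V :: "('k::field) mpoly set"
  assumes V: "psubspace V" "V \<subseteq> graded_part r n" "pdim V < (\<Sum>j\<le>n. min s (j + 1))"
  shows "finite {t. s \<le> pdim {v\<in>V. lshift r t v = 0}}"
proof (rule ccontr)
  assume inf: "infinite {t. s \<le> pdim {v\<in>V. lshift r t v = 0}}"
  have "(\<Sum>j\<le>n. min s (j + 1)) \<le> pdim V"
  proof (rule dim_ge_of_kernels[OF _ inf _ V(1,2), where K = "\<lambda>t. {v\<in>V. lshift r t v = 0}"])
    fix d and U :: "'k mpoly set"
    assume U: "U \<subseteq> graded_part r (Suc d)" "psubspace U" "min s (d + 2) \<le> pdim U"
    then have le: "min s (d + 1) \<le> pdim U" by simp
    obtain U' where U': "psubspace U'" "U' \<subseteq> U" "pdim U' = min s (d + 1)"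
      by (rule mp.exists_subspace_dim[OF U(2) fin_dim_subset_graded[OF U(1)] le])
    have "finite {t. \<exists>v\<in>U'. v \<noteq> 0 \<and> lshift r t v = 0}"
      by (rule finite_lshift_not_inj[of U' r "Suc d"]) (use U' U(1) in auto)
    moreover have "{t. pdim (lshift r t ` U) < min s (d + 1)} \<subseteq> {t. \<exists>v\<in>U'. v \<noteq> 0 \<and> lshift r t v = 0}"
    proof (rule subsetI, rule ccontr)
      fix t assume t: "t \<in> {t. pdim (lshift r t ` U) < min s (d + 1)}" "t \<notin> {t. \<exists>v\<in>U'. v \<noteq> 0 \<and> lshift r t v = 0}"
      have "pdim (lshift r t ` U') = pdim U'"
        by (rule dim_image_inj[OF lin_lshift U'(1)]) (use t(2) U'(2) U(1) in \<open>auto intro: fin_dim_subset_graded\<close>)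
      moreover have "pdim (lshift r t ` U') \<le> pdim (lshift r t ` U)"
        by (rule mp.dim_mono_fin) (use U'(2) mp.rank_nullity(2)[OF lin_lshift U(2) fin_dim_subset_graded[OF U(1)]] in auto)
      ultimately show False using t(1) U'(3) by (simp del: min_less_iff_conj)
    qed
    ultimately show "finite {t. pdim (lshift r t ` U) < min s (d + 1)}" by (rule rev_finite_subset)
  qed (use subspace_kernel[OF lin_lshift V(1)] in auto)
  then show False using V(3) by simp
qed

section \<open>Maximal extensions of inverse systems\<close>

text \<open>For a subspace \<open>M\<close> of degree \<open>d\<close> this is, by adjointness, the
  orthogonal of what the orthogonal of \<open>M\<close> generates in degree
  \<open>Suc d\<close>.\<close>

definition up :: "nat \<Rightarrow> nat \<Rightarrow> ('k::field) mpoly set \<Rightarrow> 'k mpoly set" where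
  "up r d M = {p \<in> graded_part r (Suc d). \<forall>i<r. shift i p \<in> M}"

primrec ups :: "nat \<Rightarrow> nat \<Rightarrow> ('k::field) mpoly set \<Rightarrow> nat \<Rightarrow> 'k mpoly set" where
  "ups r d M 0 = M"
| "ups r d M (Suc k) = up r (d + k) (ups r d M k)"

lemma up_subset: "up r d M \<subseteq> graded_part r (Suc d)"
  by (auto simp: up_def)

lemma up_mono: "M \<subseteq> N \<Longrightarrow> up r d M \<subseteq> up r d N"
  by (auto simp: up_def)

lemma subspace_up:
  assumes "psubspace M"
  shows "psubspace (up r d M)"
  using assms subspace_graded_part[of r "Suc d"]
  by (auto simp: up_def mp.vs.subspace_def mp.vs2.linear_add[OF lin_shift] mp.vs2.linear_scale[OF lin_shift])

lemma lshift_up: "psubspace M \<Longrightarrow> p \<in> up r d M \<Longrightarrow> lshift r t p \<in> M"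
  by (rule lshift_in_subspace) (auto simp: up_def)

lemma ups_subset: "M \<subseteq> graded_part r d \<Longrightarrow> ups r d M k \<subseteq> graded_part r (d + k)"
  by (cases k) (auto dest: subsetD[OF up_subset])

lemma subspace_ups: "psubspace M \<Longrightarrow> psubspace (ups r d M k)"
  by (induction k) (simp_all add: subspace_up)

lemma ups_mono: "M \<subseteq> N \<Longrightarrow> ups r d M k \<subseteq> ups r d N k"
  by (induction k) (simp_all add: up_mono)

lemma ups_Suc: "ups r d M (Suc k) = ups r (Suc d) (up r d M) k"
  by (induction k) simp_all

text \<open>Contractions commute with \<open>lshift\<close>, so all contractions of a kernel element
  lie in the kernel on \<open>M\<close>, which is zero.\<close>

lemma lshift_inj_up:
  assumes "\<And>v. v \<in> M \<Longrightarrow> lshift r t v = 0 \<Longrightarrow> v = 0" "p \<in> up r d M" "lshift r t p = 0"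
  shows "p = 0"
proof (rule graded_part_eq_0I)
  show "p \<in> graded_part r (Suc d)" using assms(2) by (simp add: up_def)
  fix i assume "i < r"
  then have "shift i p \<in> M" using assms(2) by (simp add: up_def)
  moreover have "lshift r t (shift i p) = 0" using assms(3) by (simp flip: shift_lshift)
  ultimately show "shift i p = 0" by (rule assms(1))
qed

lemma kernel_up:
  "{v\<in>up r d M. lshift r t v = 0} \<subseteq> up r d {v\<in>M. lshift r t v = 0}"
  by (auto simp: up_def simp flip: shift_lshift)

lemma exists_good_point:
  assumes "infinite (UNIV :: 'k::field set)" "finite {t :: 'k. P t}"
  obtains t where "\<not> P t"
proof -
  have "{t. P t} \<noteq> UNIV" using assms by auto
  then show ?thesis using that by blast
qed

text \<open>Macaulay's bound for values not exceeding the degree, where no growth is possible: a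
  generic form is injective on \<open>N\<close>, hence on its extension, and maps the extension back
  into \<open>N\<close>.\<close>

lemma dim_le_of_subset_up:
  fixes N :: "('k::field) mpoly set"
  assumes inf: "infinite (UNIV :: 'k set)"
    and N: "psubspace N" "N \<subseteq> graded_part r d" "pdim N \<le> d"
    and N': "psubspace N'" "N' \<subseteq> up r d N"
  shows "pdim N' \<le> pdim N"
proof -
  obtain t where t: "\<not> (\<exists>v\<in>N. v \<noteq> 0 \<and> lshift r t v = 0)"
    by (rule exists_good_point[OF inf finite_lshift_not_inj[OF N]])
  have "pdim (lshift r t ` N') = pdim N'"
  proof (rule dim_image_inj[OF lin_lshift N'(1)])
    show "mp.fin_dim N'" using N'(2) up_subset fin_dim_subset_graded by blast
    show "v = 0" if "v \<in> N'" "lshift r t v = 0" for v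
      using lshift_inj_up[of N r t v d] t that N'(2) by blast
  qed
  moreover have "lshift r t ` N' \<subseteq> N" using lshift_up[OF N(1)] N'(2) by blast
  ultimately show ?thesis using mp.dim_mono_fin[OF fin_dim_subset_graded[OF N(2)]] by metis
qed

text \<open>Macaulay's bound for the value \<open>d + 1\<close>, the Hilbert function of a line. A
  generic kernel has dimension at most one and cannot grow; the image contributes at most
  \<open>d + 1\<close>.\<close>

lemma dim_le_Suc_of_subset_up:
  fixes N :: "('k::field) mpoly set"
  assumes inf: "infinite (UNIV :: 'k set)"
    and N: "psubspace N" "N \<subseteq> graded_part r d" "pdim N \<le> d + 1" "1 \<le> d"
    and N': "psubspace N'" "N' \<subseteq> up r d N"
  shows "pdim N' \<le> d + 2"
proof -
  have fN: "mp.fin_dim N" "mp.fin_dim N'"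
    using fin_dim_subset_graded[OF N(2)] fin_dim_subset_graded[OF subset_trans[OF N'(2) up_subset]] by auto
  \<comment> \<open>A generic form is injective on a subspace of dimension at most \<open>d\<close>,
    so on \<open>N\<close> it loses at most the one dimension left out of \<open>V\<close>.\<close>
  obtain V where V: "psubspace V" "V \<subseteq> N" "pdim V = min d (pdim N)"
    by (rule mp.exists_subspace_dim[OF N(1) fN(1), of "min d (pdim N)"]) auto
  obtain t where t: "\<not> (\<exists>v\<in>V. v \<noteq> 0 \<and> lshift r t v = 0)"
    by (rule exists_good_point[OF inf finite_lshift_not_inj[of V r d]]) (use V N in auto)
  let ?Z = "{v\<in>N. lshift r t v = 0}" and ?Z' = "{v\<in>N'. lshift r t v = 0}"
  have "pdim (lshift r t ` V) = pdim V"
    by (rule dim_image_inj[OF lin_lshift V(1)]) (use t V(2) fN mp.fin_dim_mono in auto)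
  moreover have "pdim (lshift r t ` V) \<le> pdim (lshift r t ` N)"
    by (rule mp.dim_mono_fin[OF mp.rank_nullity(2)[OF lin_lshift N(1) fN(1)]]) (use V(2) in auto)
  ultimately have Z: "pdim ?Z \<le> 1"
    using mp.rank_nullity(1)[OF lin_lshift N(1) fN(1), of r t] V(3) N(3) by linarith
  have sZ: "psubspace ?Z" "psubspace ?Z'" using subspace_kernel[OF lin_lshift] N(1) N'(1) by auto
  have "pdim ?Z' \<le> pdim ?Z"
  proof (rule dim_le_of_subset_up[OF inf sZ(1) _ _ sZ(2)])
    show "?Z' \<subseteq> up r d ?Z" using kernel_up[of r d N t] N'(2) by blast
  qed (use N Z in auto)
  moreover have "pdim N' \<le> pdim ?Z' + pdim N"
    by (rule mp.dim_kernel_ge[OF lin_lshift N'(1) fN(2) _ fN(1)]) (use lshift_up[OF N(1)] N'(2) in blast)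
  ultimately show ?thesis using Z N(3) by linarith
qed

text \<open>To hit \<open>p\<close>, lift each contraction of \<open>p\<close> to some
  \<open>f i\<close>. Injectivity on \<open>N\<close> makes the lifts compatible, and their common
  antishift \<open>q\<close> is mapped to \<open>p\<close> because both have the same
  contractions.\<close>

lemma lshift_onto_up_up:
  assumes N: "psubspace N" and inj: "\<And>v. v \<in> N \<Longrightarrow> lshift r t v = 0 \<Longrightarrow> v = 0"
    and onto: "lshift r t ` up r d N = N"
  shows "lshift r t ` up r (Suc d) (up r d N) = up r d N"
proof
  show "lshift r t ` up r (Suc d) (up r d N) \<subseteq> up r d N"
    using lshift_up[OF subspace_up[OF N]] by blast
  show "up r d N \<subseteq> lshift r t ` up r (Suc d) (up r d N)"
  proof
    fix p assume p: "p \<in> up r d N"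
    define f where "f i = (SOME q. q \<in> up r d N \<and> lshift r t q = shift i p)" for i
    have f: "f i \<in> up r d N \<and> lshift r t (f i) = shift i p" if "i < r" for i
      unfolding f_def
    proof (rule someI_ex)
      have "shift i p \<in> N" using p that by (simp add: up_def)
      then show "\<exists>q. q \<in> up r d N \<and> lshift r t q = shift i p" using onto by (metis imageE)
    qed
    have comm: "shift j (f i) = shift i (f j)" if ij: "i < r" "j < r" for i j
    proof -
      have "shift j (f i) \<in> N" "shift i (f j) \<in> N" using f[OF ij(1)] f[OF ij(2)] ij by (auto simp: up_def)
      then have d: "shift j (f i) - shift i (f j) \<in> N" by (rule mp.vs.subspace_diff[OF N])
      have "lshift r t (shift j (f i)) = shift j (shift i p)"
        using f[OF ij(1)] by (simp flip: shift_lshift)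
      moreover have "lshift r t (shift i (f j)) = shift i (shift j p)"
        using f[OF ij(2)] by (simp flip: shift_lshift)
      ultimately have "lshift r t (shift j (f i) - shift i (f j)) = 0"
        using shift_commute[of i j p] by (simp add: lin_diff[OF lin_lshift])
      then have "shift j (f i) - shift i (f j) = 0" by (rule inj[OF d])
      then show ?thesis by simp
    qed
    obtain q where q: "q \<in> graded_part r (Suc (Suc d))" "\<And>i. i < r \<Longrightarrow> shift i q = f i"
    proof (rule exists_common_antishift[of r f "Suc d"])
      show "f i \<in> graded_part r (Suc d)" if "i < r" for i using f[OF that] by (simp add: up_def)
    qed (use comm in blast)+
    have "lshift r t q - p = 0"
    proof (rule graded_part_eq_0I)
      show "lshift r t q - p \<in> graded_part r (Suc d)"
        by (rule mp.vs.subspace_diff[OF subspace_graded_part lshift_in_graded_part[OF q(1)]])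
          (use p in \<open>simp add: up_def\<close>)
      show "shift i (lshift r t q - p) = 0" if "i < r" for i
        using f[OF that] q(2)[OF that] by (simp add: lin_diff[OF lin_shift] shift_lshift)
    qed
    moreover have "q \<in> up r (Suc d) (up r d N)" using q f by (auto simp: up_def[of r "Suc d"])
    ultimately show "p \<in> lshift r t ` up r (Suc d) (up r d N)" by (metis eq_iff_diff_eq_0 imageI)
  qed
qed

text \<open>On a space where a linear form is injective with maximal growth, it is bijective in all higher
  degrees. This replaces Gotzmann's persistence theorem.\<close>

lemma dim_ups_ge:
  assumes N: "psubspace N" "N \<subseteq> graded_part r d"
    and inj: "\<And>v. v \<in> N \<Longrightarrow> lshift r t v = 0 \<Longrightarrow> v = 0"
    and le: "pdim N \<le> pdim (up r d N)"
  shows "pdim N \<le> pdim (ups r d N k)"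
proof -
  have "lshift r t ` up r d N = N"
  proof (rule mp.subspace_eqI_dim)
    show "psubspace (lshift r t ` up r d N)" by (rule subspace_image[OF lin_lshift subspace_up[OF N(1)]])
    show "lshift r t ` up r d N \<subseteq> N" using lshift_up[OF N(1)] by blast
    show "mp.fin_dim N" by (rule fin_dim_subset_graded[OF N(2)])
    have "pdim (lshift r t ` up r d N) = pdim (up r d N)"
      by (rule dim_image_inj[OF lin_lshift subspace_up[OF N(1)] fin_dim_subset_graded[OF up_subset]])
        (rule lshift_inj_up[OF inj])
    then show "pdim N \<le> pdim (lshift r t ` up r d N)" using le by simp
  qed
  then show ?thesis using N inj
  proof (induction k arbitrary: d N)
    case (Suc k)
    have "pdim (up r d N) \<le> pdim (ups r (Suc d) (up r d N) k)"
      by (rule Suc.IH[OF lshift_onto_up_up subspace_up up_subset lshift_inj_up]) (use Suc.prems in auto)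
    moreover have "pdim (lshift r t ` up r d N) \<le> pdim (up r d N)"
      by (rule mp.dim_image_le_fin[OF lin_lshift subspace_up fin_dim_subset_graded[OF up_subset]])
        (rule Suc.prems)
    ultimately show ?case unfolding ups_Suc using Suc.prems(1) by simp
  qed simp
qed

lemma dim_ups_ge_of_le_degree:
  fixes N :: "('k::field) mpoly set"
  assumes inf: "infinite (UNIV :: 'k set)"
    and N: "psubspace N" "N \<subseteq> graded_part r d" "pdim N \<le> d" "pdim N \<le> pdim (up r d N)"
  shows "pdim N \<le> pdim (ups r d N k)"
proof -
  obtain t where "\<not> (\<exists>v\<in>N. v \<noteq> 0 \<and> lshift r t v = 0)"
    by (rule exists_good_point[OF inf finite_lshift_not_inj[OF N(1-3)]])
  then show ?thesis using dim_ups_ge[OF N(1,2) _ N(4), of t] by blast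
qed

section \<open>Graded ideals generated by few forms\<close>

text \<open>By \<open>pair_shift\<close>, orthogonals of a family closed under multiplication by
  variables are closed under contraction, and \<open>ups\<close> is the largest such continuation.
  Applied to \<open>J\<close>, to ideals with few generators and to primes.\<close>

lemma perp_subset_ups:
  assumes V: "\<And>e i p. p \<in> V e \<Longrightarrow> i < r \<Longrightarrow> var i * p \<in> V (Suc e)"
    and Q: "perp r d (V d) \<subseteq> Q"
  shows "perp r (d + k) (V (d + k)) \<subseteq> ups r d Q k"
proof (induction k)
  case (Suc k)
  have "shift i q \<in> perp r (d + k) (V (d + k))"
    if q: "q \<in> perp r (d + Suc k) (V (d + Suc k))" and i: "i < r" for q i
  proof -
    have "q \<in> graded_part r (Suc (d + k))" using q by (simp add: perp_def)
    moreover have "pair p (shift i q) = 0" if "p \<in> V (d + k)" for p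
      using q V[OF that i] by (simp add: perp_def flip: pair_shift)
    ultimately show ?thesis by (simp add: perp_def shift_in_graded_part)
  qed
  then show ?case using Suc by (auto simp: up_def perp_def)
qed (use Q in simp)

text \<open>The degree \<open>d\<close> part of the ideal generated by the homogeneous elements of
  \<open>A\<close>, described as a span so that dimensions can be counted.\<close>

definition gen_part :: "nat \<Rightarrow> ('k::field) mpoly set \<Rightarrow> nat \<Rightarrow> 'k mpoly set" where
  "gen_part r A d = pspan {a * p | a p c e. a \<in> A \<and> a \<in> graded_part r c \<and> p \<in> graded_part r e \<and> c + e = d}"

lemma subspace_gen_part: "psubspace (gen_part r A d)"
  by (simp add: gen_part_def)

lemma gen_part_subset: "gen_part r A d \<subseteq> graded_part r d"
  unfolding gen_part_def
  by (rule mp.vs.span_minimal) (auto intro: graded_part_mult simp: subspace_graded_part)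

lemma gen_part_mono: "A \<subseteq> B \<Longrightarrow> gen_part r A d \<subseteq> gen_part r B d"
  unfolding gen_part_def by (rule mp.vs.span_mono) blast

lemma gen_part_I: "a \<in> A \<Longrightarrow> a \<in> graded_part r c \<Longrightarrow> p \<in> graded_part r e \<Longrightarrow> a * p \<in> gen_part r A (c + e)"
  unfolding gen_part_def by (rule mp.vs.span_base) blast

lemma gen_part_mult:
  fixes f :: "('k::field) mpoly" and A :: "'k mpoly set"
  assumes f: "f \<in> graded_part r c" and p: "p \<in> gen_part r A d"
  shows "f * p \<in> gen_part r A (c + d)"
proof -
  have "gen_part r A d \<subseteq> {p. f * p \<in> gen_part r A (c + d)}"
    unfolding gen_part_def[of r A d]
  proof (rule mp.vs.span_minimal)
    show "psubspace {p. f * p \<in> gen_part r A (c + d)}"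
      using subspace_gen_part[of r A "c + d"]
      by (simp add: mp.vs.subspace_def distrib_left smul_mult_right)
    show "{a * p | a p c e. a \<in> A \<and> a \<in> graded_part r c \<and> p \<in> graded_part r e \<and> c + e = d}
        \<subseteq> {p. f * p \<in> gen_part r A (c + d)}"
    proof safe
      fix a p :: "'k mpoly" and c' e assume a: "a \<in> A" "a \<in> graded_part r c'" "p \<in> graded_part r e"
      have "a * (f * p) \<in> gen_part r A (c' + (c + e))"
        by (rule gen_part_I[OF a(1,2) graded_part_mult[OF f a(3)]])
      then show "f * (a * p) \<in> gen_part r A (c + (c' + e))" by (simp add: mult.left_commute add.left_commute)
    qed
  qed
  then show ?thesis using p by blast
qed

lemma var_in_graded_part: "i < r \<Longrightarrow> var i \<in> graded_part r 1"
  by (rule single_in_graded_part[OF mons_single])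

lemma graded_part_Suc_span:
  "graded_part r (Suc d) \<subseteq> pspan {var i * p | i p. i < r \<and> p \<in> graded_part r d}"
proof
  let ?S = "{var i * p | i p. i < r \<and> p \<in> graded_part r d} :: 'a mpoly set"
  fix q :: "'a mpoly" assume q: "q \<in> graded_part r (Suc d)"
  have "single m 1 \<in> pspan ?S" if m: "m \<in> mons r (Suc d)" for m
  proof -
    obtain i m' where im: "i < r" "m' \<in> mons r d" "m = m' + single i 1" by (rule mons_Suc_cases[OF m])
    have "single m (1 :: 'a) = var i * single m' 1" using im(3) by (simp add: mult_single add.commute)
    moreover have "single m' (1 :: 'a) \<in> graded_part r d" by (rule single_in_graded_part[OF im(2)])
    ultimately have "single m (1 :: 'a) \<in> ?S" using im(1) by blast
    then show ?thesis by (rule mp.vs.span_base)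
  qed
  then have "(\<Sum>m\<in>mons r (Suc d). smul (lookup q m) (single m 1)) \<in> pspan ?S"
    by (intro mp.vs.span_sum mp.vs.span_scale)
  moreover have "q = (\<Sum>m\<in>mons r (Suc d). smul (lookup q m) (single m 1))"
    by (rule mpoly_eq_sum_mons[OF finite_mons]) (use q in \<open>simp add: graded_part_iff\<close>)
  ultimately show "q \<in> pspan ?S" by (rule ssubst[rotated])
qed

lemma graded_part_Suc_subset:
  assumes V: "\<And>i p. p \<in> V \<Longrightarrow> i < r \<Longrightarrow> var i * p \<in> W" and W: "psubspace W" and G: "graded_part r d \<subseteq> V"
  shows "graded_part r (Suc d) \<subseteq> W"
proof -
  have "pspan {var i * p | i p. i < r \<and> p \<in> graded_part r d} \<subseteq> W"
    by (rule mp.vs.span_minimal[OF _ W]) (use V G in auto)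
  then show ?thesis using graded_part_Suc_span by blast
qed

section \<open>Growth of the quotient by few forms\<close>

text \<open>The Hilbert function of the quotient by the ideal that \<open>A\<close> generates; the
  subtraction is exact by \<open>dim_gen_part_le\<close>.\<close>

definition codim :: "nat \<Rightarrow> ('k::field) mpoly set \<Rightarrow> nat \<Rightarrow> nat" where
  "codim r A t = pdim (graded_part r t :: 'k mpoly set) - pdim (gen_part r A t)"

lemma dim_gen_part_le:
  fixes A :: "('k::field) mpoly set"
  shows "pdim (gen_part r A t) \<le> pdim (graded_part r t :: 'k mpoly set)"
  by (rule mp.dim_mono_fin[OF fin_dim_graded_part gen_part_subset])

text \<open>Multiplication by \<open>f\<close> maps the quotient by \<open>A\<close> in degree
  \<open>t - a\<close> onto what \<open>f\<close> adds to the ideal in degree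
  \<open>t\<close>.\<close>

lemma codim_insert_ge:
  fixes f :: "('k::field) mpoly"
  assumes f: "f \<in> graded_part r a" "0 < a"
  shows "codim r A t \<le> codim r (insert f A) t + (if a \<le> t then codim r A (t - a) else 0)"
proof -
  let ?V = "gen_part r A t" and ?W = "gen_part r (insert f A) t" and ?G = "graded_part r t :: 'k mpoly set"
  \<comment> \<open>Below degree \<open>a\<close> there are no nonzero multiples of
    \<open>f\<close>; the zero space lets both cases share one argument.\<close>
  let ?S = "if a \<le> t then graded_part r (t - a) else {0 :: 'k mpoly}"
  have S: "psubspace ?S" "mp.fin_dim ?S"
    using subspace_graded_part fin_dim_graded_part by (auto simp: mp.vs.subspace_def mp.fin_dim_def)
  have "?W \<subseteq> {v + f * s | v s. v \<in> ?V \<and> s \<in> ?S}"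
    unfolding gen_part_def[of r "insert f A"]
  proof (rule mp.vs.span_minimal)
    have "psubspace ((*) f ` ?S)" by (rule subspace_image[OF lin_mult S(1)])
    then have "psubspace {x + y | x y. x \<in> ?V \<and> y \<in> (*) f ` ?S}"
      by (rule mp.vs.subspace_sums[OF subspace_gen_part])
    moreover have "{x + y | x y. x \<in> ?V \<and> y \<in> (*) f ` ?S} = {v + f * s | v s. v \<in> ?V \<and> s \<in> ?S}" by blast
    ultimately show "psubspace {v + f * s | v s. v \<in> ?V \<and> s \<in> ?S}" by simp
    show "{b * p | b p c e. b \<in> insert f A \<and> b \<in> graded_part r c \<and> p \<in> graded_part r e \<and> c + e = t}
        \<subseteq> {v + f * s | v s. v \<in> ?V \<and> s \<in> ?S}"
    proof
      fix x assume "x \<in> {b * p | b p c e. b \<in> insert f A \<and> b \<in> graded_part r c \<and> p \<in> graded_part r e \<and> c + e = t}"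
      then obtain b p c e where x: "x = b * p" "b \<in> insert f A" "b \<in> graded_part r c" "p \<in> graded_part r e" "c + e = t"
        by blast
      have 0: "0 \<in> ?V" "0 \<in> ?S" using mp.vs.subspace_0[OF subspace_gen_part] mp.vs.subspace_0[OF S(1)] by auto
      show "x \<in> {v + f * s | v s. v \<in> ?V \<and> s \<in> ?S}"
      proof (cases "b \<in> A")
        case True
        then have "x \<in> ?V" using x gen_part_I by blast
        then show ?thesis using 0 by (intro CollectI exI[of _ x] exI[of _ 0]) simp
      next
        case False
        then have b: "b = f" using x(2) by simp
        show ?thesis
        \<comment> \<open>The zero form lies in every graded part, so \<open>c = a\<close> can be
          concluded only for a nonzero \<open>f\<close>.\<close>
        proof (cases "f = 0")
          case True
          then show ?thesis using 0 x(1) b by (intro CollectI exI[of _ 0]) simp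
        next
          case False
          then obtain m where "m \<in> keys f" by (metis keys_eq_empty ex_in_conv)
          then have "c = a" using f(1) x(3) b by (auto simp: graded_part_def)
          then have "p \<in> ?S" using x(4,5) by auto
          then show ?thesis using 0 x(1) b by (intro CollectI exI[of _ 0] exI[of _ p]) simp
        qed
      qed
    qed
  qed
  then have "pdim ?W + pdim {s\<in>?S. f * s \<in> ?V} \<le> pdim ?V + pdim ?S"
    by (intro mp.dim_sum_image_le lin_mult S subspace_gen_part fin_dim_subset_graded[OF gen_part_subset] gen_part_mono) auto
  moreover have "pdim ?S \<le> pdim {s\<in>?S. f * s \<in> ?V} + (if a \<le> t then codim r A (t - a) else 0)"
  proof (cases "a \<le> t")
    case True
    have "gen_part r A (t - a) \<subseteq> {s\<in>?S. f * s \<in> ?V}"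
      using gen_part_mult[OF f(1), of _ A "t - a"] gen_part_subset[of r A "t - a"] True by auto
    then have "pdim (gen_part r A (t - a)) \<le> pdim {s\<in>?S. f * s \<in> ?V}"
      by (rule mp.dim_mono_fin[rotated]) (auto intro: mp.fin_dim_mono[OF S(2)])
    then show ?thesis using True by (simp add: codim_def)
  next
    case False
    then show ?thesis by (simp add: mp.dim_zero_space)
  qed
  ultimately show ?thesis
    using dim_gen_part_le[of r A t] dim_gen_part_le[of r "insert f A" t] unfolding codim_def by linarith
qed

text \<open>The cube of all exponent vectors with entries at most \<open>q\<close>.\<close>

lemma exists_many_monomials:
  "\<exists>S. finite S \<and> card S = (q + 1) ^ r \<and> (\<forall>m\<in>S. keys m \<subseteq> {..<r} \<and> mdeg m \<le> r * q)"
proof (induction r)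
  case 0
  show ?case by (intro exI[of _ "{0}"]) simp
next
  case (Suc r)
  then obtain S where S: "finite S" "card S = (q + 1) ^ r" "\<forall>m\<in>S. keys m \<subseteq> {..<r} \<and> mdeg m \<le> r * q" by blast
  let ?f = "\<lambda>(m, e). m + single r e :: nat \<Rightarrow>\<^sub>0 nat"
  have inj: "inj_on ?f (S \<times> {..q})"
  proof (rule inj_onI, clarify)
    fix m e m' e' assume a: "m \<in> S" "m' \<in> S" "m + single r e = m' + single r e'"
    have "r \<notin> keys m" "r \<notin> keys m'" using S(3) a(1,2) by fastforce+
    then have "lookup m r = 0" "lookup m' r = 0" by (simp_all add: in_keys_iff)
    then have "e = e'" using arg_cong[OF a(3), of "\<lambda>p. lookup p r"] by (simp add: lookup_add)
    then show "m = m' \<and> e = e'" using a(3) by simp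
  qed
  have "card (?f ` (S \<times> {..q})) = (q + 1) ^ Suc r"
    using card_image[OF inj] S(2) by (simp add: card_cartesian_product)
  moreover have "keys (m + single r e) \<subseteq> {..<Suc r} \<and> mdeg (m + single r e) \<le> Suc r * q" if me: "m \<in> S" "e \<le> q" for m e
  proof
    have m: "keys m \<subseteq> {..<r}" "mdeg m \<le> r * q" using S(3) me(1) by auto
    show "keys (m + single r e) \<subseteq> {..<Suc r}"
      using m(1) keys_add[of m "single r e"] by (force split: if_splits)
    show "mdeg (m + single r e) \<le> Suc r * q" using m(2) me(2) by (simp add: mdeg_add)
  qed
  ultimately show ?case using S(1) by (intro exI[of _ "?f ` (S \<times> {..q})"]) auto
qed

lemma dim_graded_part: "pdim (graded_part r d :: ('k::field) mpoly set) = card (mons r d)"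
proof -
  let ?B = "(\<lambda>m. single m 1) ` mons r d :: 'k mpoly set"
  have inj: "inj_on (\<lambda>m. single m (1 :: 'k)) (mons r d)"
    by (rule inj_onI) (metis keys_single singleton_inject zero_neq_one)
  have "pdim (graded_part r d :: 'k mpoly set) = card ?B"
  proof (rule mp.vs.dim_unique[of ?B])
    show "?B \<subseteq> graded_part r d" using single_in_graded_part by blast
    show "graded_part r d \<subseteq> pspan ?B"
    proof
      fix p :: "'k mpoly" assume "p \<in> graded_part r d"
      then have "p = (\<Sum>m\<in>mons r d. smul (lookup p m) (single m 1))"
        by (intro mpoly_eq_sum_mons[OF finite_mons]) (simp add: graded_part_iff)
      also have "\<dots> \<in> pspan ?B" by (intro mp.vs.span_sum mp.vs.span_scale mp.vs.span_base) auto
      finally show "p \<in> pspan ?B" .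
    qed
    show "pindep ?B"
      unfolding mp.vs.dependent_def
    proof clarify
      fix m assume m: "m \<in> mons r d" and sp: "single m (1 :: 'k) \<in> pspan (?B - {single m 1})"
      have "pair (single m (1 :: 'k)) (single m 1) = 0"
      proof (rule pair_zero_span[OF sp])
        fix b :: "'k mpoly" assume "b \<in> ?B - {single m 1}"
        then obtain m' where "b = single m' 1" "m' \<noteq> m" by blast
        then show "pair b (single m 1) = 0" by (simp add: pair_single lookup_single)
      qed
      then show False by (simp add: pair_single)
    qed
  qed simp
  then show ?thesis using card_image[OF inj] by simp
qed

lemma dim_graded_part_1_le: "pdim (graded_part r 1 :: ('k::field) mpoly set) \<le> r"
proof -
  have "mons r 1 \<subseteq> (\<lambda>i. single i 1) ` {..<r}"
  proof
    fix m assume "m \<in> mons r 1"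
    then have "m \<in> mons r (Suc 0)" by simp
    then obtain i m' where "i < r" "m' \<in> mons r 0" "m = m' + single i 1" by (rule mons_Suc_cases)
    then show "m \<in> (\<lambda>i. single i 1) ` {..<r}" by simp
  qed
  then have "card (mons r 1) \<le> card ((\<lambda>i. single i (1 :: nat)) ` {..<r})" by (intro card_mono) auto
  also have "\<dots> \<le> r" using card_image_le[of "{..<r}" "\<lambda>i. single i (1::nat)"] by simp
  finally show ?thesis by (simp add: dim_graded_part)
qed

text \<open>A counting form of Krull's height theorem: each further form lowers the order of growth
  of the summed Hilbert function by at most one. The constants \<open>b\<close> and \<open>c\<close>
  absorb the degrees of the forms.\<close>

lemma sum_codim_growth:
  fixes A :: "('k::field) mpoly set"
  assumes "finite A" "card A \<le> r" "\<And>f. f \<in> A \<Longrightarrow> \<exists>a>0. f \<in> graded_part r a"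
  shows "\<exists>b c. 0 < b \<and> (\<forall>q\<ge>1. q ^ (r - card A) \<le> c * (\<Sum>t\<le>b * q. codim r A t))"
  using assms
proof (induction A)
  case empty
  have gp: "pdim (gen_part r {} t) = 0" for t
    by (simp add: gen_part_def mp.dim_zero_space)
  \<comment> \<open>The factor is \<open>r + 1\<close> and not \<open>r\<close> so that
    \<open>b\<close> is positive even for \<open>r = 0\<close>.\<close>
  have "q ^ r \<le> (\<Sum>t\<le>(r + 1) * q. codim r ({} :: 'k mpoly set) t)" if "1 \<le> q" for q
  proof -
    obtain S where S: "finite S" "card S = (q + 1) ^ r" "\<forall>m\<in>S. keys m \<subseteq> {..<r} \<and> mdeg m \<le> r * q"
      using exists_many_monomials by blast
    have "S \<subseteq> (\<Union>t\<le>(r + 1) * q. mons r t)" using S(3) by (auto simp: mons_def intro: trans_le_add2)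
    then have "card S \<le> card (\<Union>t\<le>(r + 1) * q. mons r t)"
      by (intro card_mono) (auto simp: finite_mons)
    also have "\<dots> \<le> (\<Sum>t\<le>(r + 1) * q. card (mons r t))" by (rule card_UN_le) simp
    also have "\<dots> = (\<Sum>t\<le>(r + 1) * q. codim r ({} :: 'k mpoly set) t)"
      by (simp add: codim_def gp dim_graded_part)
    finally have "(q + 1) ^ r \<le> (\<Sum>t\<le>(r + 1) * q. codim r ({} :: 'k mpoly set) t)" using S(2) by simp
    moreover have "q ^ r \<le> (q + 1) ^ r" by (rule power_mono) auto
    ultimately show ?thesis by linarith
  qed
  then show ?case by (intro exI[of _ "r + 1"] exI[of _ 1]) simp
next
  case (insert f A)
  obtain b c where bc: "0 < b" "\<And>q. 1 \<le> q \<Longrightarrow> q ^ (r - card A) \<le> c * (\<Sum>t\<le>b * q. codim r A t)"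
    using insert by auto
  obtain a where a: "0 < a" "f \<in> graded_part r a" using insert.prems by auto
  let ?h = "codim r A" and ?h' = "codim r (insert f A)"
  have step: "(\<Sum>t\<le>T + a. ?h t) \<le> (\<Sum>t\<le>T + a. ?h' t) + (\<Sum>t\<le>T. ?h t)" for T
  proof -
    have "(\<Sum>t\<le>T + a. ?h t) \<le> (\<Sum>t\<le>T + a. ?h' t + (if a \<le> t then ?h (t - a) else 0))"
      by (intro sum_mono codim_insert_ge a)
    also have "\<dots> = (\<Sum>t\<le>T + a. ?h' t) + (\<Sum>t\<le>T + a. if a \<le> t then ?h (t - a) else 0)" by (rule sum.distrib)
    also have "(\<Sum>t\<le>T + a. if a \<le> t then ?h (t - a) else 0) = (\<Sum>t\<in>{a..T + a}. ?h (t - a))"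
      by (rule sum.mono_neutral_cong_right) auto
    also have "\<dots> = (\<Sum>t\<le>T. ?h t)"
      by (rule sum.reindex_bij_witness[of _ "\<lambda>t. t + a" "\<lambda>t. t - a"]) auto
    finally show ?thesis .
  qed
  \<comment> \<open>Iterating \<open>step\<close> in blocks of length \<open>a\<close> gives
    \<open>j + 1\<close> partial sums, each at most the last one.\<close>
  have tel: "(\<Sum>t\<le>a * j. ?h t) \<le> (j + 1) * (\<Sum>t\<le>a * j. ?h' t)" for j
  proof (induction j)
    case 0
    show ?case using codim_insert_ge[OF a(2,1), of A 0] a(1) by simp
  next
    case (Suc j)
    have eq: "a * Suc j = a * j + a" by simp
    have "(\<Sum>t\<le>a * j. ?h' t) \<le> (\<Sum>t\<le>a * Suc j. ?h' t)" by (rule sum_mono2) auto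
    then have "(j + 1) * (\<Sum>t\<le>a * j. ?h' t) \<le> (j + 1) * (\<Sum>t\<le>a * Suc j. ?h' t)" by (rule mult_le_mono2)
    then have "(\<Sum>t\<le>a * Suc j. ?h t) \<le> (\<Sum>t\<le>a * Suc j. ?h' t) + (j + 1) * (\<Sum>t\<le>a * Suc j. ?h' t)"
      using step[of "a * j"] Suc unfolding eq by linarith
    also have "\<dots> = (Suc j + 1) * (\<Sum>t\<le>a * Suc j. ?h' t)" by simp
    finally show ?case .
  qed
  have "q ^ (r - card (insert f A)) \<le> (c * 2 * b) * (\<Sum>t\<le>a * b * q. ?h' t)" if q: "1 \<le> q" for q
  proof -
    have k: "r - card A = Suc (r - card (insert f A))" using insert by simp
    \<comment> \<open>The bound for \<open>A\<close> is used at \<open>a * q\<close>, so that the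
      upper limit of summation is a multiple of \<open>a\<close> and \<open>tel\<close>
      applies.\<close>
    have "q ^ (r - card A) \<le> (a * q) ^ (r - card A)" using a(1) by (intro power_mono) auto
    also have "\<dots> \<le> c * (\<Sum>t\<le>b * (a * q). ?h t)" using a(1) q by (intro bc(2)) simp
    also have "b * (a * q) = a * (b * q)" by simp
    also have "c * (\<Sum>t\<le>a * (b * q). ?h t) \<le> c * ((b * q + 1) * (\<Sum>t\<le>a * (b * q). ?h' t))"
      by (rule mult_le_mono2[OF tel])
    also have "\<dots> \<le> c * ((2 * b * q) * (\<Sum>t\<le>a * (b * q). ?h' t))"
    proof -
      have "1 \<le> b * q" using bc(1) q by simp
      then have "b * q + 1 \<le> 2 * b * q" by simp
      then show ?thesis by (intro mult_le_mono2 mult_le_mono1)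
    qed
    finally have "q * q ^ (r - card (insert f A)) \<le> q * ((c * 2 * b) * (\<Sum>t\<le>a * b * q. ?h' t))"
      unfolding k by (simp add: mult_ac)
    then show ?thesis using q by simp
  qed
  then show ?case using a(1) bc(1) by (intro exI[of _ "a * b"] exI[of _ "c * 2 * b"]) simp
qed

text \<open>Stands for the existence of a common zero. If the ideal contained everything in degree
  \<open>t\<close>, it would do so in all higher degrees, and the summed \<open>codim\<close> would
  stay bounded, whereas it must grow at least linearly.\<close>

lemma gen_part_neq_graded_part:
  fixes A :: "('k::field) mpoly set"
  assumes A: "finite A" "card A < r" "\<And>f. f \<in> A \<Longrightarrow> \<exists>a>0. f \<in> graded_part r a"
  shows "gen_part r A t \<noteq> graded_part r t"
proof
  assume eq: "gen_part r A t = graded_part r t"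
  have "graded_part r (t + k) \<subseteq> gen_part r A (t + k)" for k
  proof (induction k)
    case (Suc k)
    have "var i * p \<in> gen_part r A (Suc (t + k))" if "p \<in> gen_part r A (t + k)" "i < r" for i p
      using gen_part_mult[OF var_in_graded_part[OF that(2)] that(1)] by simp
    then show ?case using graded_part_Suc_subset[OF _ subspace_gen_part Suc] by simp
  qed (simp add: eq)
  then have z: "codim r A s = 0" if "t \<le> s" for s
    using gen_part_subset[of r A s] that by (metis codim_def diff_self_eq_0 le_add_diff_inverse subset_antisym)
  obtain b c where bc: "0 < b" "\<And>q. 1 \<le> q \<Longrightarrow> q ^ (r - card A) \<le> c * (\<Sum>t\<le>b * q. codim r A t)"
    using sum_codim_growth[of A r] A by auto
  let ?C = "\<Sum>s<t. codim r A s"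
  have "q \<le> c * ?C" if q: "1 \<le> q" for q
  proof -
    have "q ^ 1 \<le> q ^ (r - card A)" using q A(2) by (intro power_increasing) auto
    also have "\<dots> \<le> c * (\<Sum>t\<le>b * q. codim r A t)" using bc(2)[OF q] .
    also have "(\<Sum>s\<le>b * q. codim r A s) = (\<Sum>s\<in>{..b * q} \<inter> {..<t}. codim r A s)"
      by (rule sum.mono_neutral_right) (simp, simp, intro ballI z, auto)
    also have "\<dots> \<le> ?C" by (rule sum_mono2) auto
    finally show ?thesis by simp
  qed
  from this[of "c * ?C + 1"] show False by simp
qed

section \<open>Almost maximal growth\<close>

definition derivs :: "nat \<Rightarrow> ('k::field) mpoly set \<Rightarrow> 'k mpoly set" where
  "derivs r V = pspan (\<Union>i<r. shift i ` V)"

lemma subspace_derivs: "psubspace (derivs r V)"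
  by (simp add: derivs_def)

lemma derivs_subset:
  assumes "psubspace M" "V \<subseteq> up r d M"
  shows "derivs r V \<subseteq> M"
  unfolding derivs_def by (rule mp.vs.span_minimal) (use assms in \<open>auto simp: up_def\<close>)

lemma shift_in_derivs: "p \<in> V \<Longrightarrow> i < r \<Longrightarrow> shift i p \<in> derivs r V"
  unfolding derivs_def by (rule mp.vs.span_base) blast

lemma subset_up_derivs: "V \<subseteq> graded_part r (Suc d) \<Longrightarrow> V \<subseteq> up r d (derivs r V)"
  by (auto simp: up_def shift_in_derivs)

lemma derivs_subset_graded_part:
  assumes "V \<subseteq> graded_part r (Suc d)"
  shows "derivs r V \<subseteq> graded_part r d"
  by (rule derivs_subset[OF subspace_graded_part]) (use assms in \<open>auto simp: up_def intro!: shift_in_graded_part\<close>)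

lemma lshift_derivs: "lshift r t ` derivs r V = derivs r (lshift r t ` V)"
proof -
  have "lshift r t ` (\<Union>i<r. shift i ` V) = (\<Union>i<r. shift i ` (lshift r t ` V))"
    by (simp add: image_UN image_image shift_lshift)
  then show ?thesis
    unfolding derivs_def using mp.vs2.linear_span_image[OF lin_lshift, of r t "\<Union>i<r. shift i ` V"] by simp
qed

text \<open>The condition \<open>a j \<le> j\<close> under which Macaulay's bound forbids growth
  reproduces itself, since the index rises and the value does not.\<close>

lemma nonincreasing_chain:
  fixes a :: "nat \<Rightarrow> nat"
  assumes mac: "\<And>j. j < n \<Longrightarrow> a j \<le> j \<Longrightarrow> a (Suc j) \<le> a j"
    and "a j \<le> j" "j \<le> i" "i \<le> n"
  shows "a i \<le> a j"
  using assms(3,4)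
proof (induction i rule: dec_induct)
  case (step i)
  then have "a i \<le> a j" by simp
  moreover have "a i \<le> i" using step \<open>a j \<le> j\<close> by simp
  ultimately show ?case using mac[of i] step by simp
qed simp

text \<open>Below degree \<open>n\<close>, either \<open>a j > j\<close>, or \<open>a j\<close> is
  at least \<open>a n = \<delta>\<close> and differs from it by \<open>not_flat\<close>; so no term
  is smaller than claimed. At \<open>n\<close> the sum is one below the bound, which leaves no room
  for a larger term.\<close>

lemma kernel_dims_exact:
  fixes a :: "nat \<Rightarrow> nat"
  assumes mac: "\<And>j. j < n \<Longrightarrow> a j \<le> j \<Longrightarrow> a (Suc j) \<le> a j"
    and a: "a n = \<delta>" "1 \<le> \<delta>" "\<delta> \<le> n"
    and not_flat: "\<And>j. j < n \<Longrightarrow> \<delta> \<le> j \<Longrightarrow> a j \<noteq> \<delta>"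
    and bound: "(\<Sum>j\<le>n. a j) < (\<Sum>j\<le>n. min (\<delta> + 1) (j + 1))"
    and j: "j < n"
  shows "a j = min (\<delta> + 1) (j + 1)"
proof -
  have ge: "min (\<delta> + 1) (j + 1) \<le> a j" if j: "j < n" for j
  proof (cases "a j \<le> j")
    case True
    have "a n \<le> a j" by (rule nonincreasing_chain[OF mac True]) (use j in auto)
    then have "\<delta> \<le> a j" using a(1) by simp
    then show ?thesis using not_flat[OF j] True by simp
  qed simp
  have eq: "sum f {..n} = sum f {..<n} + f n" for f :: "nat \<Rightarrow> nat"
    by (simp flip: lessThan_Suc_atMost)
  have "(\<Sum>j<n. a j) \<le> (\<Sum>j<n. min (\<delta> + 1) (j + 1))"
    using bound a(1,3) unfolding eq by simp
  moreover have "(\<Sum>j<n. min (\<delta> + 1) (j + 1)) \<le> (\<Sum>j<n. a j)"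
    by (rule sum_mono) (use ge in auto)
  ultimately have "(\<Sum>j<n. min (\<delta> + 1) (j + 1)) = (\<Sum>j<n. a j)" by simp
  then have "min (\<delta> + 1) (j + 1) = a j"
    by (rule sum_mono_inv) (use ge j in auto)
  then show ?thesis by simp
qed

text \<open>Rank and nullity summed over degrees: \<open>lshift\<close> maps each extension into the
  previous one, so each degree adds at most a kernel.\<close>

lemma dim_ups_le:
  fixes Q :: "('k::field) mpoly set"
  assumes Q: "psubspace Q" "Q \<subseteq> graded_part r d"
    and k: "\<And>i. i < k \<Longrightarrow> pdim {v\<in>ups r d Q (Suc i). lshift r t v = 0} \<le> f (Suc i)"
  shows "pdim (ups r d Q k) \<le> pdim Q + (\<Sum>i<k. f (Suc i))"
  using k
proof (induction k)
  case (Suc k)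
  have fd: "mp.fin_dim (ups r d Q i)" for i by (rule fin_dim_subset_graded[OF ups_subset[OF Q(2)]])
  have "pdim (ups r d Q (Suc k)) \<le> pdim {v\<in>ups r d Q (Suc k). lshift r t v = 0} + pdim (ups r d Q k)"
    by (rule mp.dim_kernel_ge[OF lin_lshift subspace_ups[OF Q(1)] fd _ fd])
      (use lshift_up[OF subspace_ups[OF Q(1)]] in auto)
  then show ?case using Suc.IH Suc.prems[of k] Suc.prems by force
qed simp

text \<open>Dually, for a subspace \<open>Q\<close> of degree \<open>d\<close>, its orthogonal lies
  in an ideal generated by at most \<open>c\<close> forms of positive degree. For
  \<open>c < r\<close> such forms have a common zero.\<close>

definition cut_by :: "nat \<Rightarrow> nat \<Rightarrow> ('k::field) mpoly set \<Rightarrow> nat \<Rightarrow> bool" where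
  "cut_by r d Q c \<longleftrightarrow> (\<exists>A. finite A \<and> card A \<le> c \<and> (\<forall>f\<in>A. \<exists>a>0. f \<in> graded_part r a) \<and>
     perp r d (gen_part r A d) \<subseteq> Q)"

lemma one_in_graded_part: "1 \<in> graded_part r 0"
  by (simp add: graded_part_iff)

text \<open>The generators found in degree \<open>d\<close> already confine the system to
  \<open>ups\<close>; the codimension of \<open>M\<close> there is the number of new generators, all
  of degree \<open>d + k\<close>.\<close>

lemma cut_by_step:
  fixes Q :: "('k::field) mpoly set"
  assumes cut: "cut_by r d Q c" and Q: "psubspace Q" "Q \<subseteq> graded_part r d"
    and M: "psubspace M" "M \<subseteq> ups r d Q k" "pdim (ups r d Q k) \<le> pdim M + c'" and pos: "0 < d + k"
  shows "cut_by r (d + k) M (c + c')"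
proof -
  obtain A where A: "finite A" "card A \<le> c" "\<forall>f\<in>A. \<exists>a>0. f \<in> graded_part r a"
    "perp r d (gen_part r A d) \<subseteq> Q" using cut unfolding cut_by_def by blast
  obtain B where B: "finite B" "B \<subseteq> graded_part r (d + k)" "card B + pdim M = pdim (ups r d Q k)"
    "\<And>q. q \<in> ups r d Q k \<Longrightarrow> (\<And>a. a \<in> B \<Longrightarrow> pair a q = 0) \<Longrightarrow> q \<in> M"
    by (rule cut_out_by_forms[OF M(1,2) subspace_ups[OF Q(1)] ups_subset[OF Q(2)]]) (rule that, assumption+, blast)
  have "perp r (d + k) (gen_part r (A \<union> B) (d + k)) \<subseteq> M"
  proof
    fix q assume q: "q \<in> perp r (d + k) (gen_part r (A \<union> B) (d + k))"
    have "var i * p \<in> gen_part r A (Suc e)" if "p \<in> gen_part r A e" "i < r" for e i p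
      using gen_part_mult[OF var_in_graded_part[OF that(2)] that(1)] by simp
    then have "perp r (d + k) (gen_part r A (d + k)) \<subseteq> ups r d Q k"
      by (rule perp_subset_ups) (use A(4) in auto)
    then have "q \<in> ups r d Q k" using q perp_mono[OF gen_part_mono[of A "A \<union> B" r "d + k"]] by blast
    moreover have "pair b q = 0" if "b \<in> B" for b
    proof -
      have "b * 1 \<in> gen_part r (A \<union> B) (d + k + 0)"
        by (rule gen_part_I[OF _ _ one_in_graded_part]) (use that B(2) in auto)
      then show ?thesis using q by (simp add: perp_def)
    qed
    ultimately show "q \<in> M" by (rule B(4))
  qed
  moreover have "card (A \<union> B) \<le> c + c'" using card_Un_le[of A B] A(2) B(3) M(3) by linarith
  moreover have "\<forall>f\<in>A \<union> B. \<exists>a>0. f \<in> graded_part r a" using A(3) B(2) pos by blast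
  ultimately show ?thesis unfolding cut_by_def using A(1) B(1) by blast
qed

lemma dim_ups_pos_of_cut_by:
  fixes M :: "('k::field) mpoly set"
  assumes "cut_by r n M c" "c < r" "psubspace M" "M \<subseteq> graded_part r n"
  shows "0 < pdim (ups r n M k)"
proof -
  obtain A where A: "finite A" "card A \<le> c" "\<forall>f\<in>A. \<exists>a>0. f \<in> graded_part r a"
    "perp r n (gen_part r A n) \<subseteq> M" using assms(1) unfolding cut_by_def by blast
  let ?V = "gen_part r A (n + k)"
  have "var i * p \<in> gen_part r A (Suc e)" if "p \<in> gen_part r A e" "i < r" for e i p
    using gen_part_mult[OF var_in_graded_part[OF that(2)] that(1)] by simp
  then have sub: "perp r (n + k) ?V \<subseteq> ups r n M k"
    by (rule perp_subset_ups) (use A(4) in auto)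
  have ne: "?V \<noteq> graded_part r (n + k)"
    by (rule gen_part_neq_graded_part[OF A(1)]) (use A assms(2) in auto)
  have "pdim ?V < pdim (graded_part r (n + k) :: 'k mpoly set)"
  proof (rule ccontr)
    assume "\<not> pdim ?V < pdim (graded_part r (n + k) :: 'k mpoly set)"
    then have "?V = graded_part r (n + k)"
      by (intro mp.subspace_eqI_dim subspace_gen_part gen_part_subset fin_dim_graded_part) simp
    then show False using ne by simp
  qed
  moreover have "pdim (perp r (n + k) ?V) + pdim ?V = pdim (graded_part r (n + k) :: 'k mpoly set)"
    by (rule dim_perp[OF subspace_gen_part gen_part_subset])
  ultimately have "0 < pdim (perp r (n + k) ?V)" by linarith
  also have "\<dots> \<le> pdim (ups r n M k)"
    by (rule mp.dim_mono_fin[OF fin_dim_subset_graded[OF ups_subset[OF assms(4)]] sub])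
  finally show ?thesis .
qed

text \<open>The case where \<ell>, given by one fixed parameter \<open>t\<close>, is onto. Its
  kernel then has the largest dimension that Green's bound allows.\<close>

locale almost_maximal_growth =
  fixes r n \<delta> :: nat and t :: "'k::field" and M :: "'k mpoly set"
  assumes inf: "infinite (UNIV :: 'k set)"
    and M: "psubspace M" "M \<subseteq> graded_part r n"
    and \<delta>: "1 \<le> \<delta>" "\<delta> \<le> n"
    and kernel: "pdim {v\<in>M. lshift r t v = 0} = \<delta>"
    and onto: "lshift r t ` up r n M = M"
    and bound: "pdim M < (\<Sum>j\<le>n. min (\<delta> + 1) (j + 1))"
begin

text \<open>The degree \<open>j\<close> part of the inverse system generated by \<open>M\<close>,
  for \<open>j \<le> n\<close>: all contractions of order \<open>n - j\<close>.\<close>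

definition D :: "nat \<Rightarrow> 'k mpoly set" where "D j = (derivs r ^^ (n - j)) M"
definition N :: "nat \<Rightarrow> 'k mpoly set" where "N j = {v\<in>D j. lshift r t v = 0}"
abbreviation a :: "nat \<Rightarrow> nat" where "a j \<equiv> pdim (N j)"

lemma D_n: "D n = M"
  by (simp add: D_def)

lemma D_Suc: "j < n \<Longrightarrow> D j = derivs r (D (Suc j))"
  using Suc_diff_Suc[of j n] unfolding D_def by (metis comp_apply funpow.simps(2))

lemma subspace_D: "j \<le> n \<Longrightarrow> psubspace (D j)"
  by (cases "j = n") (simp_all add: D_n M D_Suc subspace_derivs)

lemma D_subset: "j \<le> n \<Longrightarrow> D j \<subseteq> graded_part r j"
proof (induction j rule: inc_induct)
  case (step j)
  then show ?case by (simp add: D_Suc derivs_subset_graded_part)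
qed (simp add: D_n M)

text \<open>\<open>lshift\<close> commutes with \<open>derivs\<close>, so surjectivity descends. At
  the top, \<open>derivs\<close> of the extension is all of \<open>M\<close>, because
  \<open>lshift\<close> is a combination of contractions and is onto.\<close>

lemma lshift_D: "j < n \<Longrightarrow> lshift r t ` D (Suc j) = D j"
proof (induction "n - Suc j" arbitrary: j)
  case 0
  then have j: "Suc j = n" by simp
  have "derivs r (up r n M) = M"
  proof
    show "derivs r (up r n M) \<subseteq> M" by (rule derivs_subset[OF M(1) order_refl])
    have "lshift r t p \<in> derivs r (up r n M)" if "p \<in> up r n M" for p
      by (rule lshift_in_subspace[OF subspace_derivs]) (use that shift_in_derivs in blast)
    then have "lshift r t ` up r n M \<subseteq> derivs r (up r n M)" by (rule image_subsetI)
    then show "M \<subseteq> derivs r (up r n M)" unfolding onto .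
  qed
  then have "lshift r t ` M = derivs r M"
    using lshift_derivs[of r t "up r n M"] onto by simp
  then show ?case using j 0 by (simp add: D_n D_Suc)
next
  case (Suc k)
  then have j: "Suc j < n" by simp
  have "lshift r t ` D (Suc (Suc j)) = D (Suc j)" using Suc j by (intro Suc.hyps(1)) auto
  then have "lshift r t ` derivs r (D (Suc (Suc j))) = derivs r (D (Suc j))" by (simp add: lshift_derivs)
  then show ?case using j by (simp add: D_Suc)
qed

lemma fin_dim_D: "j \<le> n \<Longrightarrow> mp.fin_dim (D j)"
  using D_subset fin_dim_subset_graded by blast

lemma subspace_N: "j \<le> n \<Longrightarrow> psubspace (N j)"
  unfolding N_def by (rule subspace_kernel[OF lin_lshift subspace_D])

lemma N_subset: "j \<le> n \<Longrightarrow> N j \<subseteq> graded_part r j"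
  unfolding N_def using D_subset by blast

lemma D_subset_up: "j < n \<Longrightarrow> D (Suc j) \<subseteq> up r j (D j)"
  using subset_up_derivs[OF D_subset[of "Suc j"]] by (simp add: D_Suc)

lemma N_subset_up: "j < n \<Longrightarrow> N (Suc j) \<subseteq> up r j (N j)"
  unfolding N_def using D_subset_up[of j] kernel_up[of r j "D j" t] by blast

lemma dim_D_Suc:
  assumes "j < n"
  shows "pdim (D (Suc j)) = a (Suc j) + pdim (D j)"
proof -
  have j: "Suc j \<le> n" using assms by simp
  show ?thesis
    using mp.rank_nullity(1)[OF lin_lshift subspace_D[OF j] fin_dim_D[OF j], of r t] lshift_D[OF assms]
    by (simp add: N_def)
qed

lemma dim_M_pos: "0 < pdim M"
proof -
  have "\<delta> \<le> pdim M"
    unfolding kernel[symmetric] by (rule mp.dim_mono_fin[OF fin_dim_subset_graded[OF M(2)]]) blast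
  then show ?thesis using \<delta> by simp
qed

text \<open>The contractions of a nonzero form of positive degree do not all vanish, so contracting
  \<open>M\<close> repeatedly reaches the constants, and these are killed by every
  contraction.\<close>

lemma dim_D_0: "pdim (D 0) = 1" "a 0 = 1"
proof -
  have "0 < pdim (D j)" if "j \<le> n" for j
    using that
  proof (induction j rule: inc_induct)
    case (step j)
    show ?case
    proof (rule ccontr)
      assume "\<not> 0 < pdim (D j)"
      then have "D j \<subseteq> {0}" using mp.dim_eq_0_fin[OF fin_dim_D[of j]] step(2) by simp
      then have "D (Suc j) \<subseteq> {0}"
      proof (intro subsetI)
        fix p assume "D j \<subseteq> {0}" "p \<in> D (Suc j)"
        then have "p \<in> up r j {0}" using D_subset_up[OF step(2)] up_mono[of "D j" "{0}" r j] by blast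
        then have "p = 0" by (intro graded_part_eq_0I[of p r j]) (auto simp: up_def)
        then show "p \<in> {0}" by simp
      qed
      then have "pdim (D (Suc j)) \<le> pdim {0 :: 'k mpoly}"
        by (intro mp.dim_mono_fin) (auto simp: mp.fin_dim_def)
      then show False using step by (simp add: mp.dim_zero_space)
    qed
  qed (simp add: D_n dim_M_pos)
  from this[of 0] have "0 < pdim (D 0)" by simp
  moreover have "pdim (D 0) \<le> 1"
    using mp.dim_mono_fin[OF fin_dim_graded_part D_subset[of 0]] by (simp add: dim_graded_part)
  ultimately show 1: "pdim (D 0) = 1" by simp
  have "lshift r t v = 0" if v: "v \<in> graded_part r 0" for v
  proof -
    have "shift i v = 0" for i
    proof (rule poly_mapping_eqI)
      fix m
      have "m + single i (1 :: nat) \<noteq> 0"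
      proof
        assume "m + single i (1 :: nat) = 0"
        then have "lookup (m + single i (1 :: nat)) i = 0" by simp
        then show False by (simp add: lookup_add)
      qed
      then show "lookup (shift i v) m = lookup 0 m" using v by (auto simp: graded_part_iff in_keys_iff)
    qed
    then show ?thesis by (simp add: lshift_def)
  qed
  then have "N 0 = D 0" unfolding N_def using D_subset[of 0] by auto
  then show "a 0 = 1" using 1 by simp
qed

lemma dim_D: "m \<le> n \<Longrightarrow> pdim (D m) = (\<Sum>j\<le>m. a j)"
proof (induction m)
  case (Suc m)
  then show ?case by (simp add: dim_D_Suc)
qed (simp add: dim_D_0)

lemma macaulay_N: "j < n \<Longrightarrow> a j \<le> j \<Longrightarrow> a (Suc j) \<le> a j"
  by (rule dim_le_of_subset_up[OF inf subspace_N N_subset _ subspace_N N_subset_up]) auto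

lemma a_n: "a n = \<delta>"
  using kernel by (simp add: N_def D_n)

text \<open>From degree \<open>j\<close> on the kernel dimensions cannot increase, and
  \<open>a n = \<delta>\<close>, so they are constant. The kernel therefore grows maximally from
  degree \<open>n - 1\<close> to \<open>n\<close>, and persistence applies to it.\<close>

lemma dim_ups_pos_flat:
  assumes "j < n" "\<delta> \<le> j" "a j = \<delta>"
  shows "0 < pdim (ups r n M k)"
proof -
  obtain l where l: "n = Suc l" using assms(1) by (cases n) auto
  have "a l \<le> a j" using nonincreasing_chain[of n a j l] macaulay_N assms l by simp
  then have al: "a l \<le> l" using assms l by simp
  have "a n \<le> a l" using macaulay_N[of l] al l by simp
  then have eq: "a l = \<delta>" using \<open>a l \<le> a j\<close> assms(3) a_n by simp
  have sN: "psubspace (N l)" "N l \<subseteq> graded_part r l" using subspace_N N_subset l by auto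
  have sub: "N n \<subseteq> up r l (N l)" using N_subset_up[of l] l by simp
  have le: "pdim (up r l (N l)) \<le> pdim (N l)"
    by (rule dim_le_of_subset_up[OF inf sN al subspace_up[OF sN(1)] order_refl])
  \<comment> \<open>Equality is needed because persistence speaks of the extensions of
    \<open>N l\<close>; they now become extensions of a subspace of \<open>M\<close>.\<close>
  have Neq: "N n = up r l (N l)"
    by (rule mp.subspace_eqI_dim[OF subspace_N sub fin_dim_subset_graded[OF up_subset]])
      (use le eq a_n in auto)
  have "\<delta> \<le> pdim (ups r l (N l) (Suc k))"
    using dim_ups_ge_of_le_degree[OF inf sN al, of "Suc k"] eq a_n Neq by simp
  also have "ups r l (N l) (Suc k) = ups r n (N n) k" by (simp only: ups_Suc Neq l[symmetric])
  also have "pdim (ups r n (N n) k) \<le> pdim (ups r n M k)"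
    by (rule mp.dim_mono_fin[OF fin_dim_subset_graded[OF ups_subset[OF M(2)]] ups_mono])
      (auto simp: N_def D_n)
  finally show ?thesis using \<delta> by simp
qed

lemma D_subset_ups: "j + k \<le> n \<Longrightarrow> D (j + k) \<subseteq> ups r j (D j) k"
proof (induction k)
  case (Suc k)
  have "D (j + Suc k) \<subseteq> up r (j + k) (D (j + k))" using D_subset_up[of "j + k"] Suc.prems by simp
  also have "\<dots> \<subseteq> ups r j (D j) (Suc k)" using Suc by (simp add: up_mono)
  finally show ?case .
qed simp

text \<open>Linear forms suffice in degree 1. The starting point is the full degree 0 part, which
  takes no generators and whose extension has dimension at most \<open>r\<close>.\<close>

lemma cut_by_D_1:
  assumes "1 \<le> n" "pdim (D 1) \<le> r"
  shows "cut_by r 1 (D 1) (r - pdim (D 1))"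
proof -
  have "cut_by r 0 (graded_part r 0 :: 'k mpoly set) 0"
    unfolding cut_by_def using perp_subset by (intro exI[of _ "{}"]) auto
  moreover have "D 1 \<subseteq> ups r 0 (graded_part r 0) 1"
    using D_subset[OF assms(1)] shift_in_graded_part[of _ r 0] by (auto simp: up_def)
  moreover have "pdim (ups r 0 (graded_part r 0 :: 'k mpoly set) 1) \<le> r"
    using le_trans[OF _ dim_graded_part_1_le]
      mp.dim_mono_fin[OF fin_dim_graded_part, of "ups r 0 (graded_part r 0 :: 'k mpoly set) 1" r 1]
      ups_subset[of "graded_part r 0 :: 'k mpoly set" r 0 1] by simp
  ultimately have "cut_by r (0 + 1) (D 1) (0 + (r - pdim (D 1)))"
    by (intro cut_by_step[OF _ subspace_graded_part order_refl subspace_D[OF assms(1)]]) (use assms in auto)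
  then show ?thesis by simp
qed

lemma kernel_ups_D:
  "{v\<in>ups r j (D j) (Suc i). lshift r t v = 0} \<subseteq> up r (j + i) {v\<in>ups r j (D j) i. lshift r t v = 0}"
  using kernel_up by simp

text \<open>If \<open>D 1\<close> has a two-dimensional kernel, the kernels above grow at most like
  the forms in two variables, of which there are \<open>i + 2\<close> independent ones in degree
  \<open>1 + i\<close>.\<close>

lemma dim_kernel_ups_plane:
  assumes "1 \<le> n" "a 1 = 2"
  shows "pdim {v\<in>ups r 1 (D 1) i. lshift r t v = 0} \<le> i + 2"
proof (induction i)
  case 0
  then show ?case using assms(2) by (simp add: N_def)
next
  case (Suc i)
  have sp: "psubspace {v\<in>ups r 1 (D 1) i. lshift r t v = 0}" for i
    by (rule subspace_kernel[OF lin_lshift subspace_ups[OF subspace_D[OF assms(1)]]])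
  have gr: "{v\<in>ups r 1 (D 1) i. lshift r t v = 0} \<subseteq> graded_part r (1 + i)"
    using ups_subset[OF D_subset[OF assms(1)]] by blast
  have "pdim {v\<in>ups r 1 (D 1) (Suc i). lshift r t v = 0} \<le> (1 + i) + 2"
    by (rule dim_le_Suc_of_subset_up[OF inf sp gr _ _ sp kernel_ups_D]) (use Suc in auto)
  then show ?case by simp
qed

text \<open>Once the kernel dimension is at most the degree, Macaulay's bound stops all further
  growth.\<close>

lemma dim_kernel_ups_curve:
  assumes "m \<le> n" "a m \<le> m"
  shows "pdim {v\<in>ups r m (D m) i. lshift r t v = 0} \<le> a m"
proof (induction i)
  case 0
  then show ?case by (simp add: N_def)
next
  case (Suc i)
  have sp: "psubspace {v\<in>ups r m (D m) i. lshift r t v = 0}" for i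
    by (rule subspace_kernel[OF lin_lshift subspace_ups[OF subspace_D[OF assms(1)]]])
  have gr: "{v\<in>ups r m (D m) i. lshift r t v = 0} \<subseteq> graded_part r (m + i)"
    using ups_subset[OF D_subset[OF assms(1)]] by blast
  have "pdim {v\<in>ups r m (D m) (Suc i). lshift r t v = 0} \<le> pdim {v\<in>ups r m (D m) i. lshift r t v = 0}"
    by (rule dim_le_of_subset_up[OF inf sp gr _ sp kernel_ups_D]) (use Suc assms(2) in auto)
  then show ?case using Suc by simp
qed

lemma dim_D_1_le: "1 \<le> n \<Longrightarrow> pdim (D 1) \<le> r"
  using mp.dim_mono_fin[OF fin_dim_graded_part D_subset[of 1]] dim_graded_part_1_le by (rule le_trans)

text \<open>If the kernels do not stabilise, the bound on \<open>M\<close> forces their dimensions, and \<open>M\<close> is cut out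
  by linear forms spanning a plane (or a line, for \<open>n = 1\<close>) and at most two further forms: one of degree
  \<open>\<delta> + 1\<close>, if \<open>\<delta> + 1 < n\<close>, and the others of degree \<open>n\<close>.\<close>

lemma dim_ups_pos: "0 < pdim (ups r n M k)"
proof (cases "\<exists>j<n. \<delta> \<le> j \<and> a j = \<delta>")
  case True
  then show ?thesis using dim_ups_pos_flat by blast
next
  case False
  have n: "1 \<le> n" using \<delta> by simp
  have bound': "(\<Sum>j\<le>n. a j) < (\<Sum>j\<le>n. min (\<delta> + 1) (j + 1))"
    using bound dim_D[of n] by (simp add: D_n)
  have a: "a j = min (\<delta> + 1) (j + 1)" if "j < n" for j
    by (rule kernel_dims_exact[OF macaulay_N a_n \<delta> _ bound' that]) (use False in auto)
  note sD = subspace_D D_subset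
  have "\<exists>c<r. cut_by r n M c"
  proof (cases "n = 1")
    case True
    \<comment> \<open>Here \<open>M = D 1\<close> has dimension \<open>1 + 1\<close>, so
      \<open>r - 2\<close> linear forms cut out a line.\<close>
    then have "\<delta> = 1" using \<delta> by simp
    then have d: "pdim (D 1) = 2" using dim_D[of 1] a[of 0] a_n True by simp
    then have "cut_by r 1 (D 1) (r - 2)" "2 \<le> r" using cut_by_D_1[OF n] dim_D_1_le[OF n] by auto
    then show ?thesis using True D_n by (intro exI[of _ "r - 2"]) simp
  next
    case False
    then have n2: "2 \<le> n" using n by simp
    \<comment> \<open>With \<open>\<delta> \<ge> 1\<close> and \<open>n \<ge> 2\<close> the minimum
      of \<open>\<delta> + 1\<close> and \<open>2\<close> is \<open>2\<close>; so \<open>D 1\<close>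
      has dimension 3 and spans a plane.\<close>
    then have a1: "a 1 = 2" using a[of 1] \<delta> by simp
    then have d: "pdim (D 1) = 3" using dim_D[of 1] dim_D_0 n by simp
    have r3: "3 \<le> r" using dim_D_1_le[OF n] d by simp
    have c1: "cut_by r 1 (D 1) (r - 3)" using cut_by_D_1[OF n dim_D_1_le[OF n]] d by simp
    \<comment> \<open>The right-hand side is the number of monomials of degree \<open>m\<close> in
      three variables.\<close>
    have plane: "pdim (ups r 1 (D 1) (m - 1)) \<le> (\<Sum>j\<le>m. j + 1)" if "1 \<le> m" for m
    proof -
      obtain l where l: "m = Suc l" using \<open>1 \<le> m\<close> by (cases m) auto
      have "pdim (ups r 1 (D 1) l) \<le> pdim (D 1) + (\<Sum>i<l. Suc i + 2)"
        by (rule dim_ups_le[OF sD(1)[OF n] sD(2)[OF n]]) (rule order_trans[OF dim_kernel_ups_plane[OF n a1]], simp)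
      also have "\<dots> = (\<Sum>j\<le>Suc l. j + 1)" by (induction l) (use d in auto)
      finally show ?thesis using l by simp
    qed
    have eq: "sum f {..n} = sum f {..<n} + f n" for f :: "nat \<Rightarrow> nat"
      by (simp flip: lessThan_Suc_atMost)
    show ?thesis
    proof (cases "\<delta> + 1 < n")
      case True
      \<comment> \<open>The first degree where \<open>min (\<delta> + 1) (j + 1)\<close> drops below
        \<open>j + 1\<close>. There \<open>D\<close> is one short of the bound \<open>plane\<close>,
        so at most one form of degree \<open>\<delta> + 1\<close> is needed: the equation of a plane
        curve.\<close>
      let ?m = "\<delta> + 1"
      have m: "1 \<le> ?m" "?m \<le> n" "1 + (?m - 1) = ?m" "?m + (n - ?m) = n" using True by auto
      have am: "a ?m = \<delta> + 1" using a[OF True] by simp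
      have "pdim (D ?m) = (\<Sum>j\<le>?m. min (\<delta> + 1) (j + 1))"
        unfolding dim_D[OF m(2)] by (rule sum.cong) (use True a in auto)
      then have "pdim (D ?m) = (\<Sum>j\<le>\<delta>. min (\<delta> + 1) (j + 1)) + (\<delta> + 1)" by simp
      also have "(\<Sum>j\<le>\<delta>. min (\<delta> + 1) (j + 1)) = (\<Sum>j\<le>\<delta>. j + 1)" by (rule sum.cong) auto
      finally have dm: "(\<Sum>j\<le>?m. j + 1) = pdim (D ?m) + 1" by simp
      have c2: "cut_by r (1 + (?m - 1)) (D ?m) ((r - 3) + 1)"
      proof (rule cut_by_step[OF c1 sD(1)[OF n] sD(2)[OF n] sD(1)[OF m(2)]])
        show "D ?m \<subseteq> ups r 1 (D 1) (?m - 1)" using D_subset_ups[of 1 "?m - 1"] m by simp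
        show "pdim (ups r 1 (D 1) (?m - 1)) \<le> pdim (D ?m) + 1" using plane[OF m(1)] dm by simp
      qed simp
      \<comment> \<open>Above degree \<open>?m\<close> the kernels have dimension at most
        \<open>\<delta> + 1\<close>. \<open>D\<close> attains this growth up to degree
        \<open>n - 1\<close> and misses it by one in degree \<open>n\<close>, where
        \<open>a n = \<delta>\<close>; this costs at most one form of degree
        \<open>n\<close>.\<close>
      have "pdim (ups r ?m (D ?m) (n - ?m)) \<le> pdim (D ?m) + (\<Sum>i<n - ?m. \<delta> + 1)"
        by (rule dim_ups_le[where t = t, OF sD(1)[OF m(2)] sD(2)[OF m(2)]])
          (use dim_kernel_ups_curve[OF m(2)] am in \<open>simp del: ups.simps(2)\<close>)
      moreover have "pdim M + 1 = pdim (D ?m) + (\<Sum>i<n - ?m. \<delta> + 1)"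
      proof -
        obtain l where l: "n = ?m + Suc l" using True less_iff_Suc_add by auto
        have "pdim (D (?m + i)) = pdim (D ?m) + i * (\<delta> + 1)" if "i \<le> l" for i
          using that
        proof (induction i)
          case (Suc i)
          have "pdim (D (Suc (?m + i))) = a (Suc (?m + i)) + pdim (D (?m + i))"
            by (rule dim_D_Suc) (use Suc.prems l in simp)
          moreover have "a (Suc (?m + i)) = \<delta> + 1" using a[of "Suc (?m + i)"] Suc.prems l by simp
          ultimately show ?case using Suc by simp
        qed simp
        then have "pdim (D (?m + l)) = pdim (D ?m) + l * (\<delta> + 1)" by simp
        moreover have "pdim (D (Suc (?m + l))) = a (Suc (?m + l)) + pdim (D (?m + l))"
          by (rule dim_D_Suc) (use l in simp)
        then have "pdim M = \<delta> + pdim (D (?m + l))"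
          using a_n D_n l[unfolded add_Suc_right, symmetric] by simp
        moreover have "n - ?m = Suc l" using l by simp
        ultimately show ?thesis by simp
      qed
      ultimately have up: "pdim (ups r ?m (D ?m) (n - ?m)) \<le> pdim M + 1" by simp
      have "cut_by r (?m + (n - ?m)) M ((r - 3 + 1) + 1)"
      proof (rule cut_by_step[OF _ sD(1)[OF m(2)] sD(2)[OF m(2)] M(1) _ up])
        show "cut_by r ?m (D ?m) (r - 3 + 1)" using c2 m(3) by simp
        show "M \<subseteq> ups r ?m (D ?m) (n - ?m)" using D_subset_ups[of ?m "n - ?m"] m D_n by simp
      qed simp
      then show ?thesis using r3 m by (intro exI[of _ "r - 3 + 1 + 1"]) simp
    next
      case False
      \<comment> \<open>Now \<open>\<delta>\<close> is \<open>n - 1\<close> or \<open>n\<close>. The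
        kernels are those of the plane up to degree \<open>n - 1\<close>, and \<open>M\<close> is at
        most \<open>n + 1 - \<delta> \<le> 2\<close> short of the bound
        \<open>plane\<close>.\<close>
      have "(\<Sum>j<n. a j) = (\<Sum>j<n. j + 1)" by (rule sum.cong) (use a False in auto)
      then have "pdim M = (\<Sum>j<n. j + 1) + \<delta>" using dim_D[of n] a_n eq[of a] by (simp add: D_n)
      then have "(\<Sum>j\<le>n. j + 1) \<le> pdim M + 2" using False unfolding eq by simp
      then have up: "pdim (ups r 1 (D 1) (n - 1)) \<le> pdim M + 2" using plane[OF n] by simp
      have "cut_by r (1 + (n - 1)) M ((r - 3) + 2)"
        by (rule cut_by_step[OF c1 sD(1)[OF n] sD(2)[OF n] M(1) _ up])
          (use D_subset_ups[of 1 "n - 1"] D_n n in auto)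
      then show ?thesis using r3 n by (intro exI[of _ "r - 3 + 2"]) simp
    qed
  qed
  then show ?thesis using dim_ups_pos_of_cut_by M by blast
qed

end

text \<open>\<open>growth\<close> says that the step to degree \<open>n + 1\<close> falls short of
  Macaulay's bound by at most one; rank and nullity of a generic form decide where this defect
  lies.\<close>

lemma dim_ups_pos:
  fixes M :: "('k::field) mpoly set"
  assumes inf: "infinite (UNIV :: 'k set)"
    and M: "psubspace M" "M \<subseteq> graded_part r n"
    and \<delta>: "1 \<le> \<delta>" "\<delta> \<le> n"
    and bound: "pdim M < (\<Sum>j\<le>n. min (\<delta> + 1) (j + 1))"
    and growth: "pdim M + \<delta> \<le> pdim (up r n M) + 1" and pos: "0 < pdim M"
  shows "0 < pdim (ups r n M k)"
proof -
  obtain t where t: "\<not> \<delta> + 1 \<le> pdim {v\<in>M. lshift r t v = 0}"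
    by (rule exists_good_point[OF inf finite_lshift_kernel_ge[OF M bound]])
  let ?N = "{v\<in>M. lshift r t v = 0}" and ?N' = "{v\<in>up r n M. lshift r t v = 0}"
  have fM: "mp.fin_dim M" "mp.fin_dim (up r n M)"
    using fin_dim_subset_graded M(2) up_subset by blast+
  have sM': "psubspace (up r n M)" by (rule subspace_up[OF M(1)])
  have sN: "psubspace ?N" "?N \<subseteq> graded_part r n" using subspace_kernel[OF lin_lshift M(1)] M(2) by auto
  have im: "lshift r t ` up r n M \<subseteq> M" using lshift_up[OF M(1)] by blast
  have rn: "pdim (up r n M) = pdim ?N' + pdim (lshift r t ` up r n M)"
    by (rule mp.rank_nullity(1)[OF lin_lshift sM' fM(2)])
  have le_im: "pdim (lshift r t ` up r n M) \<le> pdim M" by (rule mp.dim_mono_fin[OF fM(1) im])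
  show ?thesis
  proof (cases "pdim ?N = 0")
    case True
    then have "?N \<subseteq> {0}" using mp.dim_eq_0_fin[of ?N] fin_dim_subset_graded[OF sN(2)] by blast
    then have "pdim M \<le> pdim (ups r n M k)"
      by (intro dim_ups_ge[OF M, of t]) (use growth \<delta> in auto)
    then show ?thesis using pos by simp
  next
    case N0: False
    have N'up: "?N' \<subseteq> up r n ?N" by (rule kernel_up)
    show ?thesis
    proof (cases "pdim ?N \<le> pdim ?N'")
      case True
      have "pdim ?N' \<le> pdim (up r n ?N)" by (rule mp.dim_mono_fin[OF fin_dim_subset_graded[OF up_subset] N'up])
      then have "pdim ?N \<le> pdim (ups r n ?N k)"
        by (intro dim_ups_ge_of_le_degree[OF inf sN]) (use t \<delta> True in auto)
      also have "\<dots> \<le> pdim (ups r n M k)"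
        by (rule mp.dim_mono_fin[OF fin_dim_subset_graded[OF ups_subset[OF M(2)]] ups_mono]) blast
      finally show ?thesis using N0 by simp
    next
      case False
      \<comment> \<open>Since \<open>pdim ?N' < pdim ?N\<close>, \<open>growth\<close> gives an
        image of dimension at least \<open>pdim M + \<delta> - pdim ?N\<close>. The image lies in
        \<open>M\<close> and \<open>pdim ?N \<le> \<delta>\<close>, so both estimates are
        equalities.\<close>
      then have N: "pdim ?N = \<delta>" and im_ge: "pdim M \<le> pdim (lshift r t ` up r n M)"
        using rn le_im growth t by linarith+
      have "lshift r t ` up r n M = M"
        by (rule mp.subspace_eqI_dim[OF subspace_image[OF lin_lshift sM'] im fM(1) im_ge])
      then interpret almost_maximal_growth r n \<delta> t M
        using inf M \<delta> N bound by unfold_locales auto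
      show ?thesis by (rule dim_ups_pos)
    qed
  qed
qed

section \<open>Hilbert functions and binomial expansions\<close>

text \<open>A term \<open>i + 1\<close> over \<open>i\<close> contributes one to the growth and a
  term \<open>i\<close> over \<open>i\<close> nothing. The bound on \<open>k\<close> is the sum
  \<open>(i + 1) + i + ...\<close> of \<open>\<delta> + 1\<close> terms of the first kind, reached
  only if one more of them occurred.\<close>

lemma macaulay_growth_small:
  assumes "is_binom_expansion i k ks" "hd ks \<le> i + 1"
  shows "\<exists>\<delta>\<le>i. (\<Sum>l<length ks. Suc (ks ! l) choose Suc (i - l)) = k + \<delta> \<and>
    k < (\<Sum>j\<le>i. min (\<delta> + 1) (j + 1)) \<and> (hd ks = i \<longrightarrow> \<delta> = 0) \<and> (hd ks = i + 1 \<longrightarrow> 1 \<le> \<delta>)"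
  using assms
proof (induction ks arbitrary: i k)
  case Nil
  then show ?case by (simp add: is_binom_expansion_def)
next
  case (Cons a ks)
  have "1 \<le> i" using Cons.prems by (auto simp: is_binom_expansion_def)
  then obtain i' where i: "i = Suc i'" by (cases i) auto
  have a: "i \<le> a" "a \<le> i + 1" using is_binom_expansion_bounds[OF Cons.prems(1)] Cons.prems(2) by auto
  have one: "(\<Sum>j\<le>i. min (0 + 1) (j + 1)) = i + 1" by simp
  show ?case
  proof (cases "ks = []")
    case True
    then have k: "k = a choose i" using Cons.prems(1) by (simp add: is_binom_expansion_single)
    show ?thesis
    proof (cases "a = i")
      case True
      then show ?thesis using k \<open>ks = []\<close> i by (intro exI[of _ 0]) simp
    next
      case False
      then have ai: "a = i + 1" using a by simp
      have "(\<Sum>j\<le>i. min (1 + 1) (j + 1)) = 2 * i + 1" by (induction i) auto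
      moreover have "Suc i choose i = i + 1" "Suc (Suc i) choose Suc i = i + 2"
        by (simp_all only: binomial_Suc_n)
      ultimately show ?thesis using k ai \<open>ks = []\<close> \<open>1 \<le> i\<close>
        by (intro exI[of _ 1]) (simp del: binomial_Suc_Suc)
    qed
  next
    case False
    then obtain k' where k': "hd ks < a" "k = (a choose i) + k'" "is_binom_expansion i' k' ks"
      using Cons.prems(1) i by (auto simp: is_binom_expansion_Cons)
    have sum: "(\<Sum>l<length (a # ks). Suc ((a # ks) ! l) choose Suc (i - l)) =
      (Suc a choose Suc i) + (\<Sum>l<length ks. Suc (ks ! l) choose Suc (i' - l))"
      unfolding length_Cons by (subst sum.lessThan_Suc_shift) (simp add: i del: binomial_Suc_Suc)
    obtain \<delta> where \<delta>: "\<delta> \<le> i'" "(\<Sum>l<length ks. Suc (ks ! l) choose Suc (i' - l)) = k' + \<delta>"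
      "k' < (\<Sum>j\<le>i'. min (\<delta> + 1) (j + 1))" "hd ks = i' \<longrightarrow> \<delta> = 0"
      using Cons.IH[OF k'(3)] k'(1) a i by auto
    show ?thesis
    proof (cases "a = i")
      case True
      then have "\<delta> = 0" using \<delta>(4) k'(1) is_binom_expansion_bounds[OF k'(3)] i by simp
      then show ?thesis using \<delta> True k' i sum by (intro exI[of _ 0]) simp
    next
      case False
      then have ai: "a = Suc i" using a by simp
      \<comment> \<open>Splitting off \<open>j = 0\<close> and shifting turns the bound for
        \<open>\<delta> + 1\<close> into \<open>i + 1\<close>, the value of the leading term, plus
        the bound for \<open>\<delta>\<close> in degree \<open>i'\<close>.\<close>
      have "(\<Sum>j\<le>i. min (\<delta> + 1 + 1) (j + 1)) = 1 + (\<Sum>j\<le>i'. min (\<delta> + 1) (j + 1) + 1)"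
        unfolding i by (subst sum.atMost_Suc_shift) simp
      also have "\<dots> = i + 1 + (\<Sum>j\<le>i'. min (\<delta> + 1) (j + 1))" unfolding i by (subst sum.distrib) simp
      finally have "k < (\<Sum>j\<le>i. min (\<delta> + 1 + 1) (j + 1))"
        using \<delta>(3) k'(2) ai by (simp del: binomial_Suc_Suc add: binomial_Suc_n)
      moreover have "(Suc a choose Suc i) = (a choose i) + 1"
        unfolding ai by (simp only: binomial_Suc_n)
      ultimately show ?thesis using \<delta>(1,2) k'(2) ai i sum
        by (intro exI[of _ "\<delta> + 1"]) (simp del: binomial_Suc_Suc)
    qed
  qed
qed

text \<open>The head \<open>a\<close> is determined by
  \<open>a choose n \<le> h < Suc a choose n\<close>; for \<open>a = n + 1\<close> these limits are
  \<open>n + 1\<close> and, by symmetry, \<open>(n + 2) choose 2\<close>.\<close>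

lemma expansion_iff_bounds:
  assumes n: "1 \<le> n"
  shows "(\<exists>ks. is_binom_expansion n h ks \<and> hd ks = n + 1) \<longleftrightarrow> n + 1 \<le> h \<and> h < ((n + 2) choose 2)"
proof -
  have b1: "(n + 1 choose n) = n + 1" using binomial_Suc_n[of n] by simp
  have b2: "(n + 2 choose n) = (n + 2 choose 2)" using binomial_symmetric[of n "n + 2"] by simp
  show ?thesis
  proof
    assume "\<exists>ks. is_binom_expansion n h ks \<and> hd ks = n + 1"
    then obtain ks where ks: "is_binom_expansion n h ks" "hd ks = n + 1" by blast
    show "n + 1 \<le> h \<and> h < ((n + 2) choose 2)"
      using is_binom_expansion_bounds[OF ks(1)] ks(2) b1 b2 by (simp del: binomial_Suc_Suc)
  next
    assume h: "n + 1 \<le> h \<and> h < ((n + 2) choose 2)"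
    then have "1 \<le> h" by simp
    then obtain ks where ks: "is_binom_expansion n h ks" using is_binom_expansion_exists[OF n] by blast
    note B = is_binom_expansion_bounds[OF ks]
    have "hd ks \<noteq> n" using B h by auto
    moreover have "\<not> n + 2 \<le> hd ks" using B h b2 binomial_right_mono[of "n + 2" "hd ks" n] by linarith
    ultimately have "hd ks = n + 1" using B by simp
    then show "\<exists>ks. is_binom_expansion n h ks \<and> hd ks = n + 1" using ks by blast
  qed
qed

section \<open>The Hilbert function as a codimension in the graded part\<close>

lemma mpoly_ring_simps [simp]:
  "x \<otimes>\<^bsub>mpoly_ring r\<^esub> y = x * y" "x \<oplus>\<^bsub>mpoly_ring r\<^esub> y = x + y"
  "\<one>\<^bsub>mpoly_ring r\<^esub> = 1" "\<zero>\<^bsub>mpoly_ring r\<^esub> = 0"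
  by (simp_all add: mpoly_ring_def)

lemma const_in_carrier: "single 0 c \<in> carrier (mpoly_ring r)"
  by (auto simp: mpoly_ring_def)

lemma graded_part_in_carrier: "graded_part r t \<subseteq> carrier (mpoly_ring r)"
  by (auto simp: graded_part_def)

lemma ideal_smul:
  assumes "ideal J (mpoly_ring r)" "f \<in> J"
  shows "smul c f \<in> J"
  using ideal.I_l_closed[OF assms const_in_carrier[of c r]] by (simp add: smul_def)

lemma ideal_subspace:
  assumes "ideal J (mpoly_ring r)"
  shows "psubspace J"
proof -
  have J: "additive_subgroup J (mpoly_ring r)" by (rule ideal.axioms(1)[OF assms])
  show ?thesis unfolding mp.vs.subspace_def
    using additive_subgroup.zero_closed[OF J] additive_subgroup.a_closed[OF J] ideal_smul[OF assms] by auto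
qed

lemma coset_eq_iff:
  fixes J :: "('k::field) mpoly set"
  assumes "ideal J (mpoly_ring r)"
  shows "J +>\<^bsub>mpoly_ring r\<^esub> f = J +>\<^bsub>mpoly_ring r\<^esub> g \<longleftrightarrow> f - g \<in> J"
proof -
  note S = ideal_subspace[OF assms]
  have c: "J +>\<^bsub>mpoly_ring r\<^esub> f = {h + f | h. h \<in> J}" for f
    by (auto simp: a_r_coset_def')
  show ?thesis
  proof
    assume "J +>\<^bsub>mpoly_ring r\<^esub> f = J +>\<^bsub>mpoly_ring r\<^esub> g"
    moreover have "f \<in> J +>\<^bsub>mpoly_ring r\<^esub> f" unfolding c using mp.vs.subspace_0[OF S] by force
    ultimately obtain h where "f = h + g" "h \<in> J" unfolding c by auto
    then show "f - g \<in> J" by simp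
  next
    assume fg: "f - g \<in> J"
    have "h + f \<in> {h + g | h. h \<in> J}" if "h \<in> J" for h
      using mp.vs.subspace_add[OF S that fg] by (auto intro!: exI[of _ "h + (f - g)"])
    moreover have "h + g \<in> {h + f | h. h \<in> J}" if "h \<in> J" for h
      using mp.vs.subspace_diff[OF S that fg] by (auto intro!: exI[of _ "h - (f - g)"])
    ultimately show "J +>\<^bsub>mpoly_ring r\<^esub> f = J +>\<^bsub>mpoly_ring r\<^esub> g" unfolding c by blast
  qed
qed

text \<open>\<open>dim\<close> is computed over a subfield of the quotient ring;
  \<open>1 \<notin> J\<close> ensures that this ring is not zero.\<close>

lemma subfield_const_image:
  fixes J :: "('k::field) mpoly set"
  assumes J: "ideal J (mpoly_ring r)" "1 \<notin> J"
  shows "subfield ((\<lambda>f. J +>\<^bsub>mpoly_ring r\<^esub> f) ` const_polys) (mpoly_ring r Quot J)"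
proof -
  interpret R: cring "mpoly_ring r :: 'k mpoly ring" by (rule cring_mpoly_ring)
  interpret h: ring_hom_ring "mpoly_ring r" "mpoly_ring r Quot J" "(+>\<^bsub>mpoly_ring r\<^esub>) J"
    by (rule ideal.rcos_ring_hom_ring[OF J(1)])
  have sub: "subring const_polys (mpoly_ring r :: 'k mpoly ring)"
  proof (rule R.subringI)
    show "const_polys \<subseteq> carrier (mpoly_ring r :: 'k mpoly ring)"
      by (auto simp: const_polys_def const_in_carrier)
    show "\<one>\<^bsub>mpoly_ring r\<^esub> \<in> (const_polys :: 'k mpoly set)"
      by (auto simp: const_polys_def intro: range_eqI[of _ _ 1])
    fix h :: "'k mpoly" assume "h \<in> const_polys"
    then obtain c where c: "h = single 0 c" by (auto simp: const_polys_def)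
    have "\<ominus>\<^bsub>mpoly_ring r\<^esub> h = single 0 (- c)"
      by (rule R.minus_equality) (simp_all add: c const_in_carrier flip: single_add)
    then show "\<ominus>\<^bsub>mpoly_ring r\<^esub> h \<in> const_polys" by (auto simp: const_polys_def)
  next
    fix h1 h2 :: "'k mpoly" assume "h1 \<in> const_polys" "h2 \<in> const_polys"
    then show "h1 \<otimes>\<^bsub>mpoly_ring r\<^esub> h2 \<in> const_polys" "h1 \<oplus>\<^bsub>mpoly_ring r\<^esub> h2 \<in> const_polys"
      by (auto simp: const_polys_def mult_single simp flip: single_add)
  qed
  have "subfield const_polys (mpoly_ring r :: 'k mpoly ring)"
  proof (rule R.subfieldI[OF R.subcringI'[OF sub]])
    show "Units (mpoly_ring r \<lparr> carrier := const_polys \<rparr>) = (const_polys :: 'k mpoly set) - {\<zero>\<^bsub>mpoly_ring r\<^esub>}"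
    proof
      show "Units (mpoly_ring r \<lparr> carrier := const_polys \<rparr>) \<subseteq> (const_polys :: 'k mpoly set) - {\<zero>\<^bsub>mpoly_ring r\<^esub>}"
        by (auto simp: Units_def)
      show "(const_polys :: 'k mpoly set) - {\<zero>\<^bsub>mpoly_ring r\<^esub>} \<subseteq> Units (mpoly_ring r \<lparr> carrier := const_polys \<rparr>)"
      proof
        fix x :: "'k mpoly" assume "x \<in> const_polys - {\<zero>\<^bsub>mpoly_ring r\<^esub>}"
        then obtain c where c: "x = single 0 c" "x \<noteq> 0" by (auto simp: const_polys_def)
        then have "c \<noteq> 0" by auto
        then have "single 0 (inverse c) * x = 1" "x * single 0 (inverse c) = 1" by (simp_all add: c(1) mult_single)
        then show "x \<in> Units (mpoly_ring r \<lparr> carrier := const_polys \<rparr>)"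
          using c unfolding Units_def by (auto simp: const_polys_def intro!: bexI[of _ "single 0 (inverse c)"])
      qed
    qed
  qed
  moreover have "\<one>\<^bsub>mpoly_ring r Quot J\<^esub> \<noteq> \<zero>\<^bsub>mpoly_ring r Quot J\<^esub>"
  proof
    assume "\<one>\<^bsub>mpoly_ring r Quot J\<^esub> = \<zero>\<^bsub>mpoly_ring r Quot J\<^esub>"
    then have "J +>\<^bsub>mpoly_ring r\<^esub> 1 = J +>\<^bsub>mpoly_ring r\<^esub> 0"
      using h.hom_one h.hom_zero by simp
    then show False using coset_eq_iff[OF J(1)] J(2) by simp
  qed
  ultimately show ?thesis by (rule h.img_is_subfield(2))
qed

lemma (in ring) dimension_trivial:
  assumes "dimension n K E" "carrier R = {\<zero>}"
  shows "n = 0 \<and> E = {\<zero>}"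
  using assms by (induction rule: dimension.induct) auto

text \<open>The unit ideal is treated apart: in the zero ring the constants do not form a subfield,
  and \<open>dim\<close> is evaluated from its definition.\<close>

lemma hilbert_function_carrier:
  fixes J :: "('k::field) mpoly set"
  assumes J: "ideal J (mpoly_ring r)" "1 \<in> J"
  shows "hilbert_function r J t = 0"
proof -
  interpret I: ideal J "mpoly_ring r" by fact
  interpret h: ring_hom_ring "mpoly_ring r" "mpoly_ring r Quot J" "(+>\<^bsub>mpoly_ring r\<^esub>) J"
    by (rule I.rcos_ring_hom_ring)
  have "x \<in> J" if "x \<in> carrier (mpoly_ring r)" for x
    using I.I_r_closed[OF J(2) that] by simp
  then have const: "J +>\<^bsub>mpoly_ring r\<^esub> x = \<zero>\<^bsub>mpoly_ring r Quot J\<^esub>" if "x \<in> carrier (mpoly_ring r)" for x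
    using that coset_eq_iff[OF J(1), of x 0] h.hom_zero by simp
  have triv: "carrier (mpoly_ring r Quot J) = {\<zero>\<^bsub>mpoly_ring r Quot J\<^esub>}"
    using const h.S.zero_closed by (auto simp: FactRing_def A_RCOSETS_def')
  have ne: "graded_part r t \<noteq> ({} :: 'k mpoly set)" using mp.vs.subspace_0[OF subspace_graded_part] by blast
  have "(\<lambda>f. J +>\<^bsub>mpoly_ring r\<^esub> f) ` graded_part r t = (\<lambda>f. \<zero>\<^bsub>mpoly_ring r Quot J\<^esub>) ` (graded_part r t :: 'k mpoly set)"
    by (rule image_cong[OF refl const]) (rule subsetD[OF graded_part_in_carrier])
  then have im: "(\<lambda>f. J +>\<^bsub>mpoly_ring r\<^esub> f) ` graded_part r t = {\<zero>\<^bsub>mpoly_ring r Quot J\<^esub>}"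
    using ne by (simp only: image_constant_conv if_False)
  show ?thesis
    unfolding hilbert_function_def h.S.dim_def im
  proof (rule the_equality)
    show "n = 0" if "h.S.dimension n ((\<lambda>f. J +>\<^bsub>mpoly_ring r\<^esub> f) ` const_polys) {\<zero>\<^bsub>mpoly_ring r Quot J\<^esub>}" for n
      using h.S.dimension_trivial[OF that triv] by blast
  qed (rule h.S.dimension.zero_dim)
qed

text \<open>A basis \<open>B\<close> of the degree \<open>t\<close> part of \<open>J\<close> is
  extended to a basis \<open>E\<close> of that of the ring; the classes of \<open>E - B\<close> are
  a basis of the image in the quotient.\<close>

lemma hilbert_function_eq:
  fixes J :: "('k::field) mpoly set"
  assumes J: "ideal J (mpoly_ring r)"
  shows "hilbert_function r J t + pdim (J \<inter> graded_part r t) = pdim (graded_part r t :: 'k mpoly set)"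
proof (cases "1 \<in> J")
  case True
  interpret I: ideal J "mpoly_ring r" by fact
  have "x \<in> J" if "x \<in> carrier (mpoly_ring r)" for x
    using I.I_r_closed[OF True that] by simp
  then have "J \<inter> graded_part r t = graded_part r t" using graded_part_in_carrier by blast
  then show ?thesis using hilbert_function_carrier[OF J True] by simp
next
  case False
  interpret h: ring_hom_ring "mpoly_ring r" "mpoly_ring r Quot J" "(+>\<^bsub>mpoly_ring r\<^esub>) J"
    by (rule ideal.rcos_ring_hom_ring[OF J])
  let ?G = "graded_part r t :: 'k mpoly set"
  let ?Jt = "J \<inter> ?G"
  let ?h = "\<lambda>f. J +>\<^bsub>mpoly_ring r\<^esub> f"
  let ?K = "?h ` const_polys"
  note SJ = ideal_subspace[OF J]
  have SJt: "psubspace ?Jt" by (rule mp.vs.subspace_inter[OF SJ subspace_graded_part])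
  obtain B where B: "finite B" "B \<subseteq> ?Jt" "pindep B" "?Jt \<subseteq> pspan B" "card B = pdim ?Jt"
    by (rule mp.fin_dim_basis[OF fin_dim_subset_graded[of ?Jt r t]]) auto
  obtain E where E: "B \<subseteq> E" "E \<subseteq> ?G" "pindep E" "?G \<subseteq> pspan E"
    by (rule mp.vs.maximal_independent_subset_extend[OF _ B(3), of ?G]) (use B(2) in auto)
  have finE: "finite E" using mp.independent_card_le_fin_dim(1)[OF fin_dim_graded_part E(2,3)] .
  have cE: "card E = pdim ?G" by (rule mp.vs.basis_card_eq_dim[OF E(2,4,3)])
  obtain us where us: "set us = E - B" "distinct us" using finite_distinct_list[of "E - B"] finE by auto
  have pc: "pspan U \<subseteq> ?G" if "U \<subseteq> ?G" for U
    by (rule mp.vs.span_minimal[OF that subspace_graded_part])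
  \<comment> \<open>Translates spans over the image of the constants in the quotient ring into
    images of spans of polynomials.\<close>
  have span: "h.S.Span ?K (map ?h vs) = ?h ` pspan (set vs)" if "set vs \<subseteq> ?G" for vs
    using that
  proof (induction vs)
    case Nil
    show ?case using h.hom_zero by simp
  next
    case (Cons v vs)
    have vc: "v \<in> carrier (mpoly_ring r)" using Cons.prems graded_part_in_carrier by auto
    have eq: "(?h (single 0 c) \<otimes>\<^bsub>mpoly_ring r Quot J\<^esub> ?h v) \<oplus>\<^bsub>mpoly_ring r Quot J\<^esub> ?h w = ?h (smul c v + w)"
      if "w \<in> pspan (set vs)" for c w
    proof -
      have wc: "w \<in> carrier (mpoly_ring r)" using that pc[of "set vs"] Cons.prems graded_part_in_carrier by auto
      have "?h (single 0 c) \<otimes>\<^bsub>mpoly_ring r Quot J\<^esub> ?h v = ?h (smul c v)"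
        using h.hom_mult[OF const_in_carrier vc, of c] by (simp add: smul_def)
      moreover have "smul c v \<in> carrier (mpoly_ring r)"
        using h.R.m_closed[OF const_in_carrier vc, of c] by (simp add: smul_def)
      ultimately show ?thesis using h.hom_add[of "smul c v" w] wc by simp
    qed
    have "h.S.Span ?K (map ?h (v # vs)) = h.S.line_extension ?K (?h v) (?h ` pspan (set vs))"
      using Cons by simp
    also have "\<dots> = ?h ` pspan (set (v # vs))"
    proof
      show "h.S.line_extension ?K (?h v) (?h ` pspan (set vs)) \<subseteq> ?h ` pspan (set (v # vs))"
      proof
        fix x assume "x \<in> h.S.line_extension ?K (?h v) (?h ` pspan (set vs))"
        then obtain c w where cw: "w \<in> pspan (set vs)"
          "x = (?h (single 0 c) \<otimes>\<^bsub>mpoly_ring r Quot J\<^esub> ?h v) \<oplus>\<^bsub>mpoly_ring r Quot J\<^esub> ?h w"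
          unfolding h.S.line_extension_mem_iff const_polys_def by auto
        have "smul c v + w \<in> pspan (set (v # vs))"
          using mp.vs.span_mono[of "set vs" "set (v # vs)"] cw(1)
          by (intro mp.vs.span_add mp.vs.span_scale) (auto intro: mp.vs.span_base)
        then show "x \<in> ?h ` pspan (set (v # vs))" using cw(2) eq[OF cw(1)] by simp
      qed
      show "?h ` pspan (set (v # vs)) \<subseteq> h.S.line_extension ?K (?h v) (?h ` pspan (set vs))"
      proof
        fix x assume "x \<in> ?h ` pspan (set (v # vs))"
        then obtain y where y: "x = ?h y" "y \<in> pspan (insert v (set vs))" by auto
        then obtain c where c: "y - smul c v \<in> pspan (set vs)" unfolding mp.vs.span_insert by blast
        have "x = (?h (single 0 c) \<otimes>\<^bsub>mpoly_ring r Quot J\<^esub> ?h v) \<oplus>\<^bsub>mpoly_ring r Quot J\<^esub> ?h (y - smul c v)"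
          using eq[OF c] y(1) by simp
        then show "x \<in> h.S.line_extension ?K (?h v) (?h ` pspan (set vs))"
          unfolding h.S.line_extension_mem_iff const_polys_def using c by blast
      qed
    qed
    finally show ?case .
  qed
  have usG: "set us \<subseteq> ?G" using us(1) E(2) by auto
  have indep: "h.S.independent ?K (map ?h vs)" if "distinct vs" "set vs \<subseteq> E - B" for vs
    using that
  proof (induction vs)
    case (Cons v vs)
    have vsG: "set vs \<subseteq> ?G" "v \<in> ?G" using Cons.prems E(2) by auto
    have "?h v \<notin> h.S.Span ?K (map ?h vs)"
    proof
      assume "?h v \<in> h.S.Span ?K (map ?h vs)"
      then obtain w where w: "w \<in> pspan (set vs)" "?h v = ?h w" unfolding span[OF vsG(1)] by auto
      then have "v - w \<in> J" using coset_eq_iff[OF J] by blast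
      moreover have "v - w \<in> ?G"
        using w(1) pc[OF vsG(1)] vsG(2) by (intro mp.vs.subspace_diff[OF subspace_graded_part]) auto
      ultimately have "v - w \<in> pspan B" using B(4) by blast
      then have "w + (v - w) \<in> pspan (set vs \<union> B)"
        using w(1) mp.vs.span_mono[of "set vs" "set vs \<union> B"] mp.vs.span_mono[of B "set vs \<union> B"]
        by (intro mp.vs.span_add) auto
      then have "v \<in> pspan (set vs \<union> B)" by simp
      moreover have "set vs \<union> B \<subseteq> E - {v}" using Cons.prems E(1) by auto
      ultimately have "v \<in> pspan (E - {v})" using mp.vs.span_mono by blast
      moreover have "v \<in> E" using Cons.prems by simp
      ultimately show False using E(3) unfolding mp.vs.dependent_def by blast
    qed
    moreover have "?h v \<in> carrier (mpoly_ring r Quot J)"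
      using h.hom_closed vsG(2) graded_part_in_carrier by blast
    ultimately show ?case using Cons by (auto intro: h.S.independent.li_Cons)
  qed simp
  have "?h ` pspan (set us) = ?h ` ?G"
  proof
    show "?h ` pspan (set us) \<subseteq> ?h ` ?G" using pc[OF usG] by blast
    show "?h ` ?G \<subseteq> ?h ` pspan (set us)"
    proof
      fix x assume "x \<in> ?h ` ?G"
      then obtain y where y: "x = ?h y" "y \<in> ?G" by blast
      have "E = B \<union> set us" using us(1) E(1) by blast
      then have "y \<in> pspan (B \<union> set us)" using E(4) y(2) by blast
      then obtain b w where bw: "y = b + w" "b \<in> pspan B" "w \<in> pspan (set us)" unfolding mp.vs.span_Un by blast
      have "b \<in> J" using bw(2) mp.vs.span_minimal[OF _ SJ, of B] B(2) by blast
      then have "?h y = ?h w" using bw(1) coset_eq_iff[OF J] by simp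
      then show "x \<in> ?h ` pspan (set us)" using y(1) bw(3) by simp
    qed
  qed
  then have "h.S.Span ?K (map ?h us) = ?h ` ?G" using span[OF usG] by simp
  moreover have "h.S.independent ?K (map ?h us)" by (rule indep) (use us in auto)
  ultimately have "h.S.dimension (length (map ?h us)) ?K (?h ` ?G)"
    using h.S.dimension_independent by metis
  then have "h.S.dim ?K (?h ` ?G) = length us"
    using h.S.dimI[OF subfield_const_image[OF J False]] by (simp add: over_def)
  then have "hilbert_function r J t = card (E - B)"
    unfolding hilbert_function_def using us distinct_card by force
  moreover have "card (E - B) + card B = card E"
    using E(1) finE B(1) by (simp add: card_Diff_subset card_mono)
  ultimately show ?thesis using B(5) cE by simp
qed

section \<open>Homogeneous prime ideals\<close>

lemma lookup_hom_component: "lookup (hom_component d p) m = (lookup p m when mdeg m = d)"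
  by transfer simp

lemma hom_component_add: "hom_component d (p + q) = hom_component d p + hom_component d q"
  by (rule poly_mapping_eqI) (simp add: lookup_hom_component lookup_add when_def)

lemma hom_component_zero [simp]: "hom_component d 0 = 0"
  by (rule poly_mapping_eqI) (simp add: lookup_hom_component)

lemma hom_component_sum: "hom_component d (sum f A) = (\<Sum>a\<in>A. hom_component d (f a))"
  by (induction A rule: infinite_finite_induct) (simp_all add: hom_component_add)

lemma hom_component_in_graded_part:
  "p \<in> carrier (mpoly_ring r) \<Longrightarrow> hom_component d p \<in> graded_part r d"
  by (auto simp: graded_part_def mpoly_ring_def in_keys_iff lookup_hom_component when_def split: if_splits)

lemma hom_component_graded_part:
  assumes "p \<in> graded_part r e"
  shows "hom_component d p = (if d = e then p else 0)"
proof (rule poly_mapping_eqI)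
  fix m
  show "lookup (hom_component d p) m = lookup (if d = e then p else 0) m"
    using assms by (cases "lookup p m = 0") (auto simp: graded_part_def lookup_hom_component when_def in_keys_iff)
qed

lemma sum_hom_components:
  obtains N where "\<And>n. N \<le> n \<Longrightarrow> p = (\<Sum>d\<le>n. hom_component d p)"
proof -
  have fin: "finite (mdeg ` keys p)" by simp
  then obtain N where N: "\<And>m. m \<in> keys p \<Longrightarrow> mdeg m \<le> N"
    by (metis finite_nat_set_iff_bounded_le imageI)
  have "p = (\<Sum>d\<le>n. hom_component d p)" if n: "N \<le> n" for n
  proof (rule poly_mapping_eqI)
    fix m
    have "(\<Sum>d\<le>n. lookup p m when mdeg m = d) = lookup p m"
    proof (cases "m \<in> keys p")
      case True
      then have "mdeg m \<le> n" using N n le_trans by blast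
      then show ?thesis by (simp add: when_def)
    qed (simp add: in_keys_iff)
    then show "lookup p m = lookup (\<Sum>d\<le>n. hom_component d p) m"
      by (simp add: lookup_sum lookup_hom_component)
  qed
  then show ?thesis by (rule that)
qed

lemma ideal_iff:
  fixes Q :: "('k::field) mpoly set"
  shows "ideal Q (mpoly_ring r) \<longleftrightarrow> Q \<subseteq> carrier (mpoly_ring r) \<and> 0 \<in> Q \<and> (\<forall>p\<in>Q. \<forall>q\<in>Q. p + q \<in> Q) \<and>
    (\<forall>p\<in>Q. \<forall>x\<in>carrier (mpoly_ring r). x * p \<in> Q)"
    (is "_ \<longleftrightarrow> ?R")
proof
  assume Q: "ideal Q (mpoly_ring r)"
  have A: "additive_subgroup Q (mpoly_ring r)" by (rule ideal.axioms(1)[OF Q])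
  show ?R
    using additive_subgroup.a_subset[OF A] additive_subgroup.zero_closed[OF A] additive_subgroup.a_closed[OF A]
      ideal.I_l_closed[OF Q] by simp
next
  assume Q: ?R
  interpret R: cring "mpoly_ring r :: 'k mpoly ring" by (rule cring_mpoly_ring)
  have inv: "\<ominus>\<^bsub>mpoly_ring r\<^esub> p \<in> Q" if "p \<in> Q" for p
  proof -
    have "(- 1) * p = - p" "(- 1 :: 'k mpoly) \<in> carrier (mpoly_ring r)"
      by (simp_all add: mpoly_ring_def in_keys_iff lookup_one when_def)
    then have "- p \<in> Q" using Q that by metis
    moreover have "\<ominus>\<^bsub>mpoly_ring r\<^esub> p = - p"
      by (rule R.minus_equality) (use Q that \<open>- p \<in> Q\<close> in auto)
    ultimately show ?thesis by simp
  qed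
  show "ideal Q (mpoly_ring r)"
  proof (rule idealI)
    show "ring (mpoly_ring r :: 'k mpoly ring)" by (rule R.ring_axioms)
    show "subgroup Q (add_monoid (mpoly_ring r))"
      by (rule R.add.subgroupI) (use Q inv in \<open>auto simp: a_inv_def\<close>)
  qed (use Q in \<open>auto simp: mult.commute\<close>)
qed

lemma ideal_sum:
  assumes "ideal Q (mpoly_ring r)" "\<And>a. a \<in> A \<Longrightarrow> f a \<in> Q"
  shows "sum f A \<in> Q"
  using assms(2) by (induction A rule: infinite_finite_induct) (use assms(1) in \<open>auto simp: ideal_iff\<close>)

lemma homogeneous_ideal_subsetI:
  fixes P :: "('k::field) mpoly set"
  assumes P: "homogeneous_ideal r P" and Q: "ideal Q (mpoly_ring r)"
    and le: "\<And>d. P \<inter> graded_part r d \<subseteq> Q"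
  shows "P \<subseteq> Q"
proof
  fix f assume f: "f \<in> P"
  obtain N where "f = (\<Sum>d\<le>N. hom_component d f)" using sum_hom_components[of f] by blast
  moreover have "hom_component d f \<in> Q" for d
  proof -
    have "f \<in> carrier (mpoly_ring r)" using f P by (auto simp: homogeneous_ideal_def ideal_iff)
    then have "hom_component d f \<in> graded_part r d" by (rule hom_component_in_graded_part)
    then show ?thesis using le[of d] P f by (auto simp: homogeneous_ideal_def)
  qed
  ultimately show "f \<in> Q" using ideal_sum[OF Q, of "{..N}" "\<lambda>d. hom_component d f"] by simp
qed

lemma exists_least_component:
  fixes P :: "('k::field) mpoly set"
  assumes P: "ideal P (mpoly_ring r)" and f: "f \<notin> P"
  obtains i where "hom_component i f \<notin> P" "\<forall>k<i. hom_component k f \<in> P"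
proof -
  obtain N where N: "f = (\<Sum>d\<le>N. hom_component d f)" using sum_hom_components[of f] by blast
  have ex: "\<exists>i. hom_component i f \<notin> P"
  proof (rule ccontr)
    assume "\<nexists>i. hom_component i f \<notin> P"
    then have "(\<Sum>d\<le>N. hom_component d f) \<in> P" by (intro ideal_sum[OF P]) auto
    then show False using N f by simp
  qed
  define i where "i = (LEAST i. hom_component i f \<notin> P)"
  have "hom_component i f \<notin> P" unfolding i_def by (rule LeastI_ex[OF ex])
  moreover have "\<forall>k<i. hom_component k f \<in> P" unfolding i_def using not_less_Least by blast
  ultimately show ?thesis by (rule that)
qed

text \<open>If neither factor lies in \<open>P\<close>, take their lowest components outside
  \<open>P\<close>, of degrees \<open>i\<close> and \<open>j\<close>. Modulo \<open>P\<close> the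
  component of degree \<open>i + j\<close> of the product is the product of these two.\<close>

lemma primeideal_homogeneousI:
  fixes P :: "('k::field) mpoly set"
  assumes P: "homogeneous_ideal r P" "1 \<notin> P"
    and prime: "\<And>a b i j. a \<in> graded_part r i \<Longrightarrow> b \<in> graded_part r j \<Longrightarrow> a * b \<in> P \<Longrightarrow> a \<in> P \<or> b \<in> P"
  shows "primeideal P (mpoly_ring r)"
proof -
  have I: "ideal P (mpoly_ring r)" using P(1) by (simp add: homogeneous_ideal_def)
  note S = ideal_subspace[OF I]
  have "f \<in> P \<or> g \<in> P" if fg: "f \<in> carrier (mpoly_ring r)" "g \<in> carrier (mpoly_ring r)" "f * g \<in> P" for f g
  proof (rule ccontr)
    assume "\<not> (f \<in> P \<or> g \<in> P)"
    then have "f \<notin> P" "g \<notin> P" by auto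
    obtain i where i: "hom_component i f \<notin> P" "\<forall>k<i. hom_component k f \<in> P"
      by (rule exists_least_component[OF I \<open>f \<notin> P\<close>])
    obtain j where j: "hom_component j g \<notin> P" "\<forall>k<j. hom_component k g \<in> P"
      by (rule exists_least_component[OF I \<open>g \<notin> P\<close>])
    let ?f = "\<lambda>a. hom_component a f" and ?g = "\<lambda>b. hom_component b g"
    have fG: "?f a \<in> graded_part r a" and gG: "?g a \<in> graded_part r a" for a
      using fg by (auto intro: hom_component_in_graded_part)
    obtain N1 where N1: "\<And>n. N1 \<le> n \<Longrightarrow> f = (\<Sum>a\<le>n. ?f a)" using sum_hom_components[of f] by blast
    obtain N2 where N2: "\<And>n. N2 \<le> n \<Longrightarrow> g = (\<Sum>b\<le>n. ?g b)" using sum_hom_components[of g] by blast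
    \<comment> \<open>Large enough for both expansions and for the pair \<open>(i, j)\<close> to
      occur in the double sum.\<close>
    define N where "N = N1 + N2 + i + j"
    have "f * g = (\<Sum>a\<le>N. ?f a) * (\<Sum>b\<le>N. ?g b)"
      using N1[of N] N2[of N] by (simp add: N_def)
    also have "\<dots> = (\<Sum>(a, b)\<in>{..N} \<times> {..N}. ?f a * ?g b)"
      by (simp add: sum_product sum.cartesian_product)
    finally have "hom_component (i + j) (f * g) = (\<Sum>(a, b)\<in>{..N} \<times> {..N}. hom_component (i + j) (?f a * ?g b))"
      by (simp add: hom_component_sum split_def)
    also have "\<dots> = (\<Sum>(a, b)\<in>{..N} \<times> {..N}. if i + j = a + b then ?f a * ?g b else 0)"
      by (rule sum.cong) (auto simp: hom_component_graded_part[OF graded_part_mult[OF fG gG]])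
    also have "\<dots> = ?f i * ?g j + (\<Sum>(a, b)\<in>{..N} \<times> {..N} - {(i, j)}. if i + j = a + b then ?f a * ?g b else 0)"
      by (subst sum.remove[of _ "(i, j)"]) (auto simp: N_def)
    finally have eq: "?f i * ?g j = hom_component (i + j) (f * g)
      - (\<Sum>(a, b)\<in>{..N} \<times> {..N} - {(i, j)}. if i + j = a + b then ?f a * ?g b else 0)" by simp
    have "(\<Sum>(a, b)\<in>{..N} \<times> {..N} - {(i, j)}. if i + j = a + b then ?f a * ?g b else 0) \<in> P"
    proof (rule ideal_sum[OF I])
      fix x assume "x \<in> {..N} \<times> {..N} - {(i, j)}"
      then obtain a b where x: "x = (a, b)" and "(a, b) \<noteq> (i, j)" by (cases x) auto
      have "(if i + j = a + b then ?f a * ?g b else 0) \<in> P"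
      proof (cases "i + j = a + b")
        case True
        \<comment> \<open>Any other pair of the same total degree has a smaller entry, whose
          component lies in \<open>P\<close> by minimality.\<close>
        then have "a < i \<or> b < j" using \<open>(a, b) \<noteq> (i, j)\<close> by auto
        then show ?thesis
        proof
          assume "a < i"
          then have "?g b * ?f a \<in> P" using i(2) gG graded_part_in_carrier I unfolding ideal_iff by blast
          then show ?thesis using mp.vs.subspace_0[OF S] by (simp add: mult.commute)
        next
          assume "b < j"
          then have "?f a * ?g b \<in> P" using j(2) fG graded_part_in_carrier I unfolding ideal_iff by blast
          then show ?thesis using mp.vs.subspace_0[OF S] by simp
        qed
      qed (simp add: mp.vs.subspace_0[OF S])
      then show "(case x of (a, b) \<Rightarrow> if i + j = a + b then ?f a * ?g b else 0) \<in> P" unfolding x by simp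
    qed
    moreover have "hom_component (i + j) (f * g) \<in> P" using P(1) fg(3) by (simp add: homogeneous_ideal_def)
    ultimately have "?f i * ?g j \<in> P" unfolding eq by (intro mp.vs.subspace_diff[OF S])
    then show False using prime[OF fG gG] i(1) j(1) by blast
  qed
  moreover have "carrier (mpoly_ring r) \<noteq> P" using P(2) const_in_carrier[of 1 r] by (auto simp: single_one)
  ultimately show ?thesis by (intro primeideal.intro I cring_mpoly_ring primeideal_axioms.intro) auto
qed

lemma graded_family_mult:
  fixes V :: "nat \<Rightarrow> ('k::field) mpoly set"
  assumes V: "\<And>d. psubspace (V d)" "\<And>d i p. p \<in> V d \<Longrightarrow> i < r \<Longrightarrow> var i * p \<in> V (Suc d)"
    and x: "x \<in> graded_part r c" and p: "p \<in> V d"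
  shows "x * p \<in> V (c + d)"
  using x
proof (induction c arbitrary: x)
  case 0
  have "x = smul (lookup x 0) 1"
    using mpoly_eq_sum_mons[of "mons r 0" x] 0 by (simp add: graded_part_iff)
  then have "x * p = smul (lookup x 0) p" by (metis mult_1 smul_mult_left)
  then show ?case using mp.vs.subspace_scale[OF V(1) p] by simp
next
  case (Suc c)
  have "pspan {var i * y | i y. i < r \<and> y \<in> graded_part r c} \<subseteq> {x. x * p \<in> V (Suc c + d)}"
  proof (rule mp.vs.span_minimal)
    show "psubspace {x. x * p \<in> V (Suc c + d)}"
      using V(1)[of "Suc c + d"] by (simp add: mp.vs.subspace_def distrib_right smul_mult_left)
    show "{var i * y | i y. i < r \<and> y \<in> graded_part r c} \<subseteq> {x. x * p \<in> V (Suc c + d)}"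
      using Suc.IH V(2)[of _ "c + d"] by (auto simp: mult.assoc)
  qed
  then show ?case using graded_part_Suc_span Suc.prems by blast
qed

lemma homogeneous_ideal_of_graded_family:
  fixes V :: "nat \<Rightarrow> ('k::field) mpoly set"
  assumes V: "\<And>d. psubspace (V d)" "\<And>d i p. p \<in> V d \<Longrightarrow> i < r \<Longrightarrow> var i * p \<in> V (Suc d)"
    and VG: "\<And>d. V d \<subseteq> graded_part r d"
  defines "Q \<equiv> {p \<in> carrier (mpoly_ring r). \<forall>d. hom_component d p \<in> V d}"
  shows "homogeneous_ideal r Q" "Q \<inter> graded_part r d = V d"
proof -
  interpret R: cring "mpoly_ring r :: 'k mpoly ring" by (rule cring_mpoly_ring)
  have 0: "0 \<in> V d" for d by (rule mp.vs.subspace_0[OF V(1)])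
  have "x * p \<in> Q" if p: "p \<in> Q" and x: "x \<in> carrier (mpoly_ring r)" for x p
  proof -
    obtain N1 where N1: "x = (\<Sum>a\<le>N1. hom_component a x)" using sum_hom_components[of x] by blast
    obtain N2 where N2: "p = (\<Sum>b\<le>N2. hom_component b p)" using sum_hom_components[of p] by blast
    have "hom_component d (x * p) \<in> V d" for d
    proof -
      have "x * p = (\<Sum>a\<le>N1. \<Sum>b\<le>N2. hom_component a x * hom_component b p)"
        by (subst N1, subst N2) (rule sum_product)
      then have "hom_component d (x * p) = (\<Sum>a\<le>N1. \<Sum>b\<le>N2. hom_component d (hom_component a x * hom_component b p))"
        by (simp add: hom_component_sum)
      also have "\<dots> \<in> V d"
      proof (intro mp.vs.subspace_sum[OF V(1)])
        fix a b
        have pb: "hom_component b p \<in> V b" using p by (simp add: Q_def)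
        have ab: "hom_component a x * hom_component b p \<in> V (a + b)"
        proof (rule graded_family_mult[of V r "hom_component a x" a "hom_component b p" b])
          show "hom_component a x \<in> graded_part r a" by (rule hom_component_in_graded_part[OF x])
        qed (use V pb in auto)
        then have G: "hom_component a x * hom_component b p \<in> graded_part r (a + b)" using VG by blast
        show "hom_component d (hom_component a x * hom_component b p) \<in> V d"
          unfolding hom_component_graded_part[OF G] using ab 0 by simp
      qed
      finally show ?thesis .
    qed
    then show ?thesis using R.m_closed[OF x] p by (simp add: Q_def)
  qed
  moreover have "p + q \<in> Q" if "p \<in> Q" "q \<in> Q" for p q
    using that R.a_closed[of p q] V(1) by (simp add: Q_def hom_component_add mp.vs.subspace_add)
  moreover have "0 \<in> Q" using 0 R.zero_closed by (simp add: Q_def)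
  ultimately have I: "ideal Q (mpoly_ring r)" unfolding ideal_iff by (auto simp: Q_def)
  have mem: "hom_component d p \<in> Q" if "p \<in> Q" for d p
  proof -
    have G: "hom_component d p \<in> graded_part r d" using that by (simp add: Q_def hom_component_in_graded_part)
    then show ?thesis
      using that 0 graded_part_in_carrier[of r d] hom_component_graded_part[OF G] by (auto simp: Q_def)
  qed
  show "homogeneous_ideal r Q" using I mem by (simp add: homogeneous_ideal_def)
  show "Q \<inter> graded_part r d = V d"
  proof
    show "Q \<inter> graded_part r d \<subseteq> V d"
    proof
      fix p assume p: "p \<in> Q \<inter> graded_part r d"
      then have "hom_component d p = p" using hom_component_graded_part[of p r d d] by simp
      moreover have "hom_component d p \<in> V d" using p by (simp add: Q_def)
      ultimately show "p \<in> V d" by simp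
    qed
    show "V d \<subseteq> Q \<inter> graded_part r d"
    proof
      fix p assume p: "p \<in> V d"
      then have G: "p \<in> graded_part r d" using VG by blast
      then show "p \<in> Q \<inter> graded_part r d"
        using p 0 graded_part_in_carrier[of r d] hom_component_graded_part[OF G] by (auto simp: Q_def)
    qed
  qed
qed

lemma hom_component_mult:
  assumes x: "x \<in> carrier (mpoly_ring r)" and a: "a \<in> graded_part r i"
  shows "\<exists>y\<in>carrier (mpoly_ring r). hom_component d (x * a) = y * a"
proof -
  obtain N where N: "x = (\<Sum>c\<le>N. hom_component c x)" using sum_hom_components[of x] by blast
  have "x * a = (\<Sum>c\<le>N. hom_component c x * a)" by (subst N) (rule sum_distrib_right)
  then have "hom_component d (x * a) = (\<Sum>c\<le>N. hom_component d (hom_component c x * a))"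
    by (simp add: hom_component_sum)
  also have "\<dots> = (\<Sum>c\<le>N. (if d = c + i then hom_component c x else 0) * a)"
    by (rule sum.cong) (auto simp: hom_component_graded_part[OF graded_part_mult[OF hom_component_in_graded_part[OF x] a]])
  also have "\<dots> = (\<Sum>c\<le>N. if d = c + i then hom_component c x else 0) * a"
    by (rule sum_distrib_right[symmetric])
  finally have "hom_component d (x * a) = (\<Sum>c\<le>N. if d = c + i then hom_component c x else 0) * a" .
  moreover have "(\<Sum>c\<le>N. if d = c + i then hom_component c x else 0) \<in> carrier (mpoly_ring r)"
  proof -
    have "ideal (carrier (mpoly_ring r)) (mpoly_ring r :: 'a mpoly ring)"
      by (rule ring.oneideal[OF cring.axioms(1)[OF cring_mpoly_ring]])
    then show ?thesis
      by (rule ideal_sum) (use hom_component_in_graded_part[OF x] graded_part_in_carrier in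
        \<open>auto simp: mpoly_ring_def graded_part_def\<close>)
  qed
  ultimately show ?thesis by blast
qed

lemma homogeneous_ideal_adjoin:
  fixes P :: "('k::field) mpoly set"
  assumes P: "homogeneous_ideal r P" and a: "a \<in> graded_part r i"
  defines "Q \<equiv> {p + x * a | p x. p \<in> P \<and> x \<in> carrier (mpoly_ring r)}"
  shows "homogeneous_ideal r Q" "P \<subseteq> Q" "a \<in> Q"
proof -
  interpret R: cring "mpoly_ring r :: 'k mpoly ring" by (rule cring_mpoly_ring)
  have I: "P \<subseteq> carrier (mpoly_ring r)" "0 \<in> P" "\<And>p q. p \<in> P \<Longrightarrow> q \<in> P \<Longrightarrow> p + q \<in> P"
    "\<And>x p. p \<in> P \<Longrightarrow> x \<in> carrier (mpoly_ring r) \<Longrightarrow> x * p \<in> P"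
    using P unfolding homogeneous_ideal_def ideal_iff by auto
  have ac: "a \<in> carrier (mpoly_ring r)" using a graded_part_in_carrier by blast
  have 0: "(0 :: 'k mpoly) \<in> carrier (mpoly_ring r)" "(1 :: 'k mpoly) \<in> carrier (mpoly_ring r)"
    using R.zero_closed R.one_closed by simp_all
  have add: "x + y \<in> carrier (mpoly_ring r)" "x * y \<in> carrier (mpoly_ring r)"
    if "x \<in> carrier (mpoly_ring r)" "y \<in> carrier (mpoly_ring r)" for x y :: "'k mpoly"
    using R.a_closed[OF that] R.m_closed[OF that] by simp_all
  have "ideal Q (mpoly_ring r)" unfolding ideal_iff
  proof (intro conjI ballI)
    show "Q \<subseteq> carrier (mpoly_ring r)" using I(1) ac add by (auto simp: Q_def)
    have "0 + 0 * a \<in> Q" unfolding Q_def using I(2) 0(1) by blast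
    then show "0 \<in> Q" by simp
  next
    fix f g assume "f \<in> Q" "g \<in> Q"
    then obtain p x q y where "f = p + x * a" "g = q + y * a" "p \<in> P" "q \<in> P"
      "x \<in> carrier (mpoly_ring r)" "y \<in> carrier (mpoly_ring r)" unfolding Q_def by blast
    moreover from this have "f + g = (p + q) + (x + y) * a" by (simp add: algebra_simps)
    ultimately show "f + g \<in> Q" unfolding Q_def using I(3) add(1) by blast
  next
    fix f z :: "'k mpoly" assume "f \<in> Q" "z \<in> carrier (mpoly_ring r)"
    then obtain p x where "f = p + x * a" "p \<in> P" "x \<in> carrier (mpoly_ring r)" unfolding Q_def by blast
    moreover from this have "z * f = z * p + (z * x) * a" by (simp add: algebra_simps)
    ultimately show "z * f \<in> Q" unfolding Q_def using I(4) add(2) \<open>z \<in> carrier (mpoly_ring r)\<close> by blast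
  qed
  moreover have "hom_component d f \<in> Q" if "f \<in> Q" for f d
  proof -
    obtain p x where f: "f = p + x * a" "p \<in> P" "x \<in> carrier (mpoly_ring r)" using \<open>f \<in> Q\<close> unfolding Q_def by blast
    obtain y where y: "y \<in> carrier (mpoly_ring r)" "hom_component d (x * a) = y * a"
      using hom_component_mult[OF f(3) a] by blast
    have "hom_component d p \<in> P" using P f(2) by (simp add: homogeneous_ideal_def)
    moreover have "hom_component d f = hom_component d p + y * a" by (simp add: f(1) hom_component_add y(2))
    ultimately show ?thesis unfolding Q_def using y(1) by blast
  qed
  ultimately show "homogeneous_ideal r Q" by (simp add: homogeneous_ideal_def)
  show "P \<subseteq> Q"
  proof
    fix p assume "p \<in> P"
    then have "p + 0 * a \<in> Q" unfolding Q_def using 0 by blast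
    then show "p \<in> Q" by simp
  qed
  have "0 + 1 * a \<in> Q" unfolding Q_def using I(2) 0 by blast
  then show "a \<in> Q" by simp
qed

lemma monomial_split:
  assumes "m \<in> mons r (c + d)"
  obtains a b where "m = a + b" "a \<in> mons r c" "b \<in> mons r d"
  using assms
proof (induction c arbitrary: m thesis)
  case 0
  then show ?case by (intro "0.prems"(1)[of 0 m]) auto
next
  case (Suc c)
  obtain i m' where im: "i < r" "m' \<in> mons r (c + d)" "m = m' + single i 1"
    using mons_Suc_cases[of m r "c + d"] Suc.prems(2) by auto
  obtain a b where ab: "m' = a + b" "a \<in> mons r c" "b \<in> mons r d" using Suc.IH[OF _ im(2)] by blast
  have "m = (a + single i 1) + b" using im(3) ab(1) by (simp add: add_ac)
  moreover have "a + single i 1 \<in> mons r (Suc c)" using ab(2) im(1) by (simp only: mons_add_single_iff)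
  ultimately show ?case using Suc.prems(1) ab(3) by blast
qed

lemma graded_part_subsetI:
  fixes Q :: "('k::field) mpoly set"
  assumes Q: "psubspace Q" and m: "\<And>m. m \<in> mons r d \<Longrightarrow> single m 1 \<in> Q"
  shows "graded_part r d \<subseteq> Q"
proof
  fix p :: "'k mpoly" assume p: "p \<in> graded_part r d"
  have "p = (\<Sum>m\<in>mons r d. smul (lookup p m) (single m 1))"
    by (rule mpoly_eq_sum_mons[OF finite_mons]) (use p in \<open>simp add: graded_part_iff\<close>)
  also have "\<dots> \<in> Q" by (intro mp.vs.subspace_sum[OF Q] mp.vs.subspace_scale[OF Q] m)
  finally show "p \<in> Q" .
qed

text \<open>Zorn's lemma for homogeneous ideals over \<open>Q0\<close> that contain no full graded
  part from degree \<open>n\<close> on. A maximal one is prime: if adjoining \<open>a\<close>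
  captures degree \<open>t\<close> and adjoining \<open>b\<close> captures degree \<open>s\<close>,
  then \<open>a * b \<in> P\<close> would put all of degree \<open>t + s\<close> into
  \<open>P\<close>.\<close>

lemma exists_homogeneous_prime:
  fixes Q0 :: "('k::field) mpoly set"
  assumes n: "1 \<le> n" and Q0: "homogeneous_ideal r Q0" "\<And>t. n \<le> t \<Longrightarrow> \<not> graded_part r t \<subseteq> Q0"
  obtains P where "P \<in> Proj r" "Q0 \<subseteq> P"
proof -
  define \<Q> where "\<Q> = {Q :: 'k mpoly set. homogeneous_ideal r Q \<and> Q0 \<subseteq> Q \<and> (\<forall>t\<ge>n. \<not> graded_part r t \<subseteq> Q)}"
  have "\<exists>P\<in>\<Q>. \<forall>X\<in>\<Q>. P \<subseteq> X \<longrightarrow> X = P"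
  proof (rule subset_Zorn_nonempty)
    show "\<Q> \<noteq> {}" using Q0 by (auto simp: \<Q>_def)
    fix \<C> assume \<C>: "\<C> \<noteq> {}" "subset.chain \<Q> \<C>"
    have c: "homogeneous_ideal r C" "Q0 \<subseteq> C" "\<And>t. n \<le> t \<Longrightarrow> \<not> graded_part r t \<subseteq> C" if "C \<in> \<C>" for C
      using \<C>(2) that by (auto simp: subset.chain_def \<Q>_def)
    have ci: "ideal C (mpoly_ring r)" if "C \<in> \<C>" for C using c(1)[OF that] by (simp add: homogeneous_ideal_def)
    have "ideal (\<Union>\<C>) (mpoly_ring r)" unfolding ideal_iff
    proof (intro conjI ballI)
      show "\<Union>\<C> \<subseteq> carrier (mpoly_ring r)" using ci unfolding ideal_iff by blast
      show "0 \<in> \<Union>\<C>" using \<C>(1) ci unfolding ideal_iff by blast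
      show "x * p \<in> \<Union>\<C>" if "p \<in> \<Union>\<C>" "x \<in> carrier (mpoly_ring r)" for p x
        using ci that unfolding ideal_iff by blast
      fix p q assume "p \<in> \<Union>\<C>" "q \<in> \<Union>\<C>"
      then obtain C D where CD: "p \<in> C" "q \<in> D" "C \<in> \<C>" "D \<in> \<C>" by blast
      then have "C \<subseteq> D \<or> D \<subseteq> C" using \<C>(2) by (auto simp: subset.chain_def)
      then have "p + q \<in> C \<or> p + q \<in> D" using CD ci[OF CD(3)] ci[OF CD(4)] unfolding ideal_iff by blast
      then show "p + q \<in> \<Union>\<C>" using CD by blast
    qed
    moreover have "\<forall>f\<in>\<Union>\<C>. \<forall>d. hom_component d f \<in> \<Union>\<C>" using c(1) unfolding homogeneous_ideal_def by blast
    moreover have "Q0 \<subseteq> \<Union>\<C>" using c(2) \<C>(1) by blast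
    moreover have "\<not> graded_part r t \<subseteq> \<Union>\<C>" if t: "n \<le> t" for t
    proof
      assume G: "graded_part r t \<subseteq> \<Union>\<C>"
      \<comment> \<open>The finitely many monomials spanning degree \<open>t\<close> already lie in
        one member of the chain.\<close>
      let ?B = "(\<lambda>m. single m (1 :: 'k)) ` mons r t"
      have "?B \<subseteq> \<Union>\<C>" using G single_in_graded_part by blast
      then obtain C where C: "C \<in> \<C>" "?B \<subseteq> C"
        using finite_subset_Union_chain[of ?B \<C> \<Q>] finite_mons \<C> by blast
      have "graded_part r t \<subseteq> C" by (rule graded_part_subsetI[OF ideal_subspace[OF ci[OF C(1)]]]) (use C(2) in blast)
      then show False using c(3)[OF C(1) t] by blast
    qed
    ultimately show "\<Union>\<C> \<in> \<Q>" by (simp add: \<Q>_def homogeneous_ideal_def)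
  qed
  then obtain P where P: "P \<in> \<Q>" and max: "\<And>X. X \<in> \<Q> \<Longrightarrow> P \<subseteq> X \<Longrightarrow> X = P" by blast
  have hP: "homogeneous_ideal r P" "Q0 \<subseteq> P" "\<And>t. n \<le> t \<Longrightarrow> \<not> graded_part r t \<subseteq> P" using P by (auto simp: \<Q>_def)
  have iP: "ideal P (mpoly_ring r)" using hP(1) by (simp add: homogeneous_ideal_def)
  note SP = ideal_subspace[OF iP]
  have mP: "x * p \<in> P" if "p \<in> P" "x \<in> carrier (mpoly_ring r)" for x p
    using iP that unfolding ideal_iff by blast
  have "1 \<notin> P"
  proof
    assume "1 \<in> P"
    then have "carrier (mpoly_ring r) \<subseteq> P" using mP[of 1] by auto
    then show False using hP(3)[OF order_refl] graded_part_in_carrier by blast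
  qed
  moreover have "a \<in> P \<or> b \<in> P"
    if a: "a \<in> graded_part r i" and b: "b \<in> graded_part r j" and ab: "a * b \<in> P" for a b i j
  proof (rule ccontr)
    assume n: "\<not> (a \<in> P \<or> b \<in> P)"
    have ex: "\<exists>t\<ge>n. graded_part r t \<subseteq> {p + x * a | p x. p \<in> P \<and> x \<in> carrier (mpoly_ring r)}"
      if a: "a \<in> graded_part r i" "a \<notin> P" for a i
    proof (rule ccontr)
      let ?Q = "{p + x * a | p x. p \<in> P \<and> x \<in> carrier (mpoly_ring r)}"
      assume "\<not> (\<exists>t\<ge>n. graded_part r t \<subseteq> ?Q)"
      then have "?Q \<in> \<Q>" using homogeneous_ideal_adjoin[OF hP(1) a(1)] hP(2) by (auto simp: \<Q>_def)
      then have "?Q = P" using max homogeneous_ideal_adjoin(2)[OF hP(1) a(1)] by blast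
      then show False using homogeneous_ideal_adjoin(3)[OF hP(1) a(1)] a(2) by blast
    qed
    obtain t where t: "n \<le> t" "graded_part r t \<subseteq> {p + x * a | p x. p \<in> P \<and> x \<in> carrier (mpoly_ring r)}"
      using ex[OF a] n by blast
    obtain s where s: "n \<le> s" "graded_part r s \<subseteq> {p + x * b | p x. p \<in> P \<and> x \<in> carrier (mpoly_ring r)}"
      using ex[OF b] n by blast
    have "graded_part r (t + s) \<subseteq> P"
    proof (rule graded_part_subsetI[OF SP])
      fix m assume "m \<in> mons r (t + s)"
      then obtain u v where m: "m = u + v" "u \<in> mons r t" "v \<in> mons r s" by (rule monomial_split)
      then obtain p x q y where px: "single u 1 = p + x * a" "p \<in> P" "x \<in> carrier (mpoly_ring r)"
        and qy: "single v 1 = q + y * b" "q \<in> P" "y \<in> carrier (mpoly_ring r)"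
        using t(2) s(2) single_in_graded_part[OF m(2), of 1] single_in_graded_part[OF m(3), of 1] by blast
      \<comment> \<open>Expanding the product of the two decompositions leaves three terms, each
        with a factor \<open>p\<close>, \<open>q\<close> or \<open>a * b\<close> in
        \<open>P\<close>.\<close>
      have "single m (1 :: 'k) = single v 1 * p + x * a * q + (x * y) * (a * b)"
        using px(1) qy(1) m(1) mult_single[of u "1 :: 'k" v 1] by (simp add: algebra_simps)
      moreover have "single v 1 * p \<in> P"
        using mP[OF px(2)] single_in_graded_part[OF m(3)] graded_part_in_carrier by blast
      moreover have "x * a * q \<in> P"
        using mP[OF mP[OF qy(2)] px(3)] a graded_part_in_carrier by (auto simp: mult.assoc)
      moreover have "(x * y) * (a * b) \<in> P" using mP[OF mP[OF ab qy(3)] px(3)] by (simp add: mult.assoc)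
      ultimately show "single m 1 \<in> P" by (simp add: mp.vs.subspace_add[OF SP])
    qed
    then show False using hP(3) t(1) by simp
  qed
  ultimately have "primeideal P (mpoly_ring r)" by (rule primeideal_homogeneousI[OF hP(1)])
  moreover have "\<not> (\<Union>d\<in>{1..}. graded_part r d) \<subseteq> P" using hP(3)[OF order_refl] n by auto
  ultimately have "P \<in> Proj r" using hP(1) by (simp add: Proj_def)
  then show ?thesis using hP(2) that by blast
qed

section \<open>The base locus\<close>

lemma graded_ideal_var_mult:
  assumes "ideal J (mpoly_ring r)" "p \<in> J \<inter> graded_part r e" "i < r"
  shows "var i * p \<in> J \<inter> graded_part r (Suc e)"
proof
  have "var i \<in> carrier (mpoly_ring r)" using var_in_graded_part[OF assms(3)] graded_part_in_carrier by blast
  then show "var i * p \<in> J" using assms(1,2) unfolding ideal_iff by blast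
  show "var i * p \<in> graded_part r (Suc e)"
    using graded_part_mult[OF var_in_graded_part[OF assms(3)], of p e] assms(2) by simp
qed

lemma subspace_graded_ideal: "ideal J (mpoly_ring r) \<Longrightarrow> psubspace (J \<inter> graded_part r t)"
  by (intro mp.vs.subspace_inter ideal_subspace subspace_graded_part)

lemma base_locus_eq:
  fixes J :: "('k::field) mpoly set"
  shows "base_locus r J n = {P \<in> Proj r. J \<inter> graded_part r n \<subseteq> P}"
proof -
  interpret R: cring "mpoly_ring r :: 'k mpoly ring" by (rule cring_mpoly_ring)
  let ?S = "J \<inter> graded_part r n"
  have S: "?S \<subseteq> carrier (mpoly_ring r)" using graded_part_in_carrier by blast
  have "genideal (mpoly_ring r) ?S \<subseteq> P \<longleftrightarrow> ?S \<subseteq> P" if "P \<in> Proj r" for P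
  proof
    show "?S \<subseteq> P" if "genideal (mpoly_ring r) ?S \<subseteq> P" using R.genideal_self[OF S] that by blast
    have "ideal P (mpoly_ring r)" using \<open>P \<in> Proj r\<close> by (simp add: Proj_def primeideal.axioms(1))
    then show "genideal (mpoly_ring r) ?S \<subseteq> P" if "?S \<subseteq> P" by (rule R.genideal_minimal[OF _ that])
  qed
  then show ?thesis unfolding base_locus_def V_plus_def by blast
qed

text \<open>The orthogonals \<open>V\<close> of the extensions, with zero below degree
  \<open>n\<close>, form a homogeneous ideal that contains the degree \<open>n\<close> part of
  \<open>J\<close>. By \<open>pos\<close> it contains no full graded part from degree
  \<open>n\<close> on, so a point of \<open>Proj r\<close> lies above it.\<close>

lemma base_locus_nonempty:
  fixes J :: "('k::field) mpoly set"
  assumes n: "1 \<le> n" and J: "ideal J (mpoly_ring r)"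
    and pos: "\<And>k. 0 < pdim (ups r n (perp r n (J \<inter> graded_part r n)) k)"
  shows "base_locus r J n \<noteq> {}"
proof -
  let ?M = "perp r n (J \<inter> graded_part r n)"
  define V where "V d = (if d < n then {0} else perp r d (ups r n ?M (d - n)))" for d
  have Vs: "psubspace (V d)" for d unfolding V_def using subspace_perp by (auto simp: mp.vs.subspace_def)
  have V0: "0 \<in> V d" for d by (rule mp.vs.subspace_0[OF Vs])
  have Vm: "var i * p \<in> V (Suc d)" if p: "p \<in> V d" "i < r" for d i p
  proof (cases "d < n")
    case True
    then show ?thesis using p V0[of "Suc d"] by (simp add: V_def[of d])
  next
    case False
    then have d: "Suc d - n = Suc (d - n)" "n + (d - n) = d" by auto
    have pp: "p \<in> perp r d (ups r n ?M (d - n))" using p(1) False by (simp add: V_def)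
    have "var i * p \<in> graded_part r (1 + d)"
      by (rule graded_part_mult[OF var_in_graded_part[OF p(2)]]) (use pp in \<open>simp add: perp_def\<close>)
    moreover have "pair q (var i * p) = 0" if q: "q \<in> ups r n ?M (Suc d - n)" for q
    proof -
      have "shift i q \<in> ups r n ?M (d - n)" using q p(2) by (simp add: d up_def)
      then have "pair (shift i q) p = 0" using pp by (simp add: perp_def)
      then show ?thesis unfolding pair_commute[of q] pair_shift pair_commute[of p] .
    qed
    ultimately show ?thesis using False by (simp add: V_def perp_def)
  qed
  have VG: "V d \<subseteq> graded_part r d" for d
    unfolding V_def using perp_subset mp.vs.subspace_0[OF subspace_graded_part] by auto
  let ?Q = "{p \<in> carrier (mpoly_ring r). \<forall>d. hom_component d p \<in> V d}"
  have Q: "homogeneous_ideal r ?Q" "\<And>d. ?Q \<inter> graded_part r d = V d"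
    using homogeneous_ideal_of_graded_family[OF Vs Vm VG] by blast+
  have "\<not> graded_part r t \<subseteq> ?Q" if t: "n \<le> t" for t
  proof
    assume "graded_part r t \<subseteq> ?Q"
    then have "graded_part r t \<subseteq> V t" using Q(2)[of t] by blast
    then have G: "graded_part r t \<subseteq> perp r t (ups r n ?M (t - n))" using t by (simp add: V_def)
    have U: "ups r n ?M (t - n) \<subseteq> graded_part r t"
      using ups_subset[OF perp_subset[of r n "J \<inter> graded_part r n"], of "t - n"] t by simp
    have "ups r n ?M (t - n) \<subseteq> perp r t (graded_part r t)"
    proof
      fix q assume q: "q \<in> ups r n ?M (t - n)"
      have "pair p q = 0" if "p \<in> graded_part r t" for p
      proof -
        have "p \<in> perp r t (ups r n ?M (t - n))" using G that by blast
        then have "pair q p = 0" using q by (simp add: perp_def)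
        then show ?thesis unfolding pair_commute[of p] .
      qed
      then show "q \<in> perp r t (graded_part r t)" using U q by (auto simp: perp_def)
    qed
    then have "pdim (ups r n ?M (t - n)) \<le> pdim {0 :: 'k mpoly}"
      unfolding perp_graded_part by (rule mp.dim_mono_fin[rotated]) (auto simp: mp.fin_dim_def)
    then show False using pos[of "t - n"] by (simp add: mp.dim_zero_space)
  qed
  then obtain P where P: "P \<in> Proj r" "?Q \<subseteq> P" by (rule exists_homogeneous_prime[OF n Q(1)])
  have "J \<inter> graded_part r n \<subseteq> V n"
    using perp_perp[OF subspace_graded_ideal[OF J, of n] Int_lower2] by (simp add: V_def)
  then have "J \<inter> graded_part r n \<subseteq> P" using Q(2)[of n] P(2) by blast
  then show ?thesis using P(1) by (auto simp: base_locus_eq)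
qed

section \<open>Hilbert functions of homogeneous primes\<close>

definition hilb :: "nat \<Rightarrow> ('k::field) mpoly set \<Rightarrow> nat \<Rightarrow> nat" where
  "hilb r P t = pdim (graded_part r t :: 'k mpoly set) - pdim (P \<inter> graded_part r t)"

lemma hilb_eq_dim_perp:
  assumes "ideal P (mpoly_ring r)"
  shows "hilb r P t = pdim (perp r t (P \<inter> graded_part r t))"
  using dim_perp[OF subspace_graded_ideal[OF assms, of t] Int_lower2] by (simp add: hilb_def)

text \<open>Otherwise the \<open>t\<close>-th power of every variable lies in \<open>P\<close>,
  hence every variable, hence all forms of positive degree.\<close>

lemma Proj_graded_part:
  fixes P :: "('k::field) mpoly set"
  assumes P: "P \<in> Proj r"
  shows "\<not> graded_part r t \<subseteq> P"
proof
  assume G: "graded_part r t \<subseteq> P"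
  interpret primeideal P "mpoly_ring r" using P by (simp add: Proj_def)
  have one: "1 \<notin> P" using one_imp_carrier I_notcarr by auto
  have v: "var i \<in> P" if i: "i < r" for i
  proof -
    have "var i ^ k \<in> graded_part r k" for k
    proof (induction k)
      case (Suc k)
      then show ?case using graded_part_mult[OF var_in_graded_part[OF i] Suc] by simp
    qed (simp add: one_in_graded_part)
    then have "var i ^ t \<in> P" using G by blast
    then show ?thesis
    proof (induction t)
      case (Suc t)
      have "var i \<in> carrier (mpoly_ring r)" "var i ^ t \<in> carrier (mpoly_ring r)"
        using var_in_graded_part[OF i] \<open>\<And>k. var i ^ k \<in> graded_part r k\<close> graded_part_in_carrier by blast+
      then have "var i \<in> P \<or> var i ^ t \<in> P" using I_prime[of "var i" "var i ^ t"] Suc.prems by simp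
      then show ?case using Suc.IH by blast
    qed (use one in simp)
  qed
  have "graded_part r d \<subseteq> P" if d: "1 \<le> d" for d
  proof -
    obtain e where e: "d = Suc e" using d by (cases d) auto
    have "p * var i \<in> P" if "p \<in> graded_part r e" "i < r" for p i
      using I_l_closed[OF v[OF that(2)]] that(1) graded_part_in_carrier by auto
    then have "graded_part r (Suc e) \<subseteq> P"
      by (intro graded_part_Suc_subset[OF _ ideal_subspace[OF is_ideal] order_refl]) (simp add: mult.commute)
    then show ?thesis using e by simp
  qed
  then show False using P by (auto simp: Proj_def)
qed

lemma hilb_pos:
  fixes P :: "('k::field) mpoly set"
  assumes "P \<in> Proj r"
  shows "0 < hilb r P t"
proof (rule ccontr)
  assume h: "\<not> 0 < hilb r P t"
  have "ideal P (mpoly_ring r)" using assms by (simp add: Proj_def primeideal.axioms(1))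
  then have "P \<inter> graded_part r t = graded_part r t"
    by (intro mp.subspace_eqI_dim subspace_graded_ideal fin_dim_graded_part) (use h in \<open>auto simp: hilb_def\<close>)
  then show False using Proj_graded_part[OF assms] by blast
qed

text \<open>A form \<open>f\<close> of degree \<open>d\<close> in \<open>Q\<close> but not in
  \<open>P\<close> acts injectively modulo the prime \<open>P\<close>, and its multiples lie in
  \<open>Q\<close>; so the quotient of \<open>Q\<close> by \<open>P\<close> in degree
  \<open>t + d\<close> has dimension at least \<open>hilb r P t\<close>.\<close>

lemma hilb_prime_chain:
  fixes P Q :: "('k::field) mpoly set"
  assumes P: "primeideal P (mpoly_ring r)" "homogeneous_ideal r P" and Q: "primeideal Q (mpoly_ring r)" "homogeneous_ideal r Q"
    and PQ: "P \<subset> Q"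
  obtains d where "1 \<le> d" "\<forall>t. hilb r P t + hilb r Q (t + d) \<le> hilb r P (t + d)"
proof -
  interpret P: primeideal P "mpoly_ring r" by fact
  interpret Q: primeideal Q "mpoly_ring r" by fact
  have "\<exists>d. \<not> Q \<inter> graded_part r d \<subseteq> P"
    using homogeneous_ideal_subsetI[OF Q(2) P.is_ideal] PQ by blast
  then obtain d f where f: "f \<in> Q" "f \<in> graded_part r d" "f \<notin> P" by blast
  have fc: "f \<in> carrier (mpoly_ring r)" using f(2) graded_part_in_carrier by blast
  \<comment> \<open>A form of degree 0 outside \<open>P\<close> is a unit and cannot lie in the
    proper ideal \<open>Q\<close>.\<close>
  have "d \<noteq> 0"
  proof
    assume "d = 0"
    then have "f = smul (lookup f 0) 1"
      using mpoly_eq_sum_mons[of "mons r 0" f] f(2) by (simp add: graded_part_iff)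
    moreover have "f \<noteq> 0" using f(3) mp.vs.subspace_0[OF ideal_subspace[OF P.is_ideal]] by blast
    ultimately have eq: "lookup f 0 \<noteq> 0" "f = smul (lookup f 0) 1" by auto
    have "smul (inverse (lookup f 0)) f \<in> Q" by (rule ideal_smul[OF Q.is_ideal f(1)])
    also have "smul (inverse (lookup f 0)) f = 1" by (subst eq(2)) (simp add: eq(1))
    finally show False using Q.one_imp_carrier Q.I_notcarr by simp
  qed
  moreover have "hilb r P t + hilb r Q (t + d) \<le> hilb r P (t + d)" for t
  proof -
    let ?G = "\<lambda>t. graded_part r t :: 'k mpoly set"
    have "(*) f ` ?G t \<subseteq> Q \<inter> ?G (t + d)"
    proof
      fix y assume "y \<in> (*) f ` ?G t"
      then obtain x where x: "y = f * x" "x \<in> ?G t" by blast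
      then have "y \<in> ?G (t + d)" using graded_part_mult[OF f(2) x(2)] by (simp add: add.commute)
      moreover have "y \<in> Q" using Q.I_r_closed[OF f(1), of x] x graded_part_in_carrier by auto
      ultimately show "y \<in> Q \<inter> ?G (t + d)" by blast
    qed
    then have "pdim (P \<inter> ?G (t + d)) + pdim (?G t) \<le> pdim (Q \<inter> ?G (t + d)) + pdim {s\<in>?G t. f * s \<in> P \<inter> ?G (t + d)}"
      by (intro mp.dim_preimage_le lin_mult subspace_graded_part fin_dim_graded_part subspace_graded_ideal
          P.is_ideal Q.is_ideal fin_dim_subset_graded[of _ r "t + d"]) (use PQ in auto)
    moreover have "{s\<in>?G t. f * s \<in> P \<inter> ?G (t + d)} \<subseteq> P \<inter> ?G t"
      using P.I_prime[OF fc] f(3) graded_part_in_carrier by auto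
    then have "pdim {s\<in>?G t. f * s \<in> P \<inter> ?G (t + d)} \<le> pdim (P \<inter> ?G t)"
      by (rule mp.dim_mono_fin[rotated]) (rule fin_dim_subset_graded[of _ r t], blast)
    moreover have "pdim (I \<inter> ?G t) \<le> pdim (?G t)" for I t
      by (rule mp.dim_mono_fin[OF fin_dim_graded_part]) blast
    note this[of P t] this[of P "t + d"] this[of Q "t + d"]
    ultimately show ?thesis unfolding hilb_def by linarith
  qed
  ultimately show ?thesis using that[of d] by simp
qed

text \<open>Positivity of \<open>h0\<close> makes \<open>h1\<close> gain at least one every
  \<open>d\<close> degrees, and the gains of \<open>h2\<close> every \<open>e\<close> degrees are at
  least values of \<open>h1\<close>, hence eventually exceed any given slope.\<close>

lemma quadratic_growth:
  fixes h0 h1 h2 :: "nat \<Rightarrow> nat"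
  assumes h0: "\<And>t. 0 < h0 t"
    and d: "1 \<le> d" "\<And>t. h1 t + h0 (t + d) \<le> h1 (t + d)"
    and e: "\<And>t. h2 t + h1 (t + e) \<le> h2 (t + e)"
  shows "\<exists>t\<ge>n. a + b * t < h2 t"
proof -
  have h1: "q \<le> h1 (q * d + s)" for q s
  proof (induction q)
    case (Suc q)
    have "h1 (q * d + s) + 1 \<le> h1 (q * d + s + d)" using d(2)[of "q * d + s"] h0[of "q * d + s + d"] by linarith
    then show ?case using Suc by (simp add: add_ac)
  qed simp
  \<comment> \<open>Over \<open>e\<close> degrees the linear function gains \<open>b * e\<close>;
    beyond \<open>t0\<close> the gain of \<open>h2\<close> is at least one more.\<close>
  define K where "K = b * e + 1"
  define t0 where "t0 = K * d + n"
  have h2: "q * K \<le> h2 (t0 + q * e)" for q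
  proof (induction q)
    case (Suc q)
    have "K \<le> h1 (t0 + q * e + e)" using h1[of K "n + q * e + e"] by (simp add: t0_def add_ac)
    then have "q * K + K \<le> h2 (t0 + q * e + e)" using e[of "t0 + q * e"] Suc by linarith
    then show ?case by (simp add: add_ac)
  qed simp
  \<comment> \<open>The surplus of one per block makes up for the head start
    \<open>a + b * t0\<close> after this many blocks.\<close>
  define q where "q = a + b * t0 + 1"
  have "a + b * (t0 + q * e) < q * K" by (simp add: K_def q_def algebra_simps)
  also have "\<dots> \<le> h2 (t0 + q * e)" by (rule h2)
  finally show ?thesis by (intro exI[of _ "t0 + q * e"]) (simp add: t0_def)
qed

text \<open>The generic kernel bound with \<open>s = n + 1\<close> gives a kernel of dimension at
  most \<open>n\<close> in degree \<open>n\<close>; by Macaulay's bound it never exceeds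
  \<open>n\<close> later, and each degree adds at most one such kernel.\<close>

lemma dim_ups_linear_bound:
  fixes M :: "('k::field) mpoly set"
  assumes inf: "infinite (UNIV :: 'k set)"
    and M: "psubspace M" "M \<subseteq> graded_part r n" and bound: "pdim M < (\<Sum>j\<le>n. j + 1)"
  shows "pdim (ups r n M k) \<le> pdim M + k * n"
proof -
  have "(\<Sum>j\<le>n. min (n + 1) (j + 1)) = (\<Sum>j\<le>n. j + 1)" by (rule sum.cong) auto
  then obtain t where t: "\<not> n + 1 \<le> pdim {v\<in>M. lshift r t v = 0}"
    using exists_good_point[OF inf finite_lshift_kernel_ge[OF M, of "n + 1"]] bound by metis
  let ?Z = "\<lambda>i. {v\<in>ups r n M i. lshift r t v = 0}"
  have Z: "psubspace (?Z i)" "?Z i \<subseteq> graded_part r (n + i)" for i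
    using subspace_kernel[OF lin_lshift subspace_ups[OF M(1)]] ups_subset[OF M(2)] by blast+
  have "pdim (?Z i) \<le> n" for i
  proof (induction i)
    case (Suc i)
    have "?Z (Suc i) \<subseteq> up r (n + i) (?Z i)" using kernel_up by simp
    then have "pdim (?Z (Suc i)) \<le> pdim (?Z i)"
      using Suc by (intro dim_le_of_subset_up[OF inf Z(1) Z(2) _ Z(1)]) auto
    then show ?case using Suc by simp
  qed (use t in simp)
  then have "pdim (ups r n M k) \<le> pdim M + (\<Sum>i<k. n)"
    by (intro dim_ups_le[OF M, where t = t and f = "\<lambda>_. n"])
  then show ?thesis by simp
qed

text \<open>The smallest prime \<open>P 2\<close> contains the degree \<open>n\<close> part of
  \<open>J\<close>, so its Hilbert function is at most the linearly bounded dimension of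
  \<open>ups\<close>; two strict inclusions make it outgrow every linear function.\<close>

lemma no_prime_chain:
  fixes P :: "nat \<Rightarrow> ('k::field) mpoly set"
  assumes inf: "infinite (UNIV :: 'k set)" and J: "ideal J (mpoly_ring r)"
    and bound: "pdim (perp r n (J \<inter> graded_part r n)) < (\<Sum>j\<le>n. j + 1)"
    and P: "\<And>i. i \<le> 2 \<Longrightarrow> primeideal (P i) (mpoly_ring r) \<and> homogeneous_ideal r (P i)"
    and chain: "P 2 \<subset> P 1" "P 1 \<subset> P 0" and P0: "P 0 \<in> Proj r" and JP: "J \<inter> graded_part r n \<subseteq> P 2"
  shows False
proof -
  let ?M = "perp r n (J \<inter> graded_part r n)"
  obtain d where d: "1 \<le> d" "\<forall>t. hilb r (P 1) t + hilb r (P 0) (t + d) \<le> hilb r (P 1) (t + d)"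
    by (rule hilb_prime_chain[OF _ _ _ _ chain(2)]) (use P in auto)
  obtain e where e: "1 \<le> e" "\<forall>t. hilb r (P 2) t + hilb r (P 1) (t + e) \<le> hilb r (P 2) (t + e)"
    by (rule hilb_prime_chain[OF _ _ _ _ chain(1)]) (use P in auto)
  obtain t where t: "n \<le> t" "pdim ?M + n * t < hilb r (P 2) t"
    using quadratic_growth[of "hilb r (P 0)" d "hilb r (P 1)" "hilb r (P 2)" e n "pdim ?M" n] hilb_pos[OF P0] d e
    by blast
  obtain k where k: "t = n + k" using t(1) le_Suc_ex by blast
  have I2: "ideal (P 2) (mpoly_ring r)" using P[of 2] by (simp add: primeideal.axioms(1))
  have "perp r (n + k) (P 2 \<inter> graded_part r (n + k)) \<subseteq> ups r n ?M k"
    by (rule perp_subset_ups[of "\<lambda>e. P 2 \<inter> graded_part r e"])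
      (use graded_ideal_var_mult[OF I2] perp_mono[of "J \<inter> graded_part r n" "P 2 \<inter> graded_part r n" r n] JP in auto)
  then have "hilb r (P 2) t \<le> pdim (ups r n ?M k)"
    unfolding k hilb_eq_dim_perp[OF I2]
    by (rule mp.dim_mono_fin[OF fin_dim_subset_graded[OF ups_subset[OF perp_subset]]])
  also have "\<dots> \<le> pdim ?M + k * n" by (rule dim_ups_linear_bound[OF inf subspace_perp perp_subset bound])
  also have "\<dots> \<le> pdim ?M + n * t" unfolding k by (simp add: algebra_simps)
  finally show False using t(2) by simp
qed

section \<open>Closed sets and dimension of the base locus\<close>

lemma closedin_zariski:
  "closedin (zariski r) C \<longleftrightarrow> (\<exists>E \<subseteq> (\<Union>d. graded_part r d). C = V_plus r E)"
proof -
  have V: "V_plus r E \<subseteq> Proj r" for E :: "'a mpoly set" by (auto simp: V_plus_def)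
  show ?thesis
    unfolding closedin_def topspace_zariski openin_zariski
  proof
    assume "C \<subseteq> Proj r \<and> (\<exists>E\<subseteq>\<Union>d. graded_part r d. Proj r - C = Proj r - V_plus r E)"
    then obtain E where E: "C \<subseteq> Proj r" "E \<subseteq> (\<Union>d. graded_part r d)" "Proj r - C = Proj r - V_plus r E" by blast
    then have "C = V_plus r E" using V[of E] by blast
    then show "\<exists>E\<subseteq>\<Union>d. graded_part r d. C = V_plus r E" using E(2) by blast
  qed (use V in blast)
qed

lemma closed_in_base_locus:
  "closedin (subtopology (zariski r) (base_locus r J n)) C \<longleftrightarrow>
    (\<exists>E \<subseteq> (\<Union>d. graded_part r d). C = {P \<in> base_locus r J n. E \<subseteq> P})"
proof -
  have "V_plus r E \<inter> base_locus r J n = {P \<in> base_locus r J n. E \<subseteq> P}" for E :: "'a mpoly set"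
    by (auto simp: V_plus_def base_locus_eq)
  then show ?thesis unfolding closedin_subtopology closedin_zariski by metis
qed

lemma topspace_base_locus: "topspace (subtopology (zariski r) (base_locus r J n)) = base_locus r J n"
  by (auto simp: topspace_zariski base_locus_eq)

text \<open>\<open>Z\<close> is the closure of the point \<open>P\<close>: a closed set containing
  \<open>P\<close> contains every larger prime of the base locus. It provides the chain of length
  0.\<close>

lemma irreducible_closure:
  fixes J :: "('k::field) mpoly set" and r n :: nat
  assumes P: "P \<in> base_locus r J n"
  defines "T \<equiv> subtopology (zariski r) (base_locus r J n)" and "Z \<equiv> {Q \<in> base_locus r J n. P \<subseteq> Q}"
  shows "closedin T Z" "irreducible_in T Z"
proof -
  have hP: "homogeneous_ideal r P" using P by (simp add: base_locus_eq Proj_def)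
  \<comment> \<open>Closed sets are described by homogeneous elements, and those of the homogeneous
    ideal \<open>P\<close> determine it.\<close>
  let ?E = "P \<inter> (\<Union>d. graded_part r d)"
  have "?E \<subseteq> Q \<longleftrightarrow> P \<subseteq> Q" if "Q \<in> base_locus r J n" for Q
  proof
    have "ideal Q (mpoly_ring r)" using that by (simp add: base_locus_eq Proj_def primeideal.axioms(1))
    then show "P \<subseteq> Q" if "?E \<subseteq> Q" by (rule homogeneous_ideal_subsetI[OF hP]) (use that in blast)
  qed blast
  then have "Z = {Q \<in> base_locus r J n. ?E \<subseteq> Q}" by (auto simp: Z_def)
  then show "closedin T Z" unfolding T_def closed_in_base_locus by blast
  have PZ: "P \<in> Z" using P by (simp add: Z_def)
  have gen: "Z \<subseteq> C" if C: "closedin T C" "P \<in> C" for C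
  proof -
    obtain E where "C = {P \<in> base_locus r J n. E \<subseteq> P}" using C(1) unfolding T_def closed_in_base_locus by blast
    then show ?thesis using C(2) by (auto simp: Z_def)
  qed
  show "irreducible_in T Z"
    unfolding irreducible_in_def
  proof (intro conjI allI impI)
    show "Z \<noteq> {}" using PZ by blast
    show "Z \<subseteq> topspace T" unfolding T_def topspace_base_locus by (auto simp: Z_def)
    fix A B assume "closedin T A" "closedin T B" "Z \<subseteq> A \<union> B"
    then show "Z \<subseteq> A \<or> Z \<subseteq> B" using PZ gen by blast
  qed
qed

text \<open>The generic point of \<open>Z\<close>: if a product of forms vanishes on
  \<open>Z\<close>, the zero loci of the factors cover \<open>Z\<close>, and irreducibility selects
  one of them.\<close>

lemma prime_of_irreducible:
  fixes J :: "('k::field) mpoly set" and r n :: nat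
  defines "T \<equiv> subtopology (zariski r) (base_locus r J n)"
  assumes Z: "irreducible_in T Z"
  shows "primeideal (\<Inter>Z) (mpoly_ring r)" "homogeneous_ideal r (\<Inter>Z)" "\<Inter>Z \<in> Proj r"
proof -
  have ne: "Z \<noteq> {}" and ZB: "Z \<subseteq> base_locus r J n"
    using Z unfolding irreducible_in_def T_def topspace_base_locus by auto
  have Zp: "primeideal P (mpoly_ring r)" "homogeneous_ideal r P" "P \<in> Proj r" if "P \<in> Z" for P
    using ZB that by (auto simp: base_locus_eq Proj_def)
  have I: "ideal P (mpoly_ring r)" if "P \<in> Z" for P using Zp(2)[OF that] by (simp add: homogeneous_ideal_def)
  have "ideal (\<Inter>Z) (mpoly_ring r)" using I ne unfolding ideal_iff by blast
  then show h: "homogeneous_ideal r (\<Inter>Z)" using Zp(2) by (auto simp: homogeneous_ideal_def)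
  obtain P where P: "P \<in> Z" using ne by blast
  have "1 \<notin> P"
    using primeideal.I_notcarr[OF Zp(1)[OF P]] ideal.one_imp_carrier[OF I[OF P]] by auto
  then have "1 \<notin> \<Inter>Z" using P by blast
  then show p: "primeideal (\<Inter>Z) (mpoly_ring r)"
  proof (rule primeideal_homogeneousI[OF h])
    fix a b :: "'k mpoly" and i j
    assume a: "a \<in> graded_part r i" and b: "b \<in> graded_part r j" and ab: "a * b \<in> \<Inter>Z"
    let ?C = "\<lambda>f. {P \<in> base_locus r J n. {f} \<subseteq> P}"
    have "closedin T (?C a)" "closedin T (?C b)"
      unfolding T_def closed_in_base_locus using a b by blast+
    moreover have "Z \<subseteq> ?C a \<union> ?C b"
    proof
      fix P assume P: "P \<in> Z"
      have "a \<in> P \<or> b \<in> P"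
        using primeideal.I_prime[OF Zp(1)[OF P], of a b] a b ab P graded_part_in_carrier by auto
      then show "P \<in> ?C a \<union> ?C b" using P ZB by blast
    qed
    ultimately have "Z \<subseteq> ?C a \<or> Z \<subseteq> ?C b" using Z unfolding irreducible_in_def by blast
    then show "a \<in> \<Inter>Z \<or> b \<in> \<Inter>Z" by blast
  qed
  have "\<not> (\<Union>d\<in>{1..}. graded_part r d) \<subseteq> \<Inter>Z" using Zp(3)[OF P] P by (auto simp: Proj_def)
  then show "\<Inter>Z \<in> Proj r" using h p by (simp add: Proj_def)
qed

text \<open>Makes the passage from closed sets to primes injective, so that strict inclusions remain
  strict.\<close>

lemma closed_eq_of_Inter:
  assumes "closedin (subtopology (zariski r) (base_locus r J n)) Z" "Z \<noteq> {}"
  shows "Z = {P \<in> base_locus r J n. \<Inter>Z \<subseteq> P}"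
proof -
  obtain E where "Z = {P \<in> base_locus r J n. E \<subseteq> P}" using assms(1) unfolding closed_in_base_locus by blast
  then show ?thesis using assms(2) by blast
qed

lemma base_locus_dim_le_1:
  fixes J :: "('k::field) mpoly set"
  assumes inf: "infinite (UNIV :: 'k set)" and J: "ideal J (mpoly_ring r)"
    and bound: "pdim (perp r n (J \<inter> graded_part r n)) < (\<Sum>j\<le>n. j + 1)"
    and ne: "base_locus r J n \<noteq> {}"
  shows "base_locus_dim r J n = 0 \<or> base_locus_dim r J n = 1"
proof -
  let ?T = "subtopology (zariski r) (base_locus r J n)"
  let ?S = "{ereal (real l) |l. \<exists>Z. (\<forall>i\<le>l. closedin ?T (Z i) \<and> irreducible_in ?T (Z i)) \<and> (\<forall>i<l. Z i \<subset> Z (Suc i))}"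
  have le1: "l \<le> 1" if Z: "\<forall>i\<le>l. closedin ?T (Z i) \<and> irreducible_in ?T (Z i)" "\<forall>i<l. Z i \<subset> Z (Suc i)" for l Z
  proof (rule ccontr)
    assume l: "\<not> l \<le> 1"
    \<comment> \<open>The three smallest members of the chain already give the forbidden chain of
      primes, in reverse order.\<close>
    have c: "closedin ?T (Z i)" "irreducible_in ?T (Z i)" if "i \<le> 2" for i using Z(1) l that by auto
    have nZ: "Z i \<noteq> {}" if "i \<le> 2" for i using c(2)[OF that] by (simp add: irreducible_in_def)
    have lt: "\<Inter>(Z (Suc i)) \<subset> \<Inter>(Z i)" if i: "i < 2" for i
    proof -
      have i2: "i \<le> 2" "Suc i \<le> 2" using i by simp_all
      have ss: "Z i \<subset> Z (Suc i)" using Z(2) l i by auto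
      have "\<Inter>(Z (Suc i)) \<noteq> \<Inter>(Z i)"
      proof
        assume eq: "\<Inter>(Z (Suc i)) = \<Inter>(Z i)"
        have "Z (Suc i) = {P \<in> base_locus r J n. \<Inter>(Z (Suc i)) \<subseteq> P}"
          by (rule closed_eq_of_Inter[OF c(1)[OF i2(2)] nZ[OF i2(2)]])
        also have "\<dots> = Z i"
          unfolding eq by (rule closed_eq_of_Inter[OF c(1)[OF i2(1)] nZ[OF i2(1)], symmetric])
        finally show False using ss by simp
      qed
      moreover have "\<Inter>(Z (Suc i)) \<subseteq> \<Inter>(Z i)" by (rule Inter_anti_mono) (use ss in simp)
      ultimately show ?thesis by (rule psubsetI[rotated])
    qed
    show False
    proof (rule no_prime_chain[OF inf J bound, of "\<lambda>i. \<Inter>(Z i)"])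
      show "primeideal (\<Inter>(Z i)) (mpoly_ring r) \<and> homogeneous_ideal r (\<Inter>(Z i))" if "i \<le> 2" for i
        using prime_of_irreducible[OF c(2)[OF that]] by blast
      show "\<Inter>(Z 2) \<subset> \<Inter>(Z 1)" using lt[of 1] unfolding Suc_1 by simp
      show "\<Inter>(Z 1) \<subset> \<Inter>(Z 0)" using lt[of 0] unfolding One_nat_def by simp
      show "\<Inter>(Z 0) \<in> Proj r" using prime_of_irreducible(3)[OF c(2)[of 0]] by simp
      have "Z 2 \<subseteq> base_locus r J n"
        using c(2)[of 2] unfolding irreducible_in_def topspace_base_locus by simp
      then show "J \<inter> graded_part r n \<subseteq> \<Inter>(Z 2)" by (auto simp: base_locus_eq)
    qed
  qed
  have "?S \<subseteq> {0, 1}"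
  proof
    fix x assume "x \<in> ?S"
    then obtain l Z where x: "x = ereal (real l)"
      and Z: "\<forall>i\<le>l. closedin ?T (Z i) \<and> irreducible_in ?T (Z i)" "\<forall>i<l. Z i \<subset> Z (Suc i)" by blast
    have "l = 0 \<or> l = 1" using le1[OF Z] by auto
    then show "x \<in> {0, 1}" unfolding x by (auto simp: zero_ereal_def one_ereal_def)
  qed
  moreover have "0 \<in> ?S"
  proof -
    obtain P where P: "P \<in> base_locus r J n" using ne by blast
    have "\<exists>Z. (\<forall>i\<le>(0 :: nat). closedin ?T (Z i) \<and> irreducible_in ?T (Z i)) \<and> (\<forall>i<0. Z i \<subset> Z (Suc i))"
    proof (intro exI[of _ "\<lambda>_. {Q \<in> base_locus r J n. P \<subseteq> Q}"] conjI allI impI)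
      fix i :: nat
      show "closedin ?T {Q \<in> base_locus r J n. P \<subseteq> Q}" by (rule irreducible_closure(1)[OF P])
      show "irreducible_in ?T {Q \<in> base_locus r J n. P \<subseteq> Q}" by (rule irreducible_closure(2)[OF P])
    qed simp
    then have "\<exists>l. (0 :: ereal) = ereal (real l) \<and> (\<exists>Z. (\<forall>i\<le>l. closedin ?T (Z i) \<and> irreducible_in ?T (Z i)) \<and> (\<forall>i<l. Z i \<subset> Z (Suc i)))"
      by (intro exI[of _ "0 :: nat"] conjI) (simp_all only: of_nat_0 zero_ereal_def)
    then show ?thesis by (rule CollectI)
  qed
  moreover have "Sup S = 0 \<or> Sup S = 1" if "S \<subseteq> {0, 1}" "0 \<in> S" for S :: "ereal set"
  proof -
    have "S = {0} \<or> S = {0, 1}" using that by blast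
    then show ?thesis by (auto simp: sup_max)
  qed
  ultimately have "Sup ?S = 0 \<or> Sup ?S = 1" by blast
  then show ?thesis unfolding base_locus_dim_def krull_dim_def .
qed

text \<open>Over a finite field, one plus the product of all \<open>x - a\<close> has no root.
  Infinitely many elements are what the choice of good parameters \<open>t\<close> in
  \<open>lshift\<close> requires.\<close>

lemma infinite_alg_closed: "infinite (UNIV :: 'k::alg_closed_field set)"
proof
  assume fin: "finite (UNIV :: 'k set)"
  define p where "p = (\<Prod>a\<in>UNIV. [:- a, 1 :: 'k:]) + 1"
  have "degree (\<Prod>a\<in>UNIV. [:- a, 1 :: 'k:]) = card (UNIV :: 'k set)"
    by (subst degree_prod_eq_sum_degree) auto
  moreover have "0 < card (UNIV :: 'k set)" using fin by (simp add: card_gt_0_iff)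
  ultimately have "0 < degree p" unfolding p_def by (subst degree_add_eq_left) auto
  then obtain x where "poly p x = 0" using alg_closed_imp_poly_has_root by blast
  moreover have "poly (\<Prod>a\<in>UNIV. [:- a, 1 :: 'k:]) x = 0"
    unfolding poly_prod using fin by (auto intro!: prod_zero bexI[of _ x])
  ultimately show False by (simp add: p_def)
qed

theorem theorem3p1:
  fixes r n :: nat and J :: "('k::alg_closed_field) mpoly set"
  assumes "1 \<le> r" and "1 \<le> n" and "homogeneous_ideal r J"
  shows
    "((\<exists>ks. is_binom_expansion n (hilbert_function r J n) ks \<and> hd ks = n + 1) \<longleftrightarrow>
       n + 1 \<le> hilbert_function r J n \<and> hilbert_function r J n < ((n + 2) choose 2)) \<and>
     ((\<exists>ks. is_binom_expansion n (hilbert_function r J n) ks \<and> hd ks = n + 1) \<and>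
       int (hilbert_function r J (n + 1)) = int ((hilbert_function r J n)\<^bsup>\<langle>n\<rangle>\<^esup>) - 1 \<longrightarrow>
      base_locus r J n \<noteq> {} \<and>
      (base_locus_dim r J n = 0 \<or> base_locus_dim r J n = 1) \<and>
      (base_locus_dim r J n = ereal (of_int (MG_dim (hilbert_function r J n) n - 1)) \<or>
       base_locus_dim r J n = ereal (of_int (MG_dim (hilbert_function r J n) n))))"
proof (intro conjI impI; (elim conjE)?)
  show "(\<exists>ks. is_binom_expansion n (hilbert_function r J n) ks \<and> hd ks = n + 1) \<longleftrightarrow>
       n + 1 \<le> hilbert_function r J n \<and> hilbert_function r J n < ((n + 2) choose 2)"
    by (rule expansion_iff_bounds[OF assms(2)])
next
  let ?h = "hilbert_function r J n"
  assume ex: "\<exists>ks. is_binom_expansion n ?h ks \<and> hd ks = n + 1"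
    and growth: "int (hilbert_function r J (n + 1)) = int (?h\<^bsup>\<langle>n\<rangle>\<^esup>) - 1"
  obtain ks where ks: "is_binom_expansion n ?h ks" "hd ks = n + 1" using ex by blast
  have be: "binom_expansion n ?h = ks"
    unfolding binom_expansion_def using ks(1) is_binom_expansion_unique by blast
  obtain \<delta> where \<delta>: "\<delta> \<le> n" "(\<Sum>l<length ks. Suc (ks ! l) choose Suc (n - l)) = ?h + \<delta>"
    "?h < (\<Sum>j\<le>n. min (\<delta> + 1) (j + 1))" "1 \<le> \<delta>"
    using macaulay_growth_small[OF ks(1)] ks(2) by auto
  have "?h\<^bsup>\<langle>n\<rangle>\<^esup> = ?h + \<delta>" using \<delta>(2) by (simp add: macaulay_bound_def be)
  then have growth': "?h + \<delta> = hilbert_function r J (n + 1) + 1" using growth by linarith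
  have J: "ideal J (mpoly_ring r)" using assms(3) by (simp add: homogeneous_ideal_def)
  have hp: "pdim (perp r t (J \<inter> graded_part r t)) = hilbert_function r J t" for t
    using dim_perp[OF subspace_graded_ideal[OF J, of t] Int_lower2] hilbert_function_eq[OF J, of t] by simp
  let ?M = "perp r n (J \<inter> graded_part r n)"
  note M = subspace_perp[of r n "J \<inter> graded_part r n"] perp_subset[of r n "J \<inter> graded_part r n"]
  note inf = infinite_alg_closed[where ?'k = 'k]
  \<comment> \<open>\<open>J\<close> may have new generators in degree \<open>n + 1\<close>, so the
    Hilbert function there only bounds the dimension of the extension from below, which is the
    direction that \<open>dim_ups_pos\<close> asks for.\<close>
  have "perp r (n + 1) (J \<inter> graded_part r (n + 1)) \<subseteq> ups r n ?M 1"
    by (rule perp_subset_ups[of "\<lambda>e. J \<inter> graded_part r e"]) (use graded_ideal_var_mult[OF J] in auto)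
  then have "hilbert_function r J (n + 1) \<le> pdim (up r n ?M)"
    unfolding hp[symmetric] using mp.dim_mono_fin[OF fin_dim_subset_graded[OF up_subset]] by simp
  then have up: "pdim ?M + \<delta> \<le> pdim (up r n ?M) + 1" using growth' hp[of n] by simp
  have "?h \<ge> n + 1" using is_binom_expansion_bounds[OF ks(1)] ks(2) binomial_Suc_n[of n] by simp
  then have "0 < pdim (ups r n ?M k)" for k
    using dim_ups_pos[OF inf M \<delta>(4,1) _ up] \<delta>(3) hp[of n] by simp
  then show ne: "base_locus r J n \<noteq> {}" by (rule base_locus_nonempty[OF assms(2) J])
  \<comment> \<open>The dimension estimate uses the coarser bound \<open>(n + 2) choose 2\<close>,
    here as a sum of \<open>j + 1\<close>.\<close>
  have "(\<Sum>j\<le>n. min (\<delta> + 1) (j + 1)) \<le> (\<Sum>j\<le>n. j + 1)" by (rule sum_mono) simp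
  then have "pdim ?M < (\<Sum>j\<le>n. j + 1)" using \<delta>(3) hp[of n] by simp
  then show dim: "base_locus_dim r J n = 0 \<or> base_locus_dim r J n = 1"
    by (rule base_locus_dim_le_1[OF inf J _ ne])
  have "MG_dim ?h n = 1" by (simp add: MG_dim_def be ks(2))
  then show "base_locus_dim r J n = ereal (of_int (MG_dim ?h n - 1)) \<or>
       base_locus_dim r J n = ereal (of_int (MG_dim ?h n))"
    using dim by (simp add: zero_ereal_def one_ereal_def)
qed

end
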